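(* Let $k \ge 3$ and $1 \le m \le k-2$ be integers. Let $A$ be a differential operator in $x$ of order $\le k-2$ (with coefficients in $\overline{C}^{\infty}(\mathbb{R})$) which is self-adjoint in the sense that $A \equiv A^{\ast} \pmod{S^{0}}$. Let $b_{j} \in \overline{C}^{\infty}(\mathbb{R})$ $(0 \le j \le m)$ be given functions. If the Cauchy problem \[ \begin{cases} Lu := \left( D_{t} - D_{x}^{k} - A - \sum_{j=0}^{m} b_{j}(x) D_{x}^{j} \right) u = 0, & (x,t) \in \mathbb{R}^{2}, \\ u(x, t=0) = u_{0}(x), & x \in \mathbb{R}, \end{cases} \] is $L^{2}$-wellposed, then there is a constant $C>0$ depending only on $L$ such that for all $x, y \in \mathbb{R}$, \[ \left| \int_{x}^{y} \mathrm{Im}\big( b_{m}(\widetilde{x}) \big) \, d\widetilde{x} \right| \le C |x-y|^{\frac{k-1-m}{k-1}} . \]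
   Context: $D_{t} = \frac{1}{i}\partial_{t}$ and $D_{x} = \frac{1}{i}\partial_{x}$. $\overline{C}^{\infty}(\mathbb{R})$ is the set of complex-valued smooth functions on $\mathbb{R}$ all of whose derivatives of every order (including order $0$) are bounded. $A^{\ast}$ is the formal $L^{2}$-adjoint of $A$. $S^{0}$ is the class of pseudodifferential operators $Bf(x) = \int_{\mathbb{R}} e^{ix\xi} b(x,\xi) \hat{f}(\xi)\, d\xi$ with smooth symbol $b$ on $\mathbb{R}^{2}$ such that for all integers $\alpha,\beta\ge 0$ there is a constant $C_{\alpha,\beta}$ with $|\partial_{x}^{\alpha}\partial_{\xi}^{\beta} b(x,\xi)| \le C_{\alpha,\beta}(1+|\xi|^{2})^{-\beta/2}$ for all $(x,\xi) \in \mathbb{R}^2$ (with the Fourier transform normalized so that symbol $1$ gives the identity). $A \equiv B \pmod{S^{0}}$ means $A-B \in S^{0}$. $L^{2}$-wellposedness of the Cauchy problem $Lu=0$, $u(t=0)=u_0$ means: for every $T>0$ and every $u_{0} \in L^{2}(\mathbb{R})$ there is a unique $u \in C([-T,T]; L^{2}(\mathbb{R}))$ solving $Lu=0$ in the sense of distributions with $u(\cdot,0)=u_{0}$, and there is a constant $M$ depending only on $L$ and $T$ such that $\|u(t)\|_{L^{2}} \le M \|u_{0}\|_{L^{2}}$ for all $|t| \le T$. *)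

theory Defs
  imports "HOL-Analysis.Analysis"
begin

definition dir_deriv :: "'a::real_normed_vector \<Rightarrow> ('a \<Rightarrow> 'b::real_normed_vector) \<Rightarrow> 'a \<Rightarrow> 'b"
  where "dir_deriv v f z = frechet_derivative f (at z) v"

text \<open>On a finite-dimensional space, Frechet differentiability of all iterated directional
  derivatives is the same as being infinitely often continuously differentiable.\<close>

definition smooth :: "('a::real_normed_vector \<Rightarrow> 'b::real_normed_vector) \<Rightarrow> bool"
  where "smooth f \<longleftrightarrow> (\<forall>vs. foldr dir_deriv vs f differentiable_on UNIV)"

definition Cbar_infinity :: "(real \<Rightarrow> complex) set"
  where "Cbar_infinity = {f. smooth f \<and> (\<forall>n. bounded (range ((dir_deriv 1 ^^ n) f)))}"

definition schwartz :: "(real \<Rightarrow> complex) set"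
  where "schwartz =
    {f. smooth f \<and> (\<forall>n j. bounded (range (\<lambda>x. complex_of_real (x ^ n) * (dir_deriv 1 ^^ j) f x)))}"

text \<open>An operator is a map on functions of which only the restriction to the Schwartz
  space is relevant.\<close>

type_synonym op1 = "(real \<Rightarrow> complex) \<Rightarrow> real \<Rightarrow> complex"

definition D1 :: op1
  where "D1 f = (\<lambda>x. (1 / \<i>) * dir_deriv 1 f x)"

definition diff_op :: "nat \<Rightarrow> (nat \<Rightarrow> real \<Rightarrow> complex) \<Rightarrow> op1"
  where "diff_op n a f = (\<lambda>x. \<Sum>j\<le>n. a j x * (D1 ^^ j) f x)"

definition L2_inner :: "(real \<Rightarrow> complex) \<Rightarrow> (real \<Rightarrow> complex) \<Rightarrow> complex"
  where "L2_inner f g = (LINT x|lborel. f x * cnj (g x))"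

definition formal_adjoint :: "op1 \<Rightarrow> op1 \<Rightarrow> bool"
  where "formal_adjoint A B \<longleftrightarrow>
    (\<forall>g\<in>schwartz. B g \<in> schwartz) \<and>
    (\<forall>f\<in>schwartz. \<forall>g\<in>schwartz. L2_inner (A f) g = L2_inner f (B g))"

text \<open>The factor \<open>1 / (2 * pi)\<close> sits in the transform, so that the symbol 1 quantizes to
  the identity without any factor in the inversion integral.\<close>

definition fourier :: "(real \<Rightarrow> complex) \<Rightarrow> real \<Rightarrow> complex"
  where "fourier f \<xi> =
    complex_of_real (1 / (2 * pi)) * (LINT x|lborel. exp (- \<i> * complex_of_real (x * \<xi>)) * f x)"

definition symbol_S0 :: "(real \<times> real \<Rightarrow> complex) \<Rightarrow> bool"
  where "symbol_S0 b \<longleftrightarrow> smooth b \<and>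
    (\<forall>\<alpha> \<beta>. \<exists>C. \<forall>x \<xi>.
      cmod ((dir_deriv (1, 0) ^^ \<alpha>) ((dir_deriv (0, 1) ^^ \<beta>) b) (x, \<xi>))
        \<le> C * (1 + \<bar>\<xi>\<bar>\<^sup>2) powr (- real \<beta> / 2))"

definition S0 :: "op1 set"
  where "S0 = {B. \<exists>b. symbol_S0 b \<and>
    (\<forall>f\<in>schwartz. \<forall>x.
      B f x = (LINT \<xi>|lborel. exp (\<i> * complex_of_real (x * \<xi>)) * b (x, \<xi>) * fourier f \<xi>))}"

definition equiv_mod_S0 :: "op1 \<Rightarrow> op1 \<Rightarrow> bool"
  where "equiv_mod_S0 A B \<longleftrightarrow> (\<lambda>f x. A f x - B f x) \<in> S0"

text \<open>On Schwartz functions the formal adjoint is unique, and for a differential operator with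
  coefficients in \<open>Cbar_infinity\<close> it exists.\<close>

definition self_adjoint_mod_S0 :: "op1 \<Rightarrow> bool"
  where "self_adjoint_mod_S0 A \<longleftrightarrow> (\<exists>A'. formal_adjoint A A' \<and> equiv_mod_S0 A A')"

definition test_functions :: "(real \<times> real) set \<Rightarrow> (real \<times> real \<Rightarrow> complex) set"
  where "test_functions U =
    {\<phi>. smooth \<phi> \<and> compact (closure {z. \<phi> z \<noteq> 0}) \<and> closure {z. \<phi> z \<noteq> 0} \<subseteq> U}"

text \<open>Points of the plane are written (x, t). Derivatives of distributions and their products
  with functions of x are defined by duality, for the bilinear pairing without conjugation.\<close>

type_synonym distr = "(real \<times> real \<Rightarrow> complex) \<Rightarrow> complex"

definition distr_Dx :: "distr \<Rightarrow> distr"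
  where "distr_Dx \<Lambda> \<phi> = - \<Lambda> (\<lambda>z. (1 / \<i>) * dir_deriv (1, 0) \<phi> z)"

definition distr_Dt :: "distr \<Rightarrow> distr"
  where "distr_Dt \<Lambda> \<phi> = - \<Lambda> (\<lambda>z. (1 / \<i>) * dir_deriv (0, 1) \<phi> z)"

definition distr_mult :: "(real \<Rightarrow> complex) \<Rightarrow> distr \<Rightarrow> distr"
  where "distr_mult c \<Lambda> \<phi> = \<Lambda> (\<lambda>z. c (fst z) * \<phi> z)"

definition distr_diff_op :: "nat \<Rightarrow> (nat \<Rightarrow> real \<Rightarrow> complex) \<Rightarrow> distr \<Rightarrow> distr"
  where "distr_diff_op n a \<Lambda> \<phi> = (\<Sum>j\<le>n. distr_mult (a j) ((distr_Dx ^^ j) \<Lambda>) \<phi>)"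

text \<open>The operator \<open>L = D\<^sub>t - D\<^sub>x\<^sup>k - A - \<Sum>\<^sub>j b\<^sub>j D\<^sub>x\<^sup>j\<close>, where A has coefficients a.\<close>

definition distr_L ::
    "nat \<Rightarrow> nat \<Rightarrow> (nat \<Rightarrow> real \<Rightarrow> complex) \<Rightarrow> (nat \<Rightarrow> real \<Rightarrow> complex) \<Rightarrow> distr \<Rightarrow> distr"
  where "distr_L k m a b \<Lambda> \<phi> =
    distr_Dt \<Lambda> \<phi> - (distr_Dx ^^ k) \<Lambda> \<phi> - distr_diff_op (k - 2) a \<Lambda> \<phi> - distr_diff_op m b \<Lambda> \<phi>"

text \<open>A curve u in \<open>L\<^sup>2\<close> is represented by a choice of \<open>u t\<close> for each t. The representatives
  need not be jointly measurable; the iterated integral is well defined, since the inner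
  integral is continuous in t if the curve is.\<close>

definition distr_of :: "(real \<Rightarrow> real \<Rightarrow> complex) \<Rightarrow> distr"
  where "distr_of u \<phi> = (LINT t|lborel. LINT x|lborel. u t x * \<phi> (x, t))"

definition L2 :: "(real \<Rightarrow> complex) set"
  where "L2 = {f. f \<in> borel_measurable lborel \<and> integrable lborel (\<lambda>x. (cmod (f x))\<^sup>2)}"

definition L2_norm :: "(real \<Rightarrow> complex) \<Rightarrow> real"
  where "L2_norm f = sqrt (LINT x|lborel. (cmod (f x))\<^sup>2)"

definition L2_curve :: "real \<Rightarrow> (real \<Rightarrow> real \<Rightarrow> complex) \<Rightarrow> bool"
  where "L2_curve T u \<longleftrightarrow>
    (\<forall>t\<in>{-T..T}. u t \<in> L2 \<and>
      ((\<lambda>s. L2_norm (\<lambda>x. u s x - u t x)) \<longlongrightarrow> 0) (at t within {-T..T}))"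

definition cauchy_solution ::
    "(distr \<Rightarrow> distr) \<Rightarrow> real \<Rightarrow> (real \<Rightarrow> complex) \<Rightarrow> (real \<Rightarrow> real \<Rightarrow> complex) \<Rightarrow> bool"
  where "cauchy_solution L T u0 u \<longleftrightarrow>
    L2_curve T u \<and>
    (\<forall>\<phi>\<in>test_functions (UNIV \<times> {-T<..<T}). L (distr_of u) \<phi> = 0) \<and>
    (AE x in lborel. u 0 x = u0 x)"

definition L2_wellposed :: "(distr \<Rightarrow> distr) \<Rightarrow> bool"
  where "L2_wellposed L \<longleftrightarrow>
    (\<forall>T>0.
      (\<forall>u0\<in>L2. \<exists>u. cauchy_solution L T u0 u \<and>
        (\<forall>v. cauchy_solution L T u0 v \<longrightarrow> (\<forall>t\<in>{-T..T}. AE x in lborel. v t x = u t x))) \<and>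
      (\<exists>M. \<forall>u0\<in>L2. \<forall>u. cauchy_solution L T u0 u \<longrightarrow>
        (\<forall>t\<in>{-T..T}. L2_norm (u t) \<le> M * L2_norm u0)))"

end

theory Submission
  imports Defs "HOL-Probability.Sinc_Integral" "HOL-Computational_Algebra.Fundamental_Theorem_Algebra"
begin

text \<open>Write \<open>P\<close> for the spatial part of the operator. A formal phase \<open>\<phi>\<close> with
  \<open>\<phi>' = \<xi> + O(\<xi>\<^bsup>-1\<^esup>)\<close>, a finite expansion in powers of \<open>\<xi>\<close>, satisfies
  \<open>P e\<^bsup>i\<phi>\<^esup> = (\<xi>\<^sup>k + O(1)) e\<^bsup>i\<phi>\<^esup>\<close>. Cutting \<open>e\<^bsup>i\<phi>\<^esup>\<close> off to a moving window of width w gives a wave packet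
  that solves the equation up to small errors while it travels a distance of order \<open>\<xi> w\<close>.
  An energy estimate \<open>\<parallel>u(t)\<parallel> \<le> M (\<parallel>u(0)\<parallel> + \<bar>t\<bar> sup \<parallel>\<partial>\<^sub>t u - \<i> P u\<parallel>)\<close> then bounds the growth of
  \<open>\<bar>e\<^bsup>i\<phi>\<^esup>\<bar>\<close> from scale w to scale \<open>\<xi> w\<close>. Starting from \<open>w = 1\<close>, finitely many steps reach the scale
  \<open>\<xi>\<^bsup>k-1\<^esup>\<close>: the variation of \<open>Im \<phi>\<close> over distances up to \<open>\<xi>\<^bsup>k-1\<^esup>\<close> is bounded, uniformly in \<open>\<xi>\<close>.

  The energy estimate holds for \<open>P\<close> by wellposedness and Duhamel's principle, and for
  \<open>P\<^sub>0 = D\<^sup>k + A\<close> because \<open>A - A\<^sup>*\<close>, a differential operator in \<open>S\<^sup>0\<close>, has no terms of positive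
  order. Hence the imaginary part of the difference of the two phases is bounded too. This
  difference is \<open>- \<xi>\<^bsup>m-k+1\<^esup> / k\<close> times a primitive of \<open>b\<^sub>m\<close> plus lower powers of \<open>\<xi>\<close>; letting \<open>\<xi>\<close>
  vary above \<open>\<bar>x - y\<bar>\<^bsup>1/(k-1)\<^esup>\<close> isolates the leading coefficient.\<close>

section \<open>Smooth functions\<close>

text \<open>Two obstacles shape the proof. First, the derivatives of the cutoff damage a packet of
  width w at relative rate of order \<open>\<xi>^(k-2) / w\<close>, while it moves with speed of
  order \<open>\<xi>^(k-1)\<close>; this is what limits its range to about \<open>\<xi> w\<close>
  and forces the induction over scales. The variation bound reached at one scale says that the
  modulus is nearly constant on the window used at the next one. Second, the phase contains many
  powers of \<xi>, and A may contribute imaginary parts as well. Comparing with the phase of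
  \<open>P\<^sub>0\<close> removes all of these above the order at which \<open>b m\<close> enters,
  so the phases never have to be computed explicitly. The exponent arises at distance
  \<open>\<xi>^(k-1)\<close>: the \<open>b m\<close> part of the phase has size
  \<open>\<xi>^(m-k+1)\<close> times the integral, so boundedness gives the power k-1-m of \<xi>.
  The lower powers of \<xi> have no a priori bound over such distances; they are eliminated by
  combining the estimates at \<xi> and 2\<xi>. Distances below 1 follow from the boundedness of
  \<open>b m\<close>. Wellposedness speaks of distributions and representatives. It is first
  translated into weak solutions with values in a Hilbert space, tested against functions of x
  alone.\<close>

lemma dir_deriv_has_derivative: "(f has_derivative f') (at z) \<Longrightarrow> dir_deriv v f z = f' v"
  unfolding dir_deriv_def using frechet_derivative_at by metis

lemma differentiable_on_UNIV_iff: "f differentiable_on UNIV \<longleftrightarrow> (\<forall>z. f differentiable (at z))"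
  by (simp add: differentiable_on_def)

lemma has_derivative_dir_deriv:
  "f differentiable (at z) \<Longrightarrow> (f has_derivative (\<lambda>v. dir_deriv v f z)) (at z)"
  unfolding dir_deriv_def by (simp add: frechet_derivative_works)

text \<open>\<open>smooth\<close> behaves like a greatest fixed point: it suffices to lie in some
  class of differentiable functions closed under all directional derivatives. Most closure
  properties below only exhibit such a class.\<close>

lemma smooth_coinduct:
  assumes "f \<in> X"
    and "\<And>f. f \<in> X \<Longrightarrow> f differentiable_on UNIV"
    and "\<And>f v. f \<in> X \<Longrightarrow> dir_deriv v f \<in> X"
  shows "smooth f"
proof -
  have "foldr dir_deriv vs f \<in> X" for vs
    by (induction vs) (use assms in auto)
  then show ?thesis unfolding smooth_def using assms(2) by blast
qed

lemma smooth_dir_deriv: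
  assumes "smooth f" shows "smooth (dir_deriv v f)"
  unfolding smooth_def
proof
  fix vs
  have "foldr dir_deriv (vs @ [v]) f differentiable_on UNIV" using assms unfolding smooth_def by blast
  then show "foldr dir_deriv vs (dir_deriv v f) differentiable_on UNIV" by simp
qed

lemma smooth_differentiable:
  assumes "smooth f" shows "f differentiable (at z)"
proof -
  have "foldr dir_deriv [] f differentiable_on UNIV" using assms unfolding smooth_def by blast
  then show ?thesis by (simp add: differentiable_on_UNIV_iff)
qed

lemma smooth_continuous: "smooth f \<Longrightarrow> continuous_on S f"
  by (metis differentiable_imp_continuous_within smooth_differentiable continuous_at_imp_continuous_on)

lemma smooth_has_derivative:
  "smooth f \<Longrightarrow> (f has_derivative (\<lambda>v. dir_deriv v f z)) (at z)"
  by (simp add: has_derivative_dir_deriv smooth_differentiable)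

lemma smooth_const [simp]: "smooth (\<lambda>z. c)"
proof (rule smooth_coinduct[where X = "range (\<lambda>c z. c)"])
  fix f :: "'a \<Rightarrow> 'b" and v assume "f \<in> range (\<lambda>c z. c)"
  then obtain c where f: "f = (\<lambda>z. c)" by auto
  have "dir_deriv v f = (\<lambda>z. 0)"
    unfolding f by (rule ext) (rule dir_deriv_has_derivative, simp)
  then show "dir_deriv v f \<in> range (\<lambda>c z. c)" by blast
qed auto

lemma dir_deriv_add:
  assumes "f differentiable (at z)" "g differentiable (at z)"
  shows "dir_deriv v (\<lambda>z. f z + g z) z = dir_deriv v f z + dir_deriv v g z"
  by (rule dir_deriv_has_derivative)
    (intro has_derivative_add has_derivative_dir_deriv assms)

lemma smooth_add:
  assumes "smooth f" "smooth g" shows "smooth (\<lambda>z. f z + g z)"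
proof (rule smooth_coinduct[where X = "{\<lambda>z. f z + g z | f g. smooth f \<and> smooth g}"])
  show "(\<lambda>z. f z + g z) \<in> {\<lambda>z. f z + g z | f g. smooth f \<and> smooth g}" using assms by auto
next
  fix h :: "'a \<Rightarrow> 'b" assume "h \<in> {\<lambda>z. f z + g z | f g. smooth f \<and> smooth g}"
  then show "h differentiable_on UNIV"
    by (auto simp: differentiable_on_UNIV_iff smooth_differentiable intro!: differentiable_add)
next
  fix h :: "'a \<Rightarrow> 'b" and v assume "h \<in> {\<lambda>z. f z + g z | f g. smooth f \<and> smooth g}"
  then obtain f g where h: "h = (\<lambda>z. f z + g z)" "smooth f" "smooth g" by blast
  have "dir_deriv v h = (\<lambda>z. dir_deriv v f z + dir_deriv v g z)"
    unfolding h by (rule ext) (intro dir_deriv_add smooth_differentiable h)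
  then show "dir_deriv v h \<in> {\<lambda>z. f z + g z | f g. smooth f \<and> smooth g}"
    using h smooth_dir_deriv by blast
qed

lemma smooth_sum:
  "(\<And>i. i \<in> I \<Longrightarrow> smooth (f i)) \<Longrightarrow> smooth (\<lambda>z. \<Sum>i\<in>I. f i z)"
  by (induction I rule: infinite_finite_induct) (auto intro: smooth_add)

lemma dir_deriv_linear:
  assumes "bounded_linear L" "f differentiable (at z)"
  shows "dir_deriv v (\<lambda>z. L (f z)) z = L (dir_deriv v f z)"
  by (rule dir_deriv_has_derivative)
    (rule bounded_linear.has_derivative[OF assms(1) has_derivative_dir_deriv[OF assms(2)]])

lemma smooth_linear:
  fixes f :: "'a::real_normed_vector \<Rightarrow> 'b::real_normed_vector" and L :: "'b \<Rightarrow> 'c::real_normed_vector"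
  assumes "bounded_linear L" "smooth f" shows "smooth (\<lambda>z. L (f z))"
proof (rule smooth_coinduct[where X = "{\<lambda>z. L (f z) | f. smooth f}"])
  show "(\<lambda>z. L (f z)) \<in> {\<lambda>z. L (f z) | f. smooth f}" using assms by auto
next
  fix h :: "'a \<Rightarrow> 'c" assume "h \<in> {\<lambda>z. L (f z) | f. smooth f}"
  then obtain f where "h = (\<lambda>z. L (f z))" "smooth f" by blast
  then show "h differentiable_on UNIV"
    using bounded_linear.has_derivative[OF assms(1) smooth_has_derivative]
    unfolding differentiable_on_UNIV_iff differentiable_def by blast
next
  fix h :: "'a \<Rightarrow> 'c" and v assume "h \<in> {\<lambda>z. L (f z) | f. smooth f}"
  then obtain f where h: "h = (\<lambda>z. L (f z))" "smooth f" by blast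
  have "dir_deriv v h = (\<lambda>z. L (dir_deriv v f z))"
    unfolding h by (rule ext) (intro dir_deriv_linear smooth_differentiable h assms)
  then show "dir_deriv v h \<in> {\<lambda>z. L (f z) | f. smooth f}"
    using h smooth_dir_deriv by blast
qed

lemma has_derivative_affine:
  fixes f :: "'a::real_normed_vector \<Rightarrow> 'c::real_normed_vector"
  assumes "smooth f" "bounded_linear B"
  shows "((\<lambda>x. f (a + B x)) has_derivative (\<lambda>v. dir_deriv (B v) f (a + B x))) (at x)"
proof -
  have 1: "((\<lambda>x. a + B x) has_derivative B) (at x)"
    using assms(2) by (auto intro!: derivative_eq_intros bounded_linear.has_derivative[OF assms(2)])
  show ?thesis
    by (rule has_derivative_compose[OF 1 smooth_has_derivative[OF assms(1)]])
qed

lemma dir_deriv_affine: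
  assumes "smooth f" "bounded_linear B"
  shows "dir_deriv v (\<lambda>x. f (a + B x)) = (\<lambda>x. dir_deriv (B v) f (a + B x))"
  by (rule ext) (rule dir_deriv_has_derivative[OF has_derivative_affine[OF assms]])

lemma smooth_affine:
  fixes f :: "'b::real_normed_vector \<Rightarrow> 'c::real_normed_vector" and B :: "'a::real_normed_vector \<Rightarrow> 'b"
  assumes "smooth f" "bounded_linear B"
  shows "smooth (\<lambda>x. f (a + B x))"
proof (rule smooth_coinduct[where X = "{\<lambda>x. f (a + B x) | f. smooth f}"])
  show "(\<lambda>x. f (a + B x)) \<in> {\<lambda>x. f (a + B x) | f. smooth f}" using assms by auto
next
  fix h :: "'a \<Rightarrow> 'c" assume "h \<in> {\<lambda>x. f (a + B x) | f. smooth f}"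
  then show "h differentiable_on UNIV"
    using has_derivative_affine[OF _ assms(2)]
    unfolding differentiable_on_UNIV_iff differentiable_def by blast
next
  fix h :: "'a \<Rightarrow> 'c" and v assume "h \<in> {\<lambda>x. f (a + B x) | f. smooth f}"
  then obtain f where h: "h = (\<lambda>x. f (a + B x))" "smooth f" by blast
  then show "dir_deriv v h \<in> {\<lambda>x. f (a + B x) | f. smooth f}"
    using dir_deriv_affine[OF h(2) assms(2)] smooth_dir_deriv[OF h(2)] by blast
qed

lemma smooth_bounded_linear:
  assumes "bounded_linear B" shows "smooth B"
proof (rule smooth_coinduct[where X = "insert B (range (\<lambda>c z. c))"])
  fix f v assume "f \<in> insert B (range (\<lambda>c z. c))"
  moreover have "dir_deriv v B = (\<lambda>z. B v)"
    by (rule ext) (rule dir_deriv_has_derivative[OF bounded_linear_imp_has_derivative[OF assms]])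
  moreover have "dir_deriv v (\<lambda>z. c) = (\<lambda>z. 0)" for c :: 'b
    by (rule ext) (rule dir_deriv_has_derivative, simp)
  ultimately show "dir_deriv v f \<in> insert B (range (\<lambda>c z. c))" by auto
next
  fix f assume "f \<in> insert B (range (\<lambda>c z. c))"
  then show "f differentiable_on UNIV"
    using assms bounded_linear_imp_differentiable_on by auto
qed simp

lemma dir_deriv_mult:
  fixes f g :: "'a::real_normed_vector \<Rightarrow> complex"
  assumes "f differentiable (at z)" "g differentiable (at z)"
  shows "dir_deriv v (\<lambda>z. f z * g z) z = f z * dir_deriv v g z + dir_deriv v f z * g z"
  by (rule dir_deriv_has_derivative)
    (intro has_derivative_mult has_derivative_dir_deriv assms)

text \<open>By the Leibniz rule products alone are not closed under differentiation, but finite sums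
  of products are.\<close>

inductive_set product_sums :: "('a::real_normed_vector \<Rightarrow> complex) set" where
  product: "smooth f \<Longrightarrow> smooth g \<Longrightarrow> (\<lambda>z. f z * g z) \<in> product_sums"
| add: "f \<in> product_sums \<Longrightarrow> g \<in> product_sums \<Longrightarrow> (\<lambda>z. f z + g z) \<in> product_sums"

lemma product_sums_differentiable: "f \<in> product_sums \<Longrightarrow> f differentiable (at z)"
  by (induction rule: product_sums.induct)
    (auto simp: smooth_differentiable intro!: differentiable_add differentiable_mult)

lemma product_sums_dir_deriv: "f \<in> product_sums \<Longrightarrow> dir_deriv v f \<in> product_sums"
proof (induction rule: product_sums.induct)
  case (product f g)
  have "dir_deriv v (\<lambda>z. f z * g z) = (\<lambda>z. f z * dir_deriv v g z + dir_deriv v f z * g z)"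
    by (rule ext) (intro dir_deriv_mult smooth_differentiable product)
  also have "\<dots> \<in> product_sums"
    by (intro product_sums.intros product smooth_dir_deriv)
  finally show ?case .
next
  case (add f g)
  have "dir_deriv v (\<lambda>z. f z + g z) = (\<lambda>z. dir_deriv v f z + dir_deriv v g z)"
    by (rule ext) (intro dir_deriv_add product_sums_differentiable add)
  also have "\<dots> \<in> product_sums"
    by (intro product_sums.intros add)
  finally show ?case .
qed

lemma smooth_mult:
  fixes f g :: "'a::real_normed_vector \<Rightarrow> complex"
  assumes "smooth f" "smooth g" shows "smooth (\<lambda>z. f z * g z)"
  by (rule smooth_coinduct[where X = product_sums])
    (auto intro: product_sums.product assms product_sums_dir_deriv product_sums_differentiable
      simp: differentiable_on_UNIV_iff)

lemma dir_deriv_exp: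
  fixes f :: "'a::real_normed_vector \<Rightarrow> complex"
  assumes "f differentiable (at z)"
  shows "((\<lambda>z. exp (f z)) has_derivative (\<lambda>v. dir_deriv v f z * exp (f z))) (at z)"
proof -
  have "((\<lambda>z. exp (f z)) has_derivative (\<lambda>v. exp (f z) * dir_deriv v f z)) (at z)"
    by (rule has_derivative_compose[OF has_derivative_dir_deriv[OF assms], of exp "\<lambda>w. exp (f z) * w"])
      (use DERIV_exp[of "f z"] in \<open>simp add: has_field_derivative_def\<close>)
  then show ?thesis by (simp add: mult.commute)
qed

lemma smooth_exp:
  fixes f :: "'a::real_normed_vector \<Rightarrow> complex"
  assumes f: "smooth f" shows "smooth (\<lambda>z. exp (f z))"
\<comment> \<open>Differentiation changes only the prefactor: \<open>g\<close> becomes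
  \<open>g * dir_deriv v f + dir_deriv v g\<close>.\<close>
proof (rule smooth_coinduct[where X = "{\<lambda>z. g z * exp (f z) | g. smooth g}"])
  show "(\<lambda>z. exp (f z)) \<in> {\<lambda>z. g z * exp (f z) | g. smooth g}"
    by (rule CollectI, rule exI[of _ "\<lambda>z. 1"]) simp
next
  have d: "(\<lambda>z. exp (f z)) differentiable (at z)" for z
    using dir_deriv_exp[OF smooth_differentiable[OF f]] differentiable_def by blast
  {
    fix h :: "'a \<Rightarrow> complex" assume "h \<in> {\<lambda>z. g z * exp (f z) | g. smooth g}"
    then show "h differentiable_on UNIV"
      using d by (auto simp: differentiable_on_UNIV_iff smooth_differentiable intro!: differentiable_mult)
  next
    fix h :: "'a \<Rightarrow> complex" and v assume "h \<in> {\<lambda>z. g z * exp (f z) | g. smooth g}"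
    then obtain g where h: "h = (\<lambda>z. g z * exp (f z))" "smooth g" by blast
    have "dir_deriv v h = (\<lambda>z. (g z * dir_deriv v f z + dir_deriv v g z) * exp (f z))"
      unfolding h using dir_deriv_mult[OF smooth_differentiable[OF h(2)] d]
        dir_deriv_has_derivative[OF dir_deriv_exp[OF smooth_differentiable[OF f]]]
      by (auto simp: algebra_simps)
    moreover have "smooth (\<lambda>z. g z * dir_deriv v f z + dir_deriv v g z)"
      by (intro smooth_add smooth_mult smooth_dir_deriv h f)
    ultimately show "dir_deriv v h \<in> {\<lambda>z. g z * exp (f z) | g. smooth g}"
      by (intro CollectI exI[of _ "\<lambda>z. g z * dir_deriv v f z + dir_deriv v g z"]) simp
  }
qed

subsection \<open>One variable\<close>

lemma has_vector_derivative_dir_deriv: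
  fixes f :: "real \<Rightarrow> 'b::real_normed_vector"
  assumes "f differentiable (at x)"
  shows "(f has_vector_derivative dir_deriv 1 f x) (at x)"
proof -
  have l: "bounded_linear (\<lambda>v. dir_deriv v f x)"
    using has_derivative_dir_deriv[OF assms] has_derivative_bounded_linear by blast
  have "(\<lambda>v. dir_deriv v f x) = (\<lambda>v. v *\<^sub>R dir_deriv 1 f x)"
  proof
    fix v
    show "dir_deriv v f x = v *\<^sub>R dir_deriv 1 f x"
      using linear_cmul[OF bounded_linear.linear[OF l], of v 1] by simp
  qed
  then show ?thesis
    using has_derivative_dir_deriv[OF assms] unfolding has_vector_derivative_def by metis
qed

lemma dir_deriv_vector_derivative:
  "(f has_vector_derivative d) (at x) \<Longrightarrow> dir_deriv v f x = v *\<^sub>R d"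
  unfolding has_vector_derivative_def using dir_deriv_has_derivative by blast

lemma smooth_vd: "smooth f \<Longrightarrow> (f has_vector_derivative dir_deriv 1 f x) (at x)"
  for f :: "real \<Rightarrow> 'b::real_normed_vector"
  by (simp add: has_vector_derivative_dir_deriv smooth_differentiable)

text \<open>A direction \<open>v\<close> on the line contributes only the scalar factor v, so the
  scalar multiples of a tower of derivatives form a closed class.\<close>

lemma smooth_from_derivatives:
  fixes F :: "nat \<Rightarrow> real \<Rightarrow> 'b::real_normed_vector"
  assumes F: "\<And>n x. (F n has_vector_derivative F (Suc n) x) (at x)"
  shows "smooth (F n)"
proof (rule smooth_coinduct[where X = "{\<lambda>x. c *\<^sub>R F n x | c n. True}"])
  have "F n = (\<lambda>x. 1 *\<^sub>R F n x)" by simp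
  then show "F n \<in> {\<lambda>x. c *\<^sub>R F n x | c n. True}" by blast
next
  have d: "((\<lambda>x. c *\<^sub>R F n x) has_vector_derivative c *\<^sub>R F (Suc n) x) (at x)" for c n x
    by (rule bounded_linear.has_vector_derivative[OF bounded_linear_scaleR_right F])
  {
    fix f assume "f \<in> {\<lambda>x. c *\<^sub>R F n x | c n. True}"
    then show "f differentiable_on UNIV"
      using d unfolding differentiable_on_UNIV_iff differentiable_def has_vector_derivative_def
      by blast
  next
    fix f v assume "f \<in> {\<lambda>x. c *\<^sub>R F n x | c n. True}"
    then obtain c n where f: "f = (\<lambda>x. c *\<^sub>R F n x)" by blast
    have "dir_deriv v f = (\<lambda>x. (v * c) *\<^sub>R F (Suc n) x)"
      unfolding f using dir_deriv_vector_derivative[OF d] by auto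
    then show "dir_deriv v f \<in> {\<lambda>x. c *\<^sub>R F n x | c n. True}" by blast
  }
qed

lemma smooth_antiderivative:
  fixes f :: "real \<Rightarrow> 'b::real_normed_vector"
  assumes g: "smooth g" and f: "\<And>x. (f has_vector_derivative g x) (at x)"
  shows "smooth f"
proof -
  define F where "F n = (case n of 0 \<Rightarrow> f | Suc n \<Rightarrow> (dir_deriv 1 ^^ n) g)" for n
  have s: "smooth ((dir_deriv 1 ^^ n) g)" for n
    by (induction n) (auto intro: g smooth_dir_deriv)
  have "(F n has_vector_derivative F (Suc n) x) (at x)" for n x
    by (cases n) (use f smooth_vd[OF s] in \<open>auto simp: F_def\<close>)
  from smooth_from_derivatives[of F 0, OF this] show ?thesis by (simp add: F_def)
qed

lemma smooth_D1: "smooth f \<Longrightarrow> smooth (D1 f)"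
  unfolding D1_def by (intro smooth_mult smooth_const smooth_dir_deriv)

lemma D1_vd: "smooth f \<Longrightarrow> (f has_vector_derivative \<i> * D1 f x) (at x)"
  using smooth_vd[of f x] by (simp add: D1_def)

lemma D1_eqI: "(f has_vector_derivative d) (at x) \<Longrightarrow> D1 f x = - \<i> * d"
  using dir_deriv_vector_derivative[of f d x 1] by (simp add: D1_def)

lemma D1_add: "smooth f \<Longrightarrow> smooth g \<Longrightarrow> D1 (\<lambda>x. f x + g x) = (\<lambda>x. D1 f x + D1 g x)"
  by (auto simp: D1_def dir_deriv_add smooth_differentiable algebra_simps)

lemma D1_mult:
  "smooth f \<Longrightarrow> smooth g \<Longrightarrow> D1 (\<lambda>x. f x * g x) = (\<lambda>x. D1 f x * g x + f x * D1 g x)"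
  by (auto simp: D1_def dir_deriv_mult smooth_differentiable algebra_simps)

lemma D1_const [simp]: "D1 (\<lambda>x. c) = (\<lambda>x. 0)"
  by (rule ext) (use D1_eqI[of "\<lambda>x. c" 0] in simp)

lemma D1_cmult: "smooth f \<Longrightarrow> D1 (\<lambda>x. c * f x) = (\<lambda>x. c * D1 f x)"
  by (simp add: D1_mult)

lemma D1_cnj: "smooth f \<Longrightarrow> D1 (\<lambda>x. cnj (f x)) = (\<lambda>x. - cnj (D1 f x))"
  by (auto simp: D1_def dir_deriv_linear[OF bounded_linear_cnj] smooth_differentiable)

lemma D1_sum:
  "(\<And>i. i \<in> I \<Longrightarrow> smooth (f i)) \<Longrightarrow> D1 (\<lambda>x. \<Sum>i\<in>I. f i x) = (\<lambda>x. \<Sum>i\<in>I. D1 (f i) x)"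
  by (induction I rule: infinite_finite_induct) (auto simp: D1_add smooth_sum)

lemma smooth_D1_pow: "smooth f \<Longrightarrow> smooth ((D1 ^^ n) f)"
  by (induction n) (auto intro: smooth_D1)

lemma D1_pow_cmult: "smooth f \<Longrightarrow> (D1 ^^ n) (\<lambda>x. c * f x) = (\<lambda>x. c * (D1 ^^ n) f x)"
  by (induction n) (auto simp: D1_cmult smooth_D1_pow)

subsection \<open>Bounded derivatives\<close>

lemma dir_deriv_real_scale:
  fixes f :: "real \<Rightarrow> 'b::real_normed_vector"
  assumes "\<And>x. f differentiable (at x)"
  shows "dir_deriv v (\<lambda>x. c *\<^sub>R f x) = (\<lambda>x. (v * c) *\<^sub>R dir_deriv 1 f x)"
proof
  fix x
  have "((\<lambda>x. c *\<^sub>R f x) has_vector_derivative c *\<^sub>R dir_deriv 1 f x) (at x)"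
    by (rule bounded_linear.has_vector_derivative[OF bounded_linear_scaleR_right
          has_vector_derivative_dir_deriv[OF assms]])
  from dir_deriv_vector_derivative[OF this, of v]
  show "dir_deriv v (\<lambda>x. c *\<^sub>R f x) x = (v * c) *\<^sub>R dir_deriv 1 f x" by simp
qed

text \<open>Counterpart of \<open>smooth_coinduct\<close> for bounded derivatives. On the line every
  iterated directional derivative is a multiple of an iterate of \<open>dir_deriv 1\<close>, so
  closure under this one derivative is enough.\<close>

lemma Cbar_coinduct:
  assumes X: "\<And>f. f \<in> X \<Longrightarrow> (\<forall>x. f differentiable (at x)) \<and> bounded (range f) \<and> dir_deriv 1 f \<in> X"
    and f: "f \<in> X"
  shows "f \<in> Cbar_infinity"
proof -
  have it: "(dir_deriv 1 ^^ n) f \<in> X" for n by (induction n) (use X f in auto)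
  have "\<exists>c. foldr dir_deriv vs f = (\<lambda>x. c *\<^sub>R (dir_deriv 1 ^^ length vs) f x)" for vs
  proof (induction vs)
    case Nil
    show ?case by (rule exI[of _ 1]) simp
  next
    case (Cons v vs)
    then obtain c where c: "foldr dir_deriv vs f = (\<lambda>x. c *\<^sub>R (dir_deriv 1 ^^ length vs) f x)" by blast
    have "foldr dir_deriv (v # vs) f = (\<lambda>x. (v * c) *\<^sub>R (dir_deriv 1 ^^ length (v # vs)) f x)"
      using dir_deriv_real_scale[of "(dir_deriv 1 ^^ length vs) f" v c] X it c by auto
    then show ?case by blast
  qed
  moreover have "(\<lambda>x. c *\<^sub>R (dir_deriv 1 ^^ n) f x) differentiable_on UNIV" for c n
    using X[OF it[of n]] by (auto simp: differentiable_on_UNIV_iff intro!: differentiable_scaleR)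
  ultimately have "smooth f"
    unfolding smooth_def by metis
  then show ?thesis unfolding Cbar_infinity_def using it X by auto
qed

lemma Cbar_smooth: "f \<in> Cbar_infinity \<Longrightarrow> smooth f" by (simp add: Cbar_infinity_def)

lemma Cbar_deriv:
  assumes "f \<in> Cbar_infinity" shows "dir_deriv 1 f \<in> Cbar_infinity"
proof -
  have "(dir_deriv 1 ^^ n) (dir_deriv 1 f) = (dir_deriv 1 ^^ Suc n) f" for n
    by (metis funpow_Suc_right o_apply)
  moreover have "smooth f" "\<And>n. bounded (range ((dir_deriv 1 ^^ n) f))"
    using assms by (auto simp: Cbar_infinity_def)
  ultimately show ?thesis unfolding Cbar_infinity_def mem_Collect_eq
    by (metis smooth_dir_deriv)
qed

lemma Cbar_bounded: "f \<in> Cbar_infinity \<Longrightarrow> bounded (range f)"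
  unfolding Cbar_infinity_def by (auto dest: spec[of _ "0::nat"])

lemma Cbar_bound:
  assumes "f \<in> Cbar_infinity" obtains C where "C \<ge> 0" "\<And>x. cmod (f x) \<le> C"
proof -
  obtain C where "\<forall>x. cmod (f x) \<le> C" using Cbar_bounded[OF assms] by (auto simp: bounded_iff)
  then show ?thesis using that norm_ge_zero order_trans by metis
qed

lemma Cbar_const [simp]: "(\<lambda>x. c) \<in> Cbar_infinity"
  by (rule Cbar_coinduct[where X = "range (\<lambda>c x. c)"])
    (auto simp: dir_deriv_vector_derivative[OF has_vector_derivative_const] fun_eq_iff)

lemma bounded_range_add:
  fixes f g :: "'a \<Rightarrow> complex"
  shows "bounded (range f) \<Longrightarrow> bounded (range g) \<Longrightarrow> bounded (range (\<lambda>x. f x + g x))"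
  by (rule bounded_plus_comp)

lemma bounded_range_mult:
  fixes f g :: "'a \<Rightarrow> complex"
  assumes "bounded (range f)" "bounded (range g)" shows "bounded (range (\<lambda>x. f x * g x))"
proof -
  obtain a b where "\<forall>x. cmod (f x) \<le> a" "\<forall>x. cmod (g x) \<le> b"
    using assms by (auto simp: bounded_iff)
  then have "cmod (f x * g x) \<le> a * b" for x
    by (simp add: norm_mult) (meson mult_mono norm_ge_zero order_trans)
  then show ?thesis by (auto simp: bounded_iff)
qed

lemma Cbar_add:
  assumes "f \<in> Cbar_infinity" "g \<in> Cbar_infinity" shows "(\<lambda>x. f x + g x) \<in> Cbar_infinity"
proof (rule Cbar_coinduct[where X = "{\<lambda>x. f x + g x | f g. f \<in> Cbar_infinity \<and> g \<in> Cbar_infinity}"])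
  fix h :: "real \<Rightarrow> complex"
  assume "h \<in> {\<lambda>x. f x + g x | f g. f \<in> Cbar_infinity \<and> g \<in> Cbar_infinity}"
  then obtain f g where h: "h = (\<lambda>x. f x + g x)" "f \<in> Cbar_infinity" "g \<in> Cbar_infinity" by blast
  have s: "f differentiable (at x)" "g differentiable (at x)" for x
    using h Cbar_smooth smooth_differentiable by auto
  have "dir_deriv 1 h = (\<lambda>x. dir_deriv 1 f x + dir_deriv 1 g x)"
    unfolding h by (rule ext) (intro dir_deriv_add s)
  then have "dir_deriv 1 h \<in> {\<lambda>x. f x + g x | f g. f \<in> Cbar_infinity \<and> g \<in> Cbar_infinity}"
    using Cbar_deriv[OF h(2)] Cbar_deriv[OF h(3)] by blast
  moreover have "bounded (range h)"
    unfolding h by (intro bounded_range_add Cbar_bounded h)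
  moreover have "h differentiable (at x)" for x
    unfolding h by (intro differentiable_add s)
  ultimately show "(\<forall>x. h differentiable (at x)) \<and> bounded (range h) \<and>
      dir_deriv 1 h \<in> {\<lambda>x. f x + g x | f g. f \<in> Cbar_infinity \<and> g \<in> Cbar_infinity}"
    by simp
qed (use assms in auto)

inductive_set bproduct_sums :: "(real \<Rightarrow> complex) set" where
  product: "f \<in> Cbar_infinity \<Longrightarrow> g \<in> Cbar_infinity \<Longrightarrow> (\<lambda>z. f z * g z) \<in> bproduct_sums"
| add: "f \<in> bproduct_sums \<Longrightarrow> g \<in> bproduct_sums \<Longrightarrow> (\<lambda>z. f z + g z) \<in> bproduct_sums"

lemma bproduct_sums_props:
  "f \<in> bproduct_sums \<Longrightarrow> (\<forall>x. f differentiable (at x)) \<and> bounded (range f) \<and> dir_deriv 1 f \<in> bproduct_sums"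
proof (induction rule: bproduct_sums.induct)
  case (product f g)
  have s: "f differentiable (at x)" "g differentiable (at x)" for x
    using product Cbar_smooth smooth_differentiable by auto
  have "dir_deriv 1 (\<lambda>z. f z * g z) = (\<lambda>z. f z * dir_deriv 1 g z + dir_deriv 1 f z * g z)"
    by (rule ext) (intro dir_deriv_mult s)
  also have "\<dots> \<in> bproduct_sums"
    by (intro bproduct_sums.intros product Cbar_deriv)
  finally show ?case using product s
    by (simp add: differentiable_mult bounded_range_mult Cbar_bounded)
next
  case (add f g)
  have "dir_deriv 1 (\<lambda>z. f z + g z) = (\<lambda>z. dir_deriv 1 f z + dir_deriv 1 g z)"
    by (rule ext) (intro dir_deriv_add; use add in auto)
  also have "\<dots> \<in> bproduct_sums"
    using add by (intro bproduct_sums.intros) auto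
  finally show ?case using add by (simp add: differentiable_add bounded_range_add)
qed

lemma Cbar_mult:
  assumes "f \<in> Cbar_infinity" "g \<in> Cbar_infinity" shows "(\<lambda>x. f x * g x) \<in> Cbar_infinity"
  by (rule Cbar_coinduct[where X = bproduct_sums])
    (use bproduct_sums_props bproduct_sums.product assms in auto)

lemma Cbar_cmult: "f \<in> Cbar_infinity \<Longrightarrow> (\<lambda>x. c * f x) \<in> Cbar_infinity"
  by (rule Cbar_mult[OF Cbar_const])

lemma Cbar_sum: "(\<And>i. i \<in> I \<Longrightarrow> f i \<in> Cbar_infinity) \<Longrightarrow> (\<lambda>x. \<Sum>i\<in>I. f i x) \<in> Cbar_infinity"
  by (induction I rule: infinite_finite_induct) (auto intro: Cbar_add)

lemma Cbar_D1: "f \<in> Cbar_infinity \<Longrightarrow> D1 f \<in> Cbar_infinity"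
  unfolding D1_def by (intro Cbar_cmult Cbar_deriv)

lemma Cbar_cnj:
  assumes "f \<in> Cbar_infinity" shows "(\<lambda>x. cnj (f x)) \<in> Cbar_infinity"
proof (rule Cbar_coinduct[where X = "{\<lambda>x. cnj (f x) | f. f \<in> Cbar_infinity}"])
  fix h :: "real \<Rightarrow> complex" assume "h \<in> {\<lambda>x. cnj (f x) | f. f \<in> Cbar_infinity}"
  then obtain f where h: "h = (\<lambda>x. cnj (f x))" "f \<in> Cbar_infinity" by blast
  have s: "smooth f" using h Cbar_smooth by auto
  have "smooth h" unfolding h by (rule smooth_linear[OF bounded_linear_cnj s])
  moreover have "dir_deriv 1 h = (\<lambda>x. cnj (dir_deriv 1 f x))"
    unfolding h by (rule ext) (intro dir_deriv_linear bounded_linear_cnj smooth_differentiable s)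
  moreover have "bounded (range h)" using Cbar_bounded[OF h(2)] by (simp add: h bounded_iff)
  ultimately show "(\<forall>x. h differentiable (at x)) \<and> bounded (range h) \<and>
      dir_deriv 1 h \<in> {\<lambda>x. cnj (f x) | f. f \<in> Cbar_infinity}"
    using smooth_differentiable Cbar_deriv[OF h(2)] by auto
qed (use assms in auto)

subsection \<open>Compact support\<close>

text \<open>The compactly supported smooth functions on the line; against these the evolution
  equation is tested in x.\<close>

definition ccs :: "(real \<Rightarrow> complex) set"
  where "ccs = {f. smooth f \<and> (\<exists>R. \<forall>x. \<bar>x\<bar> > R \<longrightarrow> f x = 0)}"

lemma ccs_smooth: "f \<in> ccs \<Longrightarrow> smooth f" by (simp add: ccs_def)

lemma ccsE:
  assumes "f \<in> ccs" obtains R where "R > 0" "\<And>x. \<bar>x\<bar> \<ge> R \<Longrightarrow> f x = 0"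
proof -
  obtain R where R: "\<And>x. \<bar>x\<bar> > R \<Longrightarrow> f x = 0" using assms by (auto simp: ccs_def)
  have "f x = 0" if "\<bar>x\<bar> \<ge> max R 0 + 1" for x
    by (rule R) (use that in linarith)
  then show ?thesis using that[of "max R 0 + 1"] by simp
qed

lemma ccsI: "smooth f \<Longrightarrow> (\<And>x. \<bar>x\<bar> > R \<Longrightarrow> f x = 0) \<Longrightarrow> f \<in> ccs"
  by (auto simp: ccs_def)

lemma ccs_add: assumes "f \<in> ccs" "g \<in> ccs" shows "(\<lambda>x. f x + g x) \<in> ccs"
proof -
  obtain R where R: "R > 0" "\<And>x. \<bar>x\<bar> \<ge> R \<Longrightarrow> f x = 0" using ccsE[OF assms(1)] by blast
  obtain S where S: "S > 0" "\<And>x. \<bar>x\<bar> \<ge> S \<Longrightarrow> g x = 0" using ccsE[OF assms(2)] by blast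
  have "f x + g x = 0" if "\<bar>x\<bar> > max R S" for x
    using R(2)[of x] S(2)[of x] that by simp
  then show ?thesis by (rule ccsI[OF smooth_add[OF ccs_smooth[OF assms(1)] ccs_smooth[OF assms(2)]]])
qed

lemma ccs_mult: assumes "smooth f" "g \<in> ccs" shows "(\<lambda>x. f x * g x) \<in> ccs"
proof -
  obtain S where S: "S > 0" "\<And>x. \<bar>x\<bar> \<ge> S \<Longrightarrow> g x = 0" using ccsE[OF assms(2)] by blast
  have "f x * g x = 0" if "\<bar>x\<bar> > S" for x
    using S(2)[of x] that by simp
  then show ?thesis by (rule ccsI[OF smooth_mult[OF assms(1) ccs_smooth[OF assms(2)]]])
qed

lemma ccs_zero [simp]: "(\<lambda>x. 0) \<in> ccs" by (auto simp: ccs_def)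

lemma ccs_cmult: "f \<in> ccs \<Longrightarrow> (\<lambda>x. c * f x) \<in> ccs" by (rule ccs_mult[OF smooth_const])

lemma ccs_sum: "(\<And>i. i \<in> I \<Longrightarrow> f i \<in> ccs) \<Longrightarrow> (\<lambda>x. \<Sum>i\<in>I. f i x) \<in> ccs"
  by (induction I rule: infinite_finite_induct) (auto intro: ccs_add)

lemma ccs_cnj: "f \<in> ccs \<Longrightarrow> (\<lambda>x. cnj (f x)) \<in> ccs"
  using smooth_linear[OF bounded_linear_cnj] by (auto simp: ccs_def)

lemma ccs_D1: assumes "f \<in> ccs" shows "D1 f \<in> ccs"
proof -
  obtain R where R: "R > 0" "\<And>x. \<bar>x\<bar> \<ge> R \<Longrightarrow> f x = 0" using ccsE[OF assms] by blast
  have "D1 f x = 0" if "\<bar>x\<bar> > R" for x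
  proof -
    have "((\<lambda>x. 0) has_vector_derivative 0) (at x)" by simp
    then have "(f has_vector_derivative 0) (at x)"
      by (rule has_vector_derivative_transform_within_open[where S = "{x. \<bar>x\<bar> > R}"])
        (use that R(2) in \<open>auto intro!: open_Collect_less continuous_intros\<close>)
    then show ?thesis using D1_eqI by fastforce
  qed
  then show ?thesis by (intro ccsI smooth_D1 ccs_smooth[OF assms])
qed

lemma ccs_D1_pow: "f \<in> ccs \<Longrightarrow> (D1 ^^ n) f \<in> ccs"
  by (induction n) (auto intro: ccs_D1)

lemma ccs_diff_op: "(\<And>j. j \<le> n \<Longrightarrow> smooth (a j)) \<Longrightarrow> f \<in> ccs \<Longrightarrow> diff_op n a f \<in> ccs"
  unfolding diff_op_def by (intro ccs_sum ccs_mult ccs_D1_pow) auto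

subsection \<open>A bump function\<close>

text \<open>The functions p(1/x) exp(-1/x), continued by 0, form a class closed under
  differentiation: p becomes X^2 (p - p'). So the flatness at 0 has to be checked only once, for
  general p.\<close>

definition flat_exp :: "real poly \<Rightarrow> real \<Rightarrow> real"
  where "flat_exp p x = (if x > 0 then poly p (1 / x) * exp (- (1 / x)) else 0)"

lemma poly_div_exp_tendsto_0: "((\<lambda>y. poly p y * exp (- y)) \<longlongrightarrow> (0::real)) at_top"
proof -
  have "((\<lambda>y. \<Sum>i\<le>degree p. coeff p i * (y ^ i / exp y)) \<longlongrightarrow> (\<Sum>i\<le>degree p. coeff p i * 0)) at_top"
    by (intro tendsto_sum tendsto_mult tendsto_const tendsto_power_div_exp_0)
  moreover have "(\<lambda>y. poly p y * exp (- y)) = (\<lambda>y. \<Sum>i\<le>degree p. coeff p i * (y ^ i / exp y))"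
    by (simp add: poly_altdef sum_distrib_right exp_minus divide_inverse mult.assoc)
  ultimately show ?thesis by simp
qed

lemma flat_exp_derivative:
  "(flat_exp p has_real_derivative flat_exp ([:0, 0, 1:] * (p - pderiv p)) x) (at x)"
proof -
  consider "x > 0" | "x < 0" | "x = 0" by linarith
  then show ?thesis
  proof cases
    case 1
    have "((\<lambda>x. poly p (1 / x) * exp (- (1 / x))) has_real_derivative
        flat_exp ([:0, 0, 1:] * (p - pderiv p)) x) (at x)"
      using 1 by (auto intro!: derivative_eq_intros poly_DERIV[THEN DERIV_chain2]
          simp: flat_exp_def field_simps power2_eq_square)
    then show ?thesis
      by (rule has_field_derivative_transform_within_open[where S = "{0<..}"])
        (use 1 in \<open>auto simp: flat_exp_def\<close>)
  next
    case 2
    have "((\<lambda>x. 0) has_real_derivative flat_exp ([:0, 0, 1:] * (p - pderiv p)) x) (at x)"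
      using 2 by (auto simp: flat_exp_def)
    then show ?thesis
      by (rule has_field_derivative_transform_within_open[where S = "{..<0}"])
        (use 2 in \<open>auto simp: flat_exp_def\<close>)
  next
    case 3
    \<comment> \<open>At 0 the difference quotient has the same form, with X p in place of p, and
      the exponential beats every power.\<close>
    have r: "((\<lambda>h. flat_exp p h / h) \<longlongrightarrow> 0) (at_right 0)"
    proof (rule Lim_transform_eventually)
      show "((\<lambda>h. poly ([:0, 1:] * p) (inverse h) * exp (- inverse h)) \<longlongrightarrow> 0) (at_right (0::real))"
        by (rule filterlim_compose[OF poly_div_exp_tendsto_0 filterlim_inverse_at_top_right])
      show "eventually (\<lambda>h. poly ([:0, 1:] * p) (inverse h) * exp (- inverse h) = flat_exp p h / h) (at_right 0)"
        by (auto simp: eventually_at_filter flat_exp_def field_simps)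
    qed
    have l: "((\<lambda>h. flat_exp p h / h) \<longlongrightarrow> 0) (at_left 0)"
      by (rule Lim_transform_eventually[of "\<lambda>h. 0"]) (auto simp: eventually_at_filter flat_exp_def)
    show ?thesis
      using filterlim_split_at[OF l r] 3 by (simp add: DERIV_def flat_exp_def)
  qed
qed

lemma smooth_flat_exp: "smooth (flat_exp p)"
proof -
  define F where "F n = flat_exp (((\<lambda>p. [:0, 0, 1:] * (p - pderiv p)) ^^ n) p)" for n
  have "(F n has_vector_derivative F (Suc n) x) (at x)" for n x
    unfolding F_def using flat_exp_derivative
    by (simp add: has_real_derivative_iff_has_vector_derivative[symmetric])
  from smooth_from_derivatives[of F 0, OF this] show ?thesis by (simp add: F_def)
qed

lemma bump_exists:
  obtains r :: "real \<Rightarrow> real" where "smooth (\<lambda>x. complex_of_real (r x))"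
    "\<And>x. r x \<ge> 0" "\<And>x. \<bar>x\<bar> < 1 \<Longrightarrow> r x > 0" "\<And>x. \<bar>x\<bar> \<ge> 1 \<Longrightarrow> r x = 0"
proof -
  define r where "r x = flat_exp 1 (1 - x) * flat_exp 1 (1 + x)" for x
  have s: "smooth (\<lambda>x. complex_of_real (flat_exp 1 x))"
    by (rule smooth_linear[OF bounded_linear_of_real smooth_flat_exp])
  have 1: "smooth (\<lambda>x. complex_of_real (flat_exp 1 (1 + - x)))"
    by (rule smooth_affine[OF s]) (intro bounded_linear_minus bounded_linear_ident)
  have 2: "smooth (\<lambda>x. complex_of_real (flat_exp 1 (1 + x)))"
    by (rule smooth_affine[OF s]) (rule bounded_linear_ident)
  show ?thesis
  proof (rule that[of r])
    show "smooth (\<lambda>x. complex_of_real (r x))"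
      using smooth_mult[OF 1 2] by (simp add: r_def)
  qed (auto simp: r_def flat_exp_def)
qed

section \<open>The Hilbert space of square integrable functions\<close>

lemma L2_I:
  "f \<in> borel_measurable lborel \<Longrightarrow> integrable lborel (\<lambda>x. (cmod (f x))\<^sup>2) \<Longrightarrow> f \<in> L2"
  by (simp add: L2_def)

lemma L2_measurable: "f \<in> L2 \<Longrightarrow> f \<in> borel_measurable lborel"
  and L2_integrable: "f \<in> L2 \<Longrightarrow> integrable lborel (\<lambda>x. (cmod (f x))\<^sup>2)"
  by (auto simp: L2_def)

lemma L2_zero: "(\<lambda>x. 0) \<in> L2" by (simp add: L2_def)

lemma L2_add:
  assumes "f \<in> L2" "g \<in> L2" shows "(\<lambda>x. f x + g x) \<in> L2"
proof (rule L2_I)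
  note [measurable] = L2_measurable[OF assms(1)] L2_measurable[OF assms(2)]
  show "(\<lambda>x. f x + g x) \<in> borel_measurable lborel" by measurable
  show "integrable lborel (\<lambda>x. (cmod (f x + g x))\<^sup>2)"
  proof (rule Bochner_Integration.integrable_bound)
    show "integrable lborel (\<lambda>x. 2 * (cmod (f x))\<^sup>2 + 2 * (cmod (g x))\<^sup>2)"
      using assms by (intro Bochner_Integration.integrable_add integrable_mult_right L2_integrable)
    have "(cmod (f x + g x))\<^sup>2 \<le> 2 * (cmod (f x))\<^sup>2 + 2 * (cmod (g x))\<^sup>2" for x
    proof -
      have "(cmod (f x + g x))\<^sup>2 \<le> (cmod (f x) + cmod (g x))\<^sup>2"
        by (intro power_mono norm_triangle_ineq norm_ge_zero)
      also have "\<dots> \<le> 2 * (cmod (f x))\<^sup>2 + 2 * (cmod (g x))\<^sup>2"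
        using sum_squares_ge_zero[of "cmod (f x) - cmod (g x)" 0]
        by (simp add: power2_eq_square algebra_simps)
      finally show ?thesis .
    qed
    then show "AE x in lborel. norm ((cmod (f x + g x))\<^sup>2) \<le> norm (2 * (cmod (f x))\<^sup>2 + 2 * (cmod (g x))\<^sup>2)"
      by (auto intro!: AE_I2)
  qed measurable
qed

lemma L2_cmult: "f \<in> L2 \<Longrightarrow> (\<lambda>x. c * f x) \<in> L2"
  by (auto simp: L2_def norm_mult power_mult_distrib)

lemma L2_uminus: "f \<in> L2 \<Longrightarrow> (\<lambda>x. - f x) \<in> L2"
  by (simp add: L2_def)

lemma L2_diff: "f \<in> L2 \<Longrightarrow> g \<in> L2 \<Longrightarrow> (\<lambda>x. f x - g x) \<in> L2"
  using L2_add[OF _ L2_uminus] by fastforce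

lemma L2_scaleR: "f \<in> L2 \<Longrightarrow> (\<lambda>x. r *\<^sub>R f x) \<in> L2"
  by (simp add: scaleR_conv_of_real L2_cmult)

lemma borel_measurable_cnj: "f \<in> borel_measurable M \<Longrightarrow> (\<lambda>x. cnj (f x)) \<in> borel_measurable M"
  by (rule measurable_compose[OF _ borel_measurable_continuous_onI]) (auto intro: continuous_intros)

lemma L2_cnj: "f \<in> L2 \<Longrightarrow> (\<lambda>x. cnj (f x)) \<in> L2"
  by (auto simp: L2_def intro: borel_measurable_cnj)

lemma L2_mult_integrable:
  assumes "f \<in> L2" "g \<in> L2" shows "integrable lborel (\<lambda>x. f x * g x)"
proof (rule Bochner_Integration.integrable_bound)
  note [measurable] = L2_measurable[OF assms(1)] L2_measurable[OF assms(2)]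
  show "integrable lborel (\<lambda>x. (cmod (f x))\<^sup>2 + (cmod (g x))\<^sup>2)"
    using assms by (intro Bochner_Integration.integrable_add L2_integrable)
  have "cmod (f x * g x) \<le> (cmod (f x))\<^sup>2 + (cmod (g x))\<^sup>2" for x
  proof -
    have "0 \<le> cmod (f x) * cmod (g x)" by simp
    then show ?thesis using sum_squares_bound[of "cmod (f x)" "cmod (g x)"] unfolding norm_mult by linarith
  qed
  then show "AE x in lborel. norm (f x * g x) \<le> norm ((cmod (f x))\<^sup>2 + (cmod (g x))\<^sup>2)"
    by (auto intro!: AE_I2)
  show "(\<lambda>x. f x * g x) \<in> borel_measurable lborel" by measurable
qed

text \<open>A partial equivalence: functions outside \<open>L2\<close> are related to nothing, so
  the quotient consists exactly of the classes of square integrable functions modulo null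
  sets.\<close>

definition l2_rel :: "(real \<Rightarrow> complex) \<Rightarrow> (real \<Rightarrow> complex) \<Rightarrow> bool"
  where "l2_rel f g \<longleftrightarrow> f \<in> L2 \<and> g \<in> L2 \<and> (AE x in lborel. f x = g x)"

quotient_type ltwo = "real \<Rightarrow> complex" / partial: l2_rel
proof (rule part_equivpI)
  show "\<exists>x. l2_rel x x" using L2_zero by (auto simp: l2_rel_def)
  show "symp l2_rel" by (auto simp: symp_def l2_rel_def)
  show "transp l2_rel" by (fastforce simp: transp_def l2_rel_def)
qed

lemma l2_rel_refl: "l2_rel f f \<longleftrightarrow> f \<in> L2" by (auto simp: l2_rel_def)

text \<open>The complex space is used as a real Hilbert space: the inner product is the real part of
  the Hermitian one, and the norm is the same. Imaginary parts are recovered later by multiplying a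
  test function by \<open>\<i>\<close> or \<open>- \<i>\<close>.\<close>

instantiation ltwo :: real_inner
begin

lift_definition zero_ltwo :: ltwo is "\<lambda>x. 0" by (simp add: l2_rel_refl L2_zero)

lift_definition plus_ltwo :: "ltwo \<Rightarrow> ltwo \<Rightarrow> ltwo" is "\<lambda>f g x. f x + g x"
  by (auto simp: l2_rel_def L2_add)

lift_definition uminus_ltwo :: "ltwo \<Rightarrow> ltwo" is "\<lambda>f x. - f x"
  by (auto simp: l2_rel_def L2_uminus)

lift_definition minus_ltwo :: "ltwo \<Rightarrow> ltwo \<Rightarrow> ltwo" is "\<lambda>f g x. f x - g x"
  by (auto simp: l2_rel_def L2_diff)

lift_definition scaleR_ltwo :: "real \<Rightarrow> ltwo \<Rightarrow> ltwo" is "\<lambda>r f x. r *\<^sub>R f x"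
  by (auto simp: l2_rel_def L2_scaleR)

lift_definition inner_ltwo :: "ltwo \<Rightarrow> ltwo \<Rightarrow> real"
  is "\<lambda>f g. Re (LINT x|lborel. f x * cnj (g x))"
proof -
  fix f f' g g' assume "l2_rel f f'" "l2_rel g g'"
  then have *: "f \<in> L2" "f' \<in> L2" "g \<in> L2" "g' \<in> L2" "AE x in lborel. f x * cnj (g x) = f' x * cnj (g' x)"
    by (auto simp: l2_rel_def)
  have "(LINT x|lborel. f x * cnj (g x)) = (LINT x|lborel. f' x * cnj (g' x))"
    by (intro integral_cong_AE borel_measurable_integrable L2_mult_integrable L2_cnj *)
  then show "Re (LINT x|lborel. f x * cnj (g x)) = Re (LINT x|lborel. f' x * cnj (g' x))" by simp
qed

definition norm_ltwo :: "ltwo \<Rightarrow> real" where "norm_ltwo u = sqrt (inner u u)"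
definition dist_ltwo :: "ltwo \<Rightarrow> ltwo \<Rightarrow> real" where "dist_ltwo u v = norm (u - v)"
definition sgn_ltwo :: "ltwo \<Rightarrow> ltwo" where "sgn_ltwo u = inverse (norm u) *\<^sub>R u"
definition uniformity_ltwo :: "(ltwo \<times> ltwo) filter"
  where "uniformity_ltwo = (INF e\<in>{0 <..}. principal {(x, y). dist x y < e})"
definition open_ltwo :: "ltwo set \<Rightarrow> bool"
  where "open_ltwo U \<longleftrightarrow> (\<forall>x\<in>U. eventually (\<lambda>(x', y). x' = x \<longrightarrow> y \<in> U) uniformity)"

lemma Re_mult_cnj_self: "Re (LINT x|lborel. f x * cnj (f x)) = (LINT x|lborel. (cmod (f x))\<^sup>2)"
proof -
  have "(\<lambda>x. f x * cnj (f x)) = (\<lambda>x. complex_of_real ((cmod (f x))\<^sup>2))"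
    by (auto simp: complex_norm_square simp del: of_real_power)
  then show ?thesis by (simp del: of_real_power)
qed

instance
proof
  fix a b c :: ltwo and r s :: real
  show "a + b + c = a + (b + c)" by transfer (auto simp: l2_rel_def L2_add algebra_simps)
  show "a + b = b + a" by transfer (auto simp: l2_rel_def L2_add algebra_simps)
  show "0 + a = a" by transfer (auto simp: l2_rel_def)
  show "- a + a = 0" by transfer (auto simp: l2_rel_def L2_add L2_uminus L2_zero)
  show "a - b = a + - b" by transfer (auto simp: l2_rel_def L2_add L2_uminus L2_diff)
  show "r *\<^sub>R (a + b) = r *\<^sub>R a + r *\<^sub>R b"
    by transfer (auto simp: l2_rel_def intro!: L2_add L2_scaleR simp: algebra_simps)
  show "(r + s) *\<^sub>R a = r *\<^sub>R a + s *\<^sub>R a"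
    by transfer (auto simp: l2_rel_def intro!: L2_add L2_scaleR simp: algebra_simps)
  show "r *\<^sub>R s *\<^sub>R a = (r * s) *\<^sub>R a"
    by transfer (auto simp: l2_rel_def intro!: L2_scaleR)
  show "1 *\<^sub>R a = a" by transfer (auto simp: l2_rel_def)
  show "dist a b = norm (a - b)" by (simp add: dist_ltwo_def)
  show "sgn a = inverse (norm a) *\<^sub>R a" by (simp add: sgn_ltwo_def)
  show "norm a = sqrt (inner a a)" by (simp add: norm_ltwo_def)
  show "inner a b = inner b a"
  proof transfer
    fix f g assume "l2_rel f f" "l2_rel g g"
    have "(LINT x|lborel. g x * cnj (f x)) = (LINT x|lborel. cnj (f x * cnj (g x)))"
      by (simp add: mult.commute)
    also have "\<dots> = cnj (LINT x|lborel. f x * cnj (g x))" by (rule Bochner_Integration.integral_cnj)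
    finally show "Re (LINT x|lborel. f x * cnj (g x)) = Re (LINT x|lborel. g x * cnj (f x))" by simp
  qed
  show "inner (a + b) c = inner a c + inner b c"
    by transfer (simp add: l2_rel_refl algebra_simps L2_mult_integrable L2_cnj)
  show "inner (r *\<^sub>R a) b = r * inner a b"
    by transfer (simp add: l2_rel_refl)
  show "inner a a \<ge> 0"
    by transfer (subst Re_mult_cnj_self, rule integral_nonneg_AE, simp)
  show "(inner a a = 0) = (a = 0)"
  proof transfer
    fix f assume "l2_rel f f"
    then have f: "f \<in> L2" by (simp add: l2_rel_refl)
    have "(LINT x|lborel. (cmod (f x))\<^sup>2) = 0 \<longleftrightarrow> (AE x in lborel. (cmod (f x))\<^sup>2 = 0)"
      by (rule integral_nonneg_eq_0_iff_AE[OF L2_integrable[OF f]]) auto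
    then show "(Re (LINT x|lborel. f x * cnj (f x)) = 0) = l2_rel f (\<lambda>x. 0)"
      using f L2_zero by (simp add: Re_mult_cnj_self l2_rel_def)
  qed
qed (auto simp: uniformity_ltwo_def open_ltwo_def)

end

definition emb :: "(real \<Rightarrow> complex) \<Rightarrow> ltwo" where "emb = abs_ltwo"
definition rep :: "ltwo \<Rightarrow> real \<Rightarrow> complex" where "rep = rep_ltwo"

lemma rep_L2 [simp]: "rep u \<in> L2"
  using Quotient3_rep_reflp[OF Quotient3_ltwo] by (simp add: rep_def l2_rel_refl)

lemma emb_rep [simp]: "emb (rep u) = u"
  using Quotient3_abs_rep[OF Quotient3_ltwo] by (simp add: rep_def emb_def)

lemma emb_eq_iff: "f \<in> L2 \<Longrightarrow> g \<in> L2 \<Longrightarrow> emb f = emb g \<longleftrightarrow> (AE x in lborel. f x = g x)"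
  using Quotient3_rel[OF Quotient3_ltwo, of f g] by (simp add: emb_def l2_rel_def)

lemma emb_add: "f \<in> L2 \<Longrightarrow> g \<in> L2 \<Longrightarrow> emb (\<lambda>x. f x + g x) = emb f + emb g"
  unfolding emb_def by (simp add: plus_ltwo.abs_eq l2_rel_refl)

lemma emb_diff: "f \<in> L2 \<Longrightarrow> g \<in> L2 \<Longrightarrow> emb (\<lambda>x. f x - g x) = emb f - emb g"
  unfolding emb_def by (simp add: minus_ltwo.abs_eq l2_rel_refl)

lemma emb_scaleR: "f \<in> L2 \<Longrightarrow> emb (\<lambda>x. r *\<^sub>R f x) = r *\<^sub>R emb f"
  unfolding emb_def by (simp add: scaleR_ltwo.abs_eq l2_rel_refl)

lemma emb_zero: "emb (\<lambda>x. 0) = 0"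
  unfolding emb_def zero_ltwo.abs_eq ..

lemma inner_emb: "f \<in> L2 \<Longrightarrow> g \<in> L2 \<Longrightarrow> inner (emb f) (emb g) = Re (LINT x|lborel. f x * cnj (g x))"
  unfolding emb_def by (simp add: inner_ltwo.abs_eq l2_rel_refl)

lemma norm_emb: "f \<in> L2 \<Longrightarrow> norm (emb f) = L2_norm f"
  by (simp add: norm_eq_sqrt_inner inner_emb Re_mult_cnj_self L2_norm_def)

lemma L2_norm_nonneg [simp]: "L2_norm f \<ge> 0"
  by (simp add: L2_norm_def)

text \<open>The weight lies in both L1 and L2. It serves twice: to pass from L2 to L1 in the proof
  of completeness, and as an integrable majorant of Fourier transforms.\<close>

lemma L2_weight: "(\<lambda>x. complex_of_real (1 / (1 + x\<^sup>2))) \<in> L2"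
  and integrable_weight: "integrable lborel (\<lambda>x::real. 1 / (1 + x\<^sup>2))"
proof -
  show i: "integrable lborel (\<lambda>x::real. 1 / (1 + x\<^sup>2))"
    using integrable_inverse_1_plus_square by (simp add: set_integrable_def inverse_eq_divide)
  have b: "(1 / (1 + x\<^sup>2))\<^sup>2 \<le> 1 / (1 + x\<^sup>2)" for x :: real
  proof -
    have "0 \<le> 1 / (1 + x\<^sup>2)" "1 / (1 + x\<^sup>2) \<le> 1" by (auto simp: field_simps add_pos_nonneg)
    then show ?thesis unfolding power2_eq_square[of "1 / (1 + x\<^sup>2)"] by (rule mult_left_le[rotated])
  qed
  show "(\<lambda>x. complex_of_real (1 / (1 + x\<^sup>2))) \<in> L2"
  proof (rule L2_I)
    show "integrable lborel (\<lambda>x. (cmod (complex_of_real (1 / (1 + x\<^sup>2))))\<^sup>2)"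
      by (rule Bochner_Integration.integrable_bound[OF i])
        (use b in \<open>auto intro!: AE_I2 simp del: of_real_divide of_real_add simp: abs_mult\<close>)
  qed measurable
qed

lemma L2_Cauchy_Schwarz:
  assumes f: "f \<in> L2" and g: "g \<in> L2"
  shows "(LINT x|lborel. cmod (f x * g x)) \<le> L2_norm f * L2_norm g"
proof -
  define F G where "F x = complex_of_real (cmod (f x))" and "G x = complex_of_real (cmod (g x))" for x
  note [measurable] = L2_measurable[OF f] L2_measurable[OF g]
  have [measurable]: "F \<in> borel_measurable lborel" "G \<in> borel_measurable lborel"
    unfolding F_def[abs_def] G_def[abs_def] by measurable
  have L: "F \<in> L2" "G \<in> L2"
    using L2_integrable[OF f] L2_integrable[OF g] by (auto intro!: L2_I simp: F_def G_def)
  have "inner (emb F) (emb G) \<le> norm (emb F) * norm (emb G)"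
    by (rule order_trans[OF abs_ge_self Cauchy_Schwarz_ineq2])
  moreover have "inner (emb F) (emb G) = (LINT x|lborel. cmod (f x * g x))"
    by (simp add: inner_emb L) (simp add: F_def G_def norm_mult flip: of_real_mult)
  moreover have "norm (emb F) = L2_norm f" "norm (emb G) = L2_norm g"
    by (auto simp: norm_emb L) (auto simp: L2_norm_def F_def G_def)
  ultimately show ?thesis by simp
qed

lemma L2_normD: "(\<integral>\<^sup>+x. ennreal ((cmod (f x))\<^sup>2) \<partial>lborel) = ennreal ((L2_norm f)\<^sup>2)" if "f \<in> L2"
  using nn_integral_eq_integral[OF L2_integrable[OF that]]
  by (simp add: L2_norm_def integral_nonneg_AE)

text \<open>The weight turns a Cauchy sequence in \<open>L\<^sup>2\<close> into one in \<open>L\<^sup>1\<close>, so that a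
  subsequence converges almost everywhere.\<close>

instance ltwo :: banach
proof
  fix X :: "nat \<Rightarrow> ltwo" assume X: "Cauchy X"
  define s where "s n = rep (X n)" for n
  have sL [simp]: "s n \<in> L2" for n by (simp add: s_def)
  have Xs: "X n = emb (s n)" for n by (simp add: s_def)
  have ns: "L2_norm (\<lambda>x. s i x - s j x) = norm (X i - X j)" for i j
    by (simp add: Xs flip: emb_diff norm_emb[OF L2_diff])
  define W where "W x = complex_of_real (1 / (1 + x\<^sup>2))" for x :: real
  have WL: "W \<in> L2" using L2_weight by (simp add: W_def[abs_def])
  have W0: "W x \<noteq> 0" for x unfolding W_def using add_pos_nonneg[of 1 "x\<^sup>2"] by (simp del: of_real_divide of_real_add)
  have "\<exists>N. \<forall>i\<ge>N. \<forall>j\<ge>N. LINT x|lborel. norm (s i x * W x - s j x * W x) < e" if "e > 0" for e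
  proof -
    have "e / (L2_norm W + 1) > 0" using that by (intro divide_pos_pos add_nonneg_pos) auto
    then obtain N where N: "\<And>i j. i \<ge> N \<Longrightarrow> j \<ge> N \<Longrightarrow> norm (X i - X j) < e / (L2_norm W + 1)"
      using CauchyD[OF X] by blast
    have "LINT x|lborel. norm (s i x * W x - s j x * W x) < e" if ij: "i \<ge> N" "j \<ge> N" for i j
    proof -
      have "(LINT x|lborel. norm (s i x * W x - s j x * W x)) = (LINT x|lborel. norm ((s i x - s j x) * W x))"
        by (simp add: algebra_simps)
      also have "\<dots> \<le> norm (X i - X j) * L2_norm W"
        unfolding ns[symmetric] by (intro L2_Cauchy_Schwarz L2_diff sL WL)
      also have "\<dots> \<le> norm (X i - X j) * (L2_norm W + 1)"
        by (intro mult_left_mono) auto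
      also have "\<dots> < e"
        using N[OF ij] L2_norm_nonneg[of W] by (simp add: field_simps add_nonneg_pos)
      finally show ?thesis .
    qed
    then show ?thesis by blast
  qed
  then obtain r where r: "strict_mono r" "AE x in lborel. Cauchy (\<lambda>i. s (r i) x * W x)"
    using cauchy_L1_AE_cauchy_subseq[of lborel "\<lambda>n x. s n x * W x"] L2_mult_integrable[OF sL WL] by blast
  define F where "F x = lim (\<lambda>i. s (r i) x)" for x
  note [measurable] = L2_measurable[OF sL]
  have [measurable]: "F \<in> borel_measurable lborel" unfolding F_def by measurable
  have lim: "AE x in lborel. (\<lambda>i. s (r i) x) \<longlonglongrightarrow> F x"
    using r(2)
  proof eventually_elim
    case (elim x)
    then obtain l where "(\<lambda>i. s (r i) x * W x) \<longlonglongrightarrow> l" by (auto simp: Cauchy_convergent_iff convergent_def)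
    then have "(\<lambda>i. s (r i) x * W x / W x) \<longlonglongrightarrow> l / W x" by (intro tendsto_divide tendsto_const W0)
    then have "convergent (\<lambda>i. s (r i) x)" using W0 by (auto simp: convergent_def)
    then show ?case by (simp add: F_def convergent_LIMSEQ_iff)
  qed
  \<comment> \<open>Fatou's lemma along the subsequence: the tail bound \<open>e\<close> passes to
    the limit, and the same estimate shows that the limit is square integrable.\<close>
  have key: "F \<in> L2 \<and> norm (emb F - X n) \<le> e"
    if e: "e > 0" and n: "\<And>j. j \<ge> n \<Longrightarrow> norm (X j - X n) \<le> e" for e n
  proof -
    have "(\<integral>\<^sup>+x. ennreal ((cmod (F x - s n x))\<^sup>2) \<partial>lborel)
        = (\<integral>\<^sup>+x. liminf (\<lambda>i. ennreal ((cmod (s (r i) x - s n x))\<^sup>2)) \<partial>lborel)"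
    proof (rule nn_integral_cong_AE)
      show "AE x in lborel. ennreal ((cmod (F x - s n x))\<^sup>2) = liminf (\<lambda>i. ennreal ((cmod (s (r i) x - s n x))\<^sup>2))"
        using lim
      proof eventually_elim
        case (elim x)
        have "(\<lambda>i. ennreal ((cmod (s (r i) x - s n x))\<^sup>2)) \<longlonglongrightarrow> ennreal ((cmod (F x - s n x))\<^sup>2)"
          by (intro tendsto_ennrealI tendsto_intros elim)
        then show ?case using lim_imp_Liminf[OF sequentially_bot] by metis
      qed
    qed
    also have "\<dots> \<le> liminf (\<lambda>i. \<integral>\<^sup>+x. ennreal ((cmod (s (r i) x - s n x))\<^sup>2) \<partial>lborel)"
      by (rule nn_integral_liminf) measurable
    also have "\<dots> \<le> ennreal (e\<^sup>2)"
    proof (rule Liminf_le)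
      show "eventually (\<lambda>i. (\<integral>\<^sup>+x. ennreal ((cmod (s (r i) x - s n x))\<^sup>2) \<partial>lborel) \<le> ennreal (e\<^sup>2)) sequentially"
        using eventually_ge_at_top[of n]
      proof eventually_elim
        case (elim i)
        have "n \<le> r i" using seq_suble[OF r(1), of i] elim by simp
        then have "L2_norm (\<lambda>x. s (r i) x - s n x) \<le> e" using n by (simp add: ns)
        then show ?case by (simp add: L2_normD L2_diff power_mono ennreal_leI)
      qed
    qed simp
    finally have le: "(\<integral>\<^sup>+x. ennreal ((cmod (F x - s n x))\<^sup>2) \<partial>lborel) \<le> ennreal (e\<^sup>2)" .
    have D: "(\<lambda>x. F x - s n x) \<in> L2"
    proof (rule L2_I)
      show "integrable lborel (\<lambda>x. (cmod (F x - s n x))\<^sup>2)"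
        by (rule integrableI_nonneg) (use le in \<open>auto intro: le_less_trans\<close>)
    qed measurable
    have FL: "F \<in> L2" using L2_add[OF D sL[of n]] by simp
    have "ennreal ((L2_norm (\<lambda>x. F x - s n x))\<^sup>2) \<le> ennreal (e\<^sup>2)"
      using le by (simp add: L2_normD D)
    then have "L2_norm (\<lambda>x. F x - s n x) \<le> e"
      using e by (simp add: ennreal_le_iff abs_le_square_iff[symmetric])
    then show ?thesis using FL by (simp add: Xs norm_emb[OF D, symmetric] emb_diff)
  qed
  have "X \<longlonglongrightarrow> emb F"
  proof (rule LIMSEQ_I)
    fix e :: real assume e: "e > 0"
    then obtain N where N: "\<And>i j. i \<ge> N \<Longrightarrow> j \<ge> N \<Longrightarrow> norm (X i - X j) < e / 2"
      using CauchyD[OF X, of "e / 2"] by auto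
    have "norm (X n - emb F) < e" if "n \<ge> N" for n
    proof -
      have "norm (emb F - X n) \<le> e / 2"
        using key[of "e / 2" n] e N that by (meson half_gt_zero less_imp_le order_trans)
      then show ?thesis using e by (simp add: norm_minus_commute)
    qed
    then show "\<exists>N. \<forall>n\<ge>N. norm (X n - emb F) < e" by blast
  qed
  then show "convergent X" by (auto simp: convergent_def)
qed

subsection \<open>Compactly supported functions as elements of the Hilbert space\<close>

lemma support_set_integrable:
  fixes f :: "real \<Rightarrow> 'b::{banach, second_countable_topology}"
  assumes "continuous_on {a..b} f"
  shows "set_integrable lborel {a..b} f"
  unfolding set_integrable_def by (rule borel_integrable_compact) (use assms in auto)

lemma support_integrable:
  fixes f :: "real \<Rightarrow> 'b::euclidean_space"
  assumes f: "continuous_on {a..b} f" and z: "\<And>x. x \<notin> {a..b} \<Longrightarrow> f x = 0"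
  shows "integrable lborel f" "(LINT x|lborel. f x) = integral {a..b} f"
proof -
  have e: "(\<lambda>x. indicator {a..b} x *\<^sub>R f x) = f"
  proof
    fix x show "indicator {a..b} x *\<^sub>R f x = f x"
      using z[of x] by (cases "x \<in> {a..b}") auto
  qed
  show "integrable lborel f"
    using support_set_integrable[OF f] unfolding set_integrable_def e .
  show "(LINT x|lborel. f x) = integral {a..b} f"
    using set_borel_integral_eq_integral(2)[OF support_set_integrable[OF f]]
    unfolding set_lebesgue_integral_def e .
qed

lemma support_L2:
  fixes f :: "real \<Rightarrow> complex"
  assumes f: "continuous_on UNIV f" and z: "\<And>x. \<bar>x\<bar> > R \<Longrightarrow> f x = 0"
  shows "f \<in> L2"
proof (rule L2_I)
  show "f \<in> borel_measurable lborel"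
    using borel_measurable_continuous_onI[OF f] by simp
  show "integrable lborel (\<lambda>x. (cmod (f x))\<^sup>2)"
    by (rule support_integrable[of "-R" R])
      (use z in \<open>auto intro!: continuous_intros continuous_on_subset[OF f] simp: abs_if\<close>)
qed

lemma L2_norm_le:
  assumes f: "f \<in> L2" and z: "\<And>x. \<bar>x - a\<bar> > R \<Longrightarrow> f x = 0" and b: "\<And>x. cmod (f x) \<le> B"
    and "R \<ge> 0"
  shows "L2_norm f \<le> B * sqrt (2 * R)"
proof -
  have B: "B \<ge> 0" using b norm_ge_zero order_trans by blast
  have "(LINT x|lborel. (cmod (f x))\<^sup>2) \<le> (LINT x|lborel. indicator {a - R..a + R} x *\<^sub>R B\<^sup>2)"
  proof (rule integral_mono[OF L2_integrable[OF f]])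
    show "(cmod (f x))\<^sup>2 \<le> indicator {a - R..a + R} x *\<^sub>R B\<^sup>2" for x
    proof (cases "x \<in> {a - R..a + R}")
      case True then show ?thesis using b by (simp add: power_mono)
    next
      case False
      then have "f x = 0" by (intro z) (auto simp: abs_if)
      then show ?thesis by simp
    qed
  qed (use borel_integrable_compact[of "{a - R..a + R}" "\<lambda>x. B\<^sup>2"] in auto)
  also have "\<dots> = 2 * R * B\<^sup>2" using \<open>R \<ge> 0\<close> by simp
  finally have "L2_norm f \<le> sqrt (2 * R * B\<^sup>2)" unfolding L2_norm_def by simp
  also have "\<dots> = B * sqrt (2 * R)" using B by (simp add: real_sqrt_mult)
  finally show ?thesis .
qed

lemma L2_norm_ge:
  assumes f: "f \<in> L2" and b: "\<And>x. \<bar>x - a\<bar> \<le> R \<Longrightarrow> cmod (f x) \<ge> B" and B: "B \<ge> 0" and "R \<ge> 0"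
  shows "L2_norm f \<ge> B * sqrt (2 * R)"
proof -
  have "(LINT x|lborel. indicator {a - R..a + R} x *\<^sub>R B\<^sup>2) \<le> (LINT x|lborel. (cmod (f x))\<^sup>2)"
  proof (rule integral_mono[OF _ L2_integrable[OF f]])
    show "indicator {a - R..a + R} x *\<^sub>R B\<^sup>2 \<le> (cmod (f x))\<^sup>2" for x
    proof (cases "x \<in> {a - R..a + R}")
      case True
      then have "\<bar>x - a\<bar> \<le> R" by (auto simp: abs_if)
      then show ?thesis using b B by (simp add: power_mono indicator_def)
    qed simp
  qed (use borel_integrable_compact[of "{a - R..a + R}" "\<lambda>x. B\<^sup>2"] in auto)
  also have "(LINT x|lborel. indicator {a - R..a + R} x *\<^sub>R B\<^sup>2) = 2 * R * B\<^sup>2" using \<open>R \<ge> 0\<close> by simp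
  finally have "sqrt (2 * R * B\<^sup>2) \<le> L2_norm f" unfolding L2_norm_def by simp
  moreover have "sqrt (2 * R * B\<^sup>2) = B * sqrt (2 * R)" using B by (simp add: real_sqrt_mult)
  ultimately show ?thesis by simp
qed

lemma ccs_L2: assumes "f \<in> ccs" shows "f \<in> L2"
proof -
  obtain R where "R > 0" "\<And>x. \<bar>x\<bar> \<ge> R \<Longrightarrow> f x = 0" using ccsE[OF assms] by blast
  then show ?thesis by (intro support_L2[of f R] smooth_continuous[OF ccs_smooth[OF assms]]) simp_all
qed

text \<open>Conjugating \<open>\<theta>\<close> undoes the conjugation in the inner product: this is
  the real part of the bilinear pairing, in accordance with the pairing used for
  distributions.\<close>

definition pair :: "ltwo \<Rightarrow> (real \<Rightarrow> complex) \<Rightarrow> real"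
  where "pair w \<theta> = inner w (emb (\<lambda>x. cnj (\<theta> x)))"

lemma pair_emb: "f \<in> L2 \<Longrightarrow> \<theta> \<in> L2 \<Longrightarrow> pair (emb f) \<theta> = Re (LINT x|lborel. f x * \<theta> x)"
  by (simp add: pair_def inner_emb L2_cnj)

lemma pair_add: "\<theta> \<in> L2 \<Longrightarrow> \<eta> \<in> L2 \<Longrightarrow> pair w (\<lambda>x. \<theta> x + \<eta> x) = pair w \<theta> + pair w \<eta>"
  by (simp add: pair_def emb_add L2_cnj inner_add_right)

text \<open>Uniform continuity on the compact slab \<open>{t0 - 1..t0 + 1} \<times> {-R..R}\<close>
  makes the modulus of continuity in t independent of x.\<close>

lemma emb_curve_estimate:
  fixes v :: "real \<Rightarrow> real \<Rightarrow> complex"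
  assumes v: "continuous_on UNIV (\<lambda>p. v (fst p) (snd p))" and e: "e > 0"
  obtains d where "d > 0" "d < 1" "\<And>t x. \<bar>t - t0\<bar> \<le> d \<Longrightarrow> \<bar>x\<bar> \<le> R \<Longrightarrow> cmod (v t x - v t0 x) \<le> e"
proof -
  define K where "K = {t0 - 1..t0 + 1} \<times> {-R..R}"
  have "uniformly_continuous_on K (\<lambda>p. v (fst p) (snd p))"
    by (rule compact_uniformly_continuous)
      (use v continuous_on_subset in \<open>auto simp: K_def intro!: compact_Times\<close>)
  then obtain d where d: "d > 0" "\<And>p q. p \<in> K \<Longrightarrow> q \<in> K \<Longrightarrow> dist q p < d \<Longrightarrow>
      dist (v (fst q) (snd q)) (v (fst p) (snd p)) < e"
    using e unfolding uniformly_continuous_on_def by metis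
  show ?thesis
  proof (rule that[of "min (d / 2) (1 / 2)"])
    fix t x :: real assume t: "\<bar>t - t0\<bar> \<le> min (d / 2) (1 / 2)" and x: "\<bar>x\<bar> \<le> R"
    have "(t, x) \<in> K" "(t0, x) \<in> K" using t x by (auto simp: K_def abs_if split: if_splits)
    moreover have "dist (t, x) (t0, x) < d" using t d(1) by (simp add: dist_prod_def dist_real_def)
    ultimately show "cmod (v t x - v t0 x) \<le> e" using d(2)[of "(t0, x)" "(t, x)"] by (simp add: dist_norm)
  qed (use d(1) in auto)
qed

lemma joint_continuous_slice:
  "continuous_on UNIV (\<lambda>p. v (fst p) (snd p)) \<Longrightarrow> continuous_on UNIV (v t)"
  using continuous_on_compose2[of UNIV "\<lambda>p. v (fst p) (snd p)" UNIV "\<lambda>x. (t, x)"]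
    continuous_on_Pair[OF continuous_on_const continuous_on_id, of UNIV t]
  by auto

text \<open>On a common bounded support, uniform convergence implies L2 convergence with the factor
  \<open>sqrt (2 * R)\<close>.\<close>

lemma emb_curve_continuous:
  fixes v :: "real \<Rightarrow> real \<Rightarrow> complex"
  assumes v: "continuous_on UNIV (\<lambda>p. v (fst p) (snd p))" and R: "R > 0"
    and z: "\<And>t x. \<bar>t - t0\<bar> < 1 \<Longrightarrow> \<bar>x\<bar> > R \<Longrightarrow> v t x = 0"
  shows "isCont (\<lambda>t. emb (v t)) t0"
  unfolding continuous_at_eps_delta
proof (intro allI impI)
  fix e :: real assume e: "e > 0"
  define e' where "e' = e / (2 * (sqrt (2 * R) + 1))"
  have e': "e' > 0" using e R by (auto simp: e'_def intro!: divide_pos_pos add_nonneg_pos)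
  obtain d where d: "d > 0" "d < 1" "\<And>t x. \<bar>t - t0\<bar> \<le> d \<Longrightarrow> \<bar>x\<bar> \<le> R \<Longrightarrow> cmod (v t x - v t0 x) \<le> e'"
    using emb_curve_estimate[OF v e'] by blast
  have "dist (emb (v t)) (emb (v t0)) < e" if t: "dist t t0 < d" for t
  proof -
    have t': "\<bar>t - t0\<bar> < d" using t by (simp add: dist_real_def)
    have L: "v t \<in> L2" "v t0 \<in> L2"
      using z t' d by (auto intro!: support_L2[where R = R] joint_continuous_slice[OF v])
    have "L2_norm (\<lambda>x. v t x - v t0 x) \<le> e' * sqrt (2 * R)"
    proof (rule L2_norm_le[where a = 0])
      show "cmod (v t x - v t0 x) \<le> e'" for x
        using d(3)[of t x] z[of t x] z[of t0 x] t' d e' by (cases "\<bar>x\<bar> \<le> R") auto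
    qed (use z t' d R in \<open>auto intro: L2_diff L\<close>)
    also have "\<dots> < e"
      using e R by (simp add: e'_def field_simps add_nonneg_pos add_pos_nonneg)
    finally show ?thesis by (simp add: dist_norm L flip: emb_diff norm_emb[OF L2_diff])
  qed
  then show "\<exists>d>0. \<forall>x'. dist x' t0 < d \<longrightarrow> dist (emb (v x')) (emb (v t0)) < e" using d(1) by blast
qed

text \<open>For each fixed x the mean value inequality bounds the Taylor remainder by
  \<open>\<bar>t - t0\<bar>\<close> times the oscillation of \<open>v\<close> in time. The bound is
  uniform in x on a bounded support and therefore carries over to the L2 norm.\<close>

lemma emb_curve_derivative:
  fixes u v :: "real \<Rightarrow> real \<Rightarrow> complex"
  assumes d: "\<And>t x. ((\<lambda>t. u t x) has_vector_derivative v t x) (at t)"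
    and v: "continuous_on UNIV (\<lambda>p. v (fst p) (snd p))"
    and u: "\<And>t. continuous_on UNIV (u t)" and R: "R > 0"
    and z: "\<And>t x. \<bar>t - t0\<bar> < 1 \<Longrightarrow> \<bar>x\<bar> > R \<Longrightarrow> u t x = 0"
  shows "v t0 \<in> L2" "((\<lambda>t. emb (u t)) has_vector_derivative emb (v t0)) (at t0)"
proof -
  have zv: "v t0 x = 0" if "\<bar>x\<bar> > R" for x
  proof -
    have "((\<lambda>t. u t x) has_vector_derivative 0) (at t0)"
      by (rule has_vector_derivative_transform_within_open[where f = "\<lambda>t. 0" and S = "ball t0 1"])
        (use z that in \<open>auto simp: dist_real_def abs_minus_commute\<close>)
    then show ?thesis using d vector_derivative_unique_at by blast
  qed
  show vL: "v t0 \<in> L2"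
    by (rule support_L2[where R = R]) (auto intro: zv joint_continuous_slice[OF v])
  have uL: "u t \<in> L2" if "\<bar>t - t0\<bar> < 1" for t
    by (rule support_L2[where R = R]) (use z that u in auto)
  show "((\<lambda>t. emb (u t)) has_vector_derivative emb (v t0)) (at t0)"
    unfolding has_vector_derivative_def has_derivative_at_alt
  proof (intro conjI allI impI)
    fix e :: real assume e: "e > 0"
    define e' where "e' = e / (sqrt (2 * R) + 1)"
    have e': "e' > 0" using e R by (auto simp: e'_def intro!: divide_pos_pos add_nonneg_pos)
    obtain d' where d': "d' > 0" "d' < 1"
      "\<And>t x. \<bar>t - t0\<bar> \<le> d' \<Longrightarrow> \<bar>x\<bar> \<le> R \<Longrightarrow> cmod (v t x - v t0 x) \<le> e'"
      using emb_curve_estimate[OF v e'] by blast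
    have "norm (emb (u t) - emb (u t0) - (t - t0) *\<^sub>R emb (v t0)) \<le> e * norm (t - t0)"
      if t: "norm (t - t0) < d'" for t
    proof -
      have t': "\<bar>t - t0\<bar> < d'" "\<bar>t - t0\<bar> < 1" using t d' by auto
      define w where "w x = u t x - u t0 x - (t - t0) *\<^sub>R v t0 x" for x
      have wL: "w \<in> L2" unfolding w_def
        by (intro L2_diff L2_scaleR vL uL) (use t' in auto)
      have "emb w = emb (u t) - emb (u t0) - (t - t0) *\<^sub>R emb (v t0)"
        unfolding w_def using uL[of t] uL[of t0] t' vL
        by (simp add: emb_diff emb_scaleR L2_diff L2_scaleR)
      then have "norm (emb (u t) - emb (u t0) - (t - t0) *\<^sub>R emb (v t0)) = L2_norm w"
        using norm_emb[OF wL] by simp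
      also have "\<dots> \<le> (\<bar>t - t0\<bar> * e') * sqrt (2 * R)"
      proof (rule L2_norm_le[where a = 0])
        show "w \<in> L2" by (rule wL)
        show "w x = 0" if "\<bar>x - 0\<bar> > R" for x using z[of t x] z[of t0 x] zv[of x] that t' by (simp add: w_def)
        show "cmod (w x) \<le> \<bar>t - t0\<bar> * e'" for x
        proof (cases "\<bar>x\<bar> \<le> R")
          case True
          have "norm (u t x - u t0 x - (t - t0) *\<^sub>R v t0 x) \<le> norm (t - t0) * e'"
          proof (rule vector_differentiable_bound_linearization[where S = "{t0 - d'..t0 + d'}"
                and f = "\<lambda>t. u t x" and f' = "\<lambda>t. v t x"])
            show "((\<lambda>t. u t x) has_vector_derivative v s x) (at s within {t0 - d'..t0 + d'})" for s
              using d has_vector_derivative_at_within by blast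
            show "closed_segment t0 t \<subseteq> {t0 - d'..t0 + d'}"
              using t' d' by (auto simp: closed_segment_eq_real_ivl abs_if split: if_splits)
            show "norm (v s x - v t0 x) \<le> e'" if "s \<in> {t0 - d'..t0 + d'}" for s
              using d'(3)[of s x] True that by (auto simp: abs_le_iff)
          qed (use d' in auto)
          then show ?thesis by (simp add: w_def)
        next
          case False
          then have "w x = 0" using z[of t x] z[of t0 x] zv[of x] t' by (simp add: w_def)
          then show ?thesis using e' by simp
        qed
      qed (use R in auto)
      also have "\<dots> = \<bar>t - t0\<bar> * (e' * sqrt (2 * R))" by simp
      also have "\<dots> \<le> \<bar>t - t0\<bar> * e"
      proof (rule mult_left_mono)
        show "e' * sqrt (2 * R) \<le> e"
          using e R by (simp add: e'_def field_simps add_nonneg_pos add_pos_nonneg)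
      qed simp
      finally show ?thesis by (simp add: mult.commute)
    qed
    then show "\<exists>d>0. \<forall>y. norm (y - t0) < d \<longrightarrow>
        norm (emb (u y) - emb (u t0) - (y - t0) *\<^sub>R emb (v t0)) \<le> e * norm (y - t0)"
      using d'(1) by blast
  qed (rule bounded_linear_scaleR_left)
qed

subsection \<open>Antiderivatives and integration by parts\<close>

lemma antiderivative_exists:
  fixes f :: "real \<Rightarrow> 'b::banach"
  assumes f: "continuous_on UNIV f"
  obtains F where "\<And>x. (F has_vector_derivative f x) (at x)"
proof -
  define F where "F x = (if x \<ge> 0 then integral {0..x} f else - integral {x..0} f)" for x
  have eq: "F x = integral {-R..x} f - integral {-R..0} f" if "x \<in> {-R..R}" "R > 0" for x R
  proof (cases "x \<ge> 0")
    case True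
    have "integral {-R..0} f + integral {0..x} f = integral {-R..x} f"
      by (rule Henstock_Kurzweil_Integration.integral_combine)
        (use True that in \<open>auto intro!: integrable_continuous_interval continuous_on_subset[OF f]\<close>)
    then show ?thesis using True by (simp add: F_def algebra_simps)
  next
    case False
    have "integral {-R..x} f + integral {x..0} f = integral {-R..0} f"
      by (rule Henstock_Kurzweil_Integration.integral_combine)
        (use False that in \<open>auto intro!: integrable_continuous_interval continuous_on_subset[OF f]\<close>)
    then show ?thesis using False by (simp add: F_def algebra_simps)
  qed
  have "(F has_vector_derivative f x) (at x)" for x
  proof -
    define R where "R = \<bar>x\<bar> + 1"
    have R: "R > 0" "x \<in> {-R<..<R}" by (auto simp: R_def)
    have "((\<lambda>u. integral {-R..u} f) has_vector_derivative f x) (at x within {-R..R})"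
      by (rule integral_has_vector_derivative) (use R in \<open>auto intro!: continuous_on_subset[OF f]\<close>)
    then have "((\<lambda>u. integral {-R..u} f) has_vector_derivative f x) (at x)"
      using R(2) at_within_Icc_at[of "-R" x R] by simp
    then have "((\<lambda>u. integral {-R..u} f - integral {-R..0} f) has_vector_derivative f x - 0) (at x)"
      by (intro has_vector_derivative_diff has_vector_derivative_const)
    then have "((\<lambda>u. integral {-R..u} f - integral {-R..0} f) has_vector_derivative f x) (at x)" by simp
    then show ?thesis
      by (rule has_vector_derivative_transform_within_open[where S = "{-R<..<R}"])
        (use R eq[of _ R] in auto)
  qed
  then show ?thesis by (rule that)
qed

lemma integral_D1_zero:
  assumes "f \<in> ccs" shows "(LINT x|lborel. D1 f x) = 0"
proof -
  obtain R where R: "R > 0" "\<And>x. \<bar>x\<bar> \<ge> R \<Longrightarrow> f x = 0" using ccsE[OF assms] by blast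
  obtain R' where R': "R' > 0" "\<And>x. \<bar>x\<bar> \<ge> R' \<Longrightarrow> D1 f x = 0" using ccsE[OF ccs_D1[OF assms]] by blast
  define M where "M = max R R'"
  have M: "M > 0" "M \<ge> R" "M \<ge> R'" using R R' by (auto simp: M_def)
  have s: "smooth f" by (rule ccs_smooth[OF assms])
  have "((\<lambda>x. \<i> * D1 f x) has_integral (f M - f (-M))) {-M..M}"
    by (rule fundamental_theorem_of_calculus) (use M in \<open>auto intro!: has_vector_derivative_at_within D1_vd[OF s]\<close>)
  moreover have "f M = 0" by (rule R(2)) (use M in simp)
  moreover have "f (-M) = 0" by (rule R(2)) (use M in simp)
  ultimately have "((\<lambda>x. \<i> * D1 f x) has_integral 0) {-M..M}" by simp
  then have "integral {-M..M} (\<lambda>x. \<i> * D1 f x) = 0" by (rule integral_unique)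
  moreover have "(LINT x|lborel. \<i> * D1 f x) = integral {-M..M} (\<lambda>x. \<i> * D1 f x)"
  proof (rule support_integrable)
    show "continuous_on {-M..M} (\<lambda>x. \<i> * D1 f x)"
      by (intro continuous_intros smooth_continuous smooth_D1 s)
    show "\<i> * D1 f x = 0" if "x \<notin> {-M..M}" for x
      using R'(2)[of x] that M by (auto simp: abs_if split: if_splits)
  qed
  ultimately show ?thesis by simp
qed

lemma ccs_integrable: assumes "f \<in> ccs" shows "integrable lborel f"
proof -
  obtain R where R: "R > 0" "\<And>x. \<bar>x\<bar> \<ge> R \<Longrightarrow> f x = 0" using ccsE[OF assms] by blast
  show ?thesis
  proof (rule support_integrable)
    show "continuous_on {-R..R} f" by (rule smooth_continuous[OF ccs_smooth[OF assms]])
    show "f x = 0" if "x \<notin> {-R..R}" for x by (rule R(2)) (use that in auto)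
  qed
qed

lemma ccs_mult2: "f \<in> ccs \<Longrightarrow> smooth g \<Longrightarrow> (\<lambda>x. f x * g x) \<in> ccs"
  using ccs_mult[of g f] by (simp add: mult.commute)

lemma integration_by_parts:
  assumes f: "f \<in> ccs" and g: "smooth g"
  shows "(LINT x|lborel. D1 f x * g x) = - (LINT x|lborel. f x * D1 g x)"
proof -
  have "(LINT x|lborel. D1 f x * g x + f x * D1 g x) = 0"
    using integral_D1_zero[OF ccs_mult2[OF f g]] by (simp add: D1_mult ccs_smooth f g)
  moreover have "(LINT x|lborel. D1 f x * g x + f x * D1 g x)
      = (LINT x|lborel. D1 f x * g x) + (LINT x|lborel. f x * D1 g x)"
    by (intro Bochner_Integration.integral_add ccs_integrable ccs_mult2 ccs_D1 f smooth_D1 g)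
  ultimately show ?thesis by (simp add: eq_neg_iff_add_eq_0)
qed

lemma integration_by_parts_pow:
  assumes g: "smooth g"
  shows "f \<in> ccs \<Longrightarrow> (LINT x|lborel. (D1 ^^ j) f x * g x) = (-1) ^ j * (LINT x|lborel. f x * (D1 ^^ j) g x)"
proof (induction j arbitrary: f)
  case (Suc j)
  have "(LINT x|lborel. (D1 ^^ Suc j) f x * g x) = (LINT x|lborel. (D1 ^^ j) (D1 f) x * g x)"
    by (metis funpow_Suc_right o_apply)
  also have "\<dots> = (-1) ^ j * (LINT x|lborel. D1 f x * (D1 ^^ j) g x)"
    by (rule Suc.IH) (rule ccs_D1[OF Suc.prems])
  also have "\<dots> = (-1) ^ Suc j * (LINT x|lborel. f x * (D1 ^^ Suc j) g x)"
    by (simp add: integration_by_parts[OF Suc.prems smooth_D1_pow[OF g]])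
  finally show ?case .
qed simp

text \<open>The transpose of \<open>diff_op\<close> for the bilinear pairing: integrating by parts j
  times produces the sign and moves the coefficient under the derivative.\<close>

definition tdiff_op :: "nat \<Rightarrow> (nat \<Rightarrow> real \<Rightarrow> complex) \<Rightarrow> op1"
  where "tdiff_op n c g = (\<lambda>x. \<Sum>j\<le>n. (-1) ^ j * (D1 ^^ j) (\<lambda>x. c j x * g x) x)"

lemma tdiff_op_ccs:
  assumes "\<And>j. j \<le> n \<Longrightarrow> smooth (c j)" "g \<in> ccs" shows "tdiff_op n c g \<in> ccs"
  unfolding tdiff_op_def by (intro ccs_sum ccs_cmult ccs_D1_pow ccs_mult assms) auto

lemma smooth_diff_op:
  assumes "\<And>j. j \<le> n \<Longrightarrow> smooth (c j)" "smooth g" shows "smooth (diff_op n c g)"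
  unfolding diff_op_def by (intro smooth_sum smooth_mult smooth_D1_pow assms) auto

lemma diff_op_transpose:
  assumes c: "\<And>j. j \<le> n \<Longrightarrow> smooth (c j)" and f: "f \<in> ccs" and g: "g \<in> ccs"
  shows "(LINT x|lborel. diff_op n c f x * g x) = (LINT x|lborel. f x * tdiff_op n c g x)"
proof -
  have "(LINT x|lborel. diff_op n c f x * g x) = (LINT x|lborel. (\<Sum>j\<le>n. (D1 ^^ j) f x * (c j x * g x)))"
    by (simp add: diff_op_def sum_distrib_left sum_distrib_right mult_ac)
  also have "\<dots> = (\<Sum>j\<le>n. LINT x|lborel. (D1 ^^ j) f x * (c j x * g x))"
    by (intro Bochner_Integration.integral_sum ccs_integrable ccs_mult2 ccs_D1_pow smooth_mult f c ccs_smooth[OF g]) auto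
  also have "\<dots> = (\<Sum>j\<le>n. (-1) ^ j * (LINT x|lborel. f x * (D1 ^^ j) (\<lambda>x. c j x * g x) x))"
    by (intro sum.cong refl integration_by_parts_pow smooth_mult c ccs_smooth[OF g] f) auto
  also have "\<dots> = (\<Sum>j\<le>n. LINT x|lborel. (-1) ^ j * (f x * (D1 ^^ j) (\<lambda>x. c j x * g x) x))"
    by simp
  also have "\<dots> = (LINT x|lborel. (\<Sum>j\<le>n. (-1) ^ j * (f x * (D1 ^^ j) (\<lambda>x. c j x * g x) x)))"
    by (intro Bochner_Integration.integral_sum[symmetric] ccs_integrable ccs_cmult ccs_mult2 smooth_D1_pow smooth_mult f c ccs_smooth[OF g]) auto
  also have "\<dots> = (LINT x|lborel. f x * tdiff_op n c g x)"
    by (simp add: tdiff_op_def sum_distrib_left mult_ac)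
  finally show ?thesis .
qed

subsection \<open>The lemma of du Bois-Reymond\<close>

text \<open>The derivative of a test function may be the difference of two narrow bumps of equal
  mass, one at \<open>a\<close> and one at \<open>b\<close>. Testing with it equates the local
  averages of \<open>q\<close> at the two points. One inequality suffices, since the points may be
  exchanged.\<close>

lemma du_Bois_Reymond_const:
  fixes q :: "real \<Rightarrow> real"
  assumes q: "continuous_on {-T..T} q"
    and test: "\<And>r r' T'. (\<And>t. (r has_real_derivative r' t) (at t)) \<Longrightarrow>
      smooth (\<lambda>t. complex_of_real (r t)) \<Longrightarrow> T' < T \<Longrightarrow> (\<And>t. \<bar>t\<bar> > T' \<Longrightarrow> r t = 0) \<Longrightarrow>
      continuous_on UNIV r' \<Longrightarrow> integral {-T..T} (\<lambda>t. r' t * q t) = 0"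
    and a: "a \<in> {-T<..<T}" and b: "b \<in> {-T<..<T}"
  shows "q a \<le> q b"
proof (rule ccontr)
  assume "\<not> q a \<le> q b"
  then have ab: "q b < q a" by simp
  \<comment> \<open>A third of the gap: with \<open>q\<close> within \<open>m\<close> of its values
    at both points, the two averages remain separated by \<open>m\<close>.\<close>
  define m where "m = (q a - q b) / 3"
  have m: "m > 0" using ab by (simp add: m_def)
  have Q: "isCont q s" if "s \<in> {-T<..<T}" for s
    using continuous_on_interior[OF q, of s] that by (simp add: interior_atLeastAtMost_real)
  obtain d1 where d1: "d1 > 0" "\<And>t. \<bar>t - a\<bar> < d1 \<Longrightarrow> \<bar>q t - q a\<bar> < m"
    using Q[OF a] m unfolding continuous_at_eps_delta dist_real_def by metis
  obtain d2 where d2: "d2 > 0" "\<And>t. \<bar>t - b\<bar> < d2 \<Longrightarrow> \<bar>q t - q b\<bar> < m"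
    using Q[OF b] m unfolding continuous_at_eps_delta dist_real_def by metis
  define e where "e = min (min d1 d2) (min (T - \<bar>a\<bar>) (T - \<bar>b\<bar>)) / 2"
  have e: "e > 0" "e < d1" "e < d2" "\<bar>a\<bar> + e < T" "\<bar>b\<bar> + e < T"
  proof -
    define M where "M = min (min d1 d2) (min (T - \<bar>a\<bar>) (T - \<bar>b\<bar>))"
    have "M > 0" using d1(1) d2(1) a b by (auto simp: M_def)
    moreover have "M \<le> d1" "M \<le> d2" "M \<le> T - \<bar>a\<bar>" "M \<le> T - \<bar>b\<bar>" by (auto simp: M_def)
    moreover have "e = M / 2" by (simp add: e_def M_def)
    ultimately show "e > 0" "e < d1" "e < d2" "\<bar>a\<bar> + e < T" "\<bar>b\<bar> + e < T" by linarith+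
  qed
  obtain \<eta> :: "real \<Rightarrow> real" where \<eta>: "smooth (\<lambda>x. complex_of_real (\<eta> x))"
    "\<And>x. \<eta> x \<ge> 0" "\<And>x. \<bar>x\<bar> < 1 \<Longrightarrow> \<eta> x > 0" "\<And>x. \<bar>x\<bar> \<ge> 1 \<Longrightarrow> \<eta> x = 0"
    using bump_exists by blast
  have \<eta>c: "continuous_on S \<eta>" for S
  proof -
    have "continuous_on S (\<lambda>x. Re (complex_of_real (\<eta> x)))"
      by (intro continuous_intros smooth_continuous \<eta>)
    then show ?thesis by simp
  qed
  obtain H where H: "\<And>x. (H has_vector_derivative \<eta> x) (at x)"
    using antiderivative_exists[OF \<eta>c] by blast
  have Hs: "smooth (\<lambda>x. complex_of_real (H x))"
    by (rule smooth_antiderivative[OF \<eta>(1)])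
      (rule bounded_linear.has_vector_derivative[OF bounded_linear_of_real H])
  have H_const: "H x = H y" if S: "convex S" "x \<in> S" "y \<in> S" "\<And>x. x \<in> S \<Longrightarrow> \<eta> x = 0" for x y S
  proof -
    have "(H has_vector_derivative 0) (at x within S)" if "x \<in> S" for x
      using H[of x] S(4)[OF that] by (metis has_vector_derivative_at_within)
    then obtain c where "\<And>x. x \<in> S \<Longrightarrow> H x = c"
      using has_vector_derivative_zero_constant[OF S(1)] by blast
    then show ?thesis using S by simp
  qed
  have H_up: "H x = H 1" if "x \<ge> 1" for x
    by (rule H_const[of "{1..}"]) (use that \<eta>(4) in auto)
  have H_low: "H x = H (-1)" if "x \<le> -1" for x
    by (rule H_const[of "{..-1}"]) (use that \<eta>(4) in auto)
  define N where "N s t = \<eta> ((t - s) / e) / e" for s t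
  define r where "r t = H ((t - a) / e) - H ((t - b) / e)" for t
  define r' where "r' t = N a t - N b t" for t
  define T' where "T' = max \<bar>a\<bar> \<bar>b\<bar> + e"
  have T': "T' < T" using e by (auto simp: T'_def)
  have Nc: "continuous_on S (N s)" for S s unfolding N_def
    by (intro continuous_intros continuous_on_compose2[OF \<eta>c[of UNIV]]) (use e in auto)
  have rd: "(r has_real_derivative r' t) (at t)" for t
  proof -
    have "((\<lambda>t. H ((t - s) / e)) has_real_derivative N s t) (at t)" for s
    proof -
      have 1: "((\<lambda>t. (t - s) / e) has_real_derivative 1 / e) (at t)"
        using e(1) by (auto intro!: derivative_eq_intros)
      have 2: "(H has_real_derivative \<eta> ((t - s) / e)) (at ((t - s) / e))"
        using H by (simp add: has_real_derivative_iff_has_vector_derivative)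
      show ?thesis using DERIV_chain2[OF 2 1] by (simp add: N_def)
    qed
    then show ?thesis unfolding r_def r'_def by (intro DERIV_diff)
  qed
  have rz: "r t = 0" if "\<bar>t\<bar> > T'" for t
  proof -
    have "((t - a) / e \<ge> 1 \<and> (t - b) / e \<ge> 1) \<or> ((t - a) / e \<le> -1 \<and> (t - b) / e \<le> -1)"
    proof -
      have "\<bar>a\<bar> + e < \<bar>t\<bar>" "\<bar>b\<bar> + e < \<bar>t\<bar>" using that by (auto simp: T'_def)
      then have "(e \<le> t - a \<and> e \<le> t - b) \<or> (t - a \<le> - e \<and> t - b \<le> - e)" by linarith
      then show ?thesis using e(1) by (simp add: le_divide_eq divide_le_eq)
    qed
    then show ?thesis
      using H_up[of "(t - a) / e"] H_up[of "(t - b) / e"] H_low[of "(t - a) / e"] H_low[of "(t - b) / e"]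
      unfolding r_def by argo
  qed
  have rs: "smooth (\<lambda>t. complex_of_real (r t))"
  proof -
    have "smooth (\<lambda>t. complex_of_real (H (- s / e + t / e)))" for s
      by (rule smooth_affine[OF Hs]) (rule bounded_linear_divide)
    from smooth_add[OF this[of a] smooth_linear[OF bounded_linear_minus[OF bounded_linear_ident] this[of b]]]
    show ?thesis by (simp add: r_def diff_divide_distrib)
  qed
  have rc: "continuous_on S r'" for S unfolding r'_def by (intro continuous_intros Nc)
  have z: "integral {-T..T} (\<lambda>t. r' t * q t) = 0"
    by (rule test[OF rd rs T' rz rc])
  have I: "(\<lambda>t. N s t * q t) integrable_on {-T..T}" "N s integrable_on {-T..T}"
      "(\<lambda>t. N s t * k) integrable_on {-T..T}" for s k
    by (intro integrable_continuous_interval continuous_intros Nc q)+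
  have T: "-T < T" using a by auto
  have Nab: "integral {-T..T} (N a) = integral {-T..T} (N b)"
  proof -
    have "(r' has_integral (r T - r (-T))) {-T..T}"
      by (rule fundamental_theorem_of_calculus)
        (use rd T in \<open>auto simp: has_real_derivative_iff_has_vector_derivative intro: has_vector_derivative_at_within\<close>)
    then have "integral {-T..T} r' = 0" using rz[of T] rz[of "-T"] T' T by (simp add: integral_unique)
    then show ?thesis unfolding r'_def by (simp add: integral_diff I)
  qed
  have "integral {-T..T} (N a) \<noteq> 0"
  proof
    assume "integral {-T..T} (N a) = 0"
    then have "\<forall>t\<in>{-T..T}. N a t = 0"
      using integral_eq_0_iff[OF Nc[of "{-T..T}" a] T] \<eta>(2) e by (simp add: N_def)
    then have "N a a = 0" using a by auto
    then show False using \<eta>(3)[of 0] e by (simp add: N_def)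
  qed
  moreover have "integral {-T..T} (N a) \<ge> 0"
    by (rule integral_nonneg[OF I(2)]) (use \<eta>(2) e in \<open>auto simp: N_def\<close>)
  ultimately have pos: "integral {-T..T} (N a) > 0" by simp
  have supp: "N s t = 0" if "\<bar>t - s\<bar> \<ge> e" for s t
    using \<eta>(4)[of "(t - s) / e"] that e(1) by (simp add: N_def)
  have Nn: "N s t \<ge> 0" for s t using \<eta>(2) e by (simp add: N_def)
  have "integral {-T..T} (\<lambda>t. N a t * (q a - m)) \<le> integral {-T..T} (\<lambda>t. N a t * q t)"
  proof (rule integral_le[OF I(3) I(1)])
    show "N a t * (q a - m) \<le> N a t * q t" for t
      using d1(2)[of t] e supp[of t a] by (cases "\<bar>t - a\<bar> < e") (auto intro!: mult_left_mono Nn)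
  qed
  moreover have "integral {-T..T} (\<lambda>t. N b t * q t) \<le> integral {-T..T} (\<lambda>t. N b t * (q b + m))"
  proof (rule integral_le[OF I(1) I(3)])
    show "N b t * q t \<le> N b t * (q b + m)" for t
      using d2(2)[of t] e supp[of t b] by (cases "\<bar>t - b\<bar> < e") (auto intro!: mult_left_mono Nn)
  qed
  moreover have "integral {-T..T} (\<lambda>t. N a t * q t) = integral {-T..T} (\<lambda>t. N b t * q t)"
    using z unfolding r'_def left_diff_distrib by (simp add: integral_diff I)
  ultimately have "(q a - m) * integral {-T..T} (N a) \<le> (q b + m) * integral {-T..T} (N a)"
    using Nab by (simp add: mult.commute)
  then have "q a - m \<le> q b + m" using pos by simp
  then show False using ab by (simp add: m_def field_simps)
qed

text \<open>Subtracting an antiderivative of \<open>h\<close> from \<open>g\<close> leaves a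
  function with weak derivative zero, which is constant on the open interval by the previous lemma.
  Thus a weak equation in time becomes a classical one.\<close>

lemma du_Bois_Reymond:
  fixes g h :: "real \<Rightarrow> real"
  assumes g: "continuous_on {-T..T} g" and h: "continuous_on {-T..T} h"
    and test: "\<And>r r' T'. (\<And>t. (r has_real_derivative r' t) (at t)) \<Longrightarrow>
      smooth (\<lambda>t. complex_of_real (r t)) \<Longrightarrow> T' < T \<Longrightarrow> (\<And>t. \<bar>t\<bar> > T' \<Longrightarrow> r t = 0) \<Longrightarrow>
      continuous_on UNIV r' \<Longrightarrow> integral {-T..T} (\<lambda>t. r' t * g t + r t * h t) = 0"
    and a: "a \<in> {-T<..<T}"
  shows "(g has_real_derivative h a) (at a)"
proof -
  have T: "-T \<le> T" using a by auto
  define G where "G t = integral {-T..t} h" for t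
  have Gd: "(G has_vector_derivative h t) (at t within {-T..T})" if "t \<in> {-T..T}" for t
    unfolding G_def by (rule integral_has_vector_derivative[OF h that])
  have Gc: "continuous_on {-T..T} G"
    using Gd by (meson continuous_on_eq_continuous_within has_vector_derivative_continuous)
  define q where "q t = g t - G t" for t
  have qc: "continuous_on {-T..T} q" unfolding q_def by (intro continuous_intros g Gc)
  have le: "q s \<le> q t" if st: "s \<in> {-T<..<T}" "t \<in> {-T<..<T}" for s t
  proof (rule du_Bois_Reymond_const[OF qc _ st])
    fix r r' T' assume r: "\<And>t. (r has_real_derivative r' t) (at t)" "smooth (\<lambda>t. complex_of_real (r t))"
      "T' < T" "\<And>t. \<bar>t\<bar> > T' \<Longrightarrow> r t = 0" "continuous_on UNIV r'"
    have rc: "continuous_on {-T..T} r"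
      using r(1) by (meson DERIV_isCont continuous_at_imp_continuous_on)
    have r'c: "continuous_on {-T..T} r'" using r(5) continuous_on_subset by blast
    have "((\<lambda>t. r' t * G t + r t * h t) has_integral (r T * G T - r (-T) * G (-T))) {-T..T}"
    proof (rule fundamental_theorem_of_calculus[OF T])
      fix x assume x: "x \<in> {-T..T}"
      have "((\<lambda>t. r t * G t) has_real_derivative r' x * G x + h x * r x) (at x within {-T..T})"
        by (rule DERIV_mult[OF has_field_derivative_at_within[OF r(1)]])
          (use Gd[OF x] in \<open>simp add: has_real_derivative_iff_has_vector_derivative\<close>)
      then show "((\<lambda>t. r t * G t) has_vector_derivative r' x * G x + r x * h x) (at x within {-T..T})"
        by (simp add: has_real_derivative_iff_has_vector_derivative mult.commute)
    qed
    moreover have "r T = 0" "r (-T) = 0" using r(3,4) T by auto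
    ultimately have 1: "integral {-T..T} (\<lambda>t. r' t * G t + r t * h t) = 0"
      by (simp add: integral_unique)
    have 2: "integral {-T..T} (\<lambda>t. r' t * g t + r t * h t) = 0"
      by (rule test[OF r])
    have "integral {-T..T} (\<lambda>t. r' t * q t)
        = integral {-T..T} (\<lambda>t. (r' t * g t + r t * h t) - (r' t * G t + r t * h t))"
      by (simp add: q_def algebra_simps)
    also have "\<dots> = integral {-T..T} (\<lambda>t. r' t * g t + r t * h t) - integral {-T..T} (\<lambda>t. r' t * G t + r t * h t)"
      by (intro integral_diff integrable_continuous_interval continuous_intros rc r'c g h Gc)
    finally show "integral {-T..T} (\<lambda>t. r' t * q t) = 0" using 1 2 by simp
  qed
  have eq: "g t = q a + G t" if "t \<in> {-T<..<T}" for t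
    using le[OF a that] le[OF that a] by (simp add: q_def)
  have "(G has_vector_derivative h a) (at a)"
    using Gd[of a] a at_within_Icc_at[of "-T" a T] by auto
  then have "((\<lambda>t. q a + G t) has_vector_derivative 0 + h a) (at a)"
    by (intro has_vector_derivative_add has_vector_derivative_const)
  then have "(g has_vector_derivative h a) (at a)"
    by - (rule has_vector_derivative_transform_within_open[where S = "{-T<..<T}" and f = "\<lambda>t. q a + G t"],
      use a eq in auto)
  then show ?thesis by (simp add: has_real_derivative_iff_has_vector_derivative)
qed

section \<open>Weak solutions\<close>

lemma has_vector_derivative_quotient:
  fixes f :: "real \<Rightarrow> 'b::real_normed_vector"
  shows "(f has_vector_derivative d) (at t) \<longleftrightarrow> ((\<lambda>s. (f s - f t) /\<^sub>R (s - t)) \<longlongrightarrow> d) (at t)"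
proof -
  have "norm ((f s - f t) /\<^sub>R (s - t) - d) = norm (f s - f t - (s - t) *\<^sub>R d) / norm (s - t)" if "s \<noteq> t" for s
  proof -
    have "(f s - f t) /\<^sub>R (s - t) - d = (f s - f t - (s - t) *\<^sub>R d) /\<^sub>R (s - t)"
      using that by (simp add: scaleR_diff_right)
    then show ?thesis by (simp add: divide_inverse mult.commute)
  qed
  then have "((\<lambda>s. norm (f s - f t - (s - t) *\<^sub>R d) / norm (s - t)) \<longlongrightarrow> 0) (at t) \<longleftrightarrow>
      ((\<lambda>s. norm ((f s - f t) /\<^sub>R (s - t) - d)) \<longlongrightarrow> 0) (at t)"
    by (intro tendsto_cong) (auto simp: eventually_at_filter)
  then show ?thesis
    unfolding has_vector_derivative_def has_derivative_iff_norm
    by (simp add: bounded_linear_scaleR_left tendsto_norm_zero_iff Lim_null[symmetric])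
qed

text \<open>\<open>w\<close> is only known to be continuous, and differentiable when paired with the
  single vector \<open>e t\<close>. The difference quotient is split so that the increment of
  \<open>e\<close> meets \<open>w s\<close>, where continuity suffices, and the increment of
  \<open>w\<close> meets only \<open>e t\<close>.\<close>

lemma weak_product_rule:
  fixes w e :: "real \<Rightarrow> 'a::real_inner"
  assumes w: "isCont w t" and e: "(e has_vector_derivative e') (at t)"
    and d: "((\<lambda>s. inner (w s) (e t)) has_real_derivative d) (at t)"
  shows "((\<lambda>s. inner (w s) (e s)) has_real_derivative inner (w t) e' + d) (at t)"
proof -
  have "((\<lambda>s. inner (w s) ((e s - e t) /\<^sub>R (s - t)) + (inner (w s) (e t) - inner (w t) (e t)) / (s - t))
      \<longlongrightarrow> inner (w t) e' + d) (at t)"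
    using w e[unfolded has_vector_derivative_quotient] d[unfolded has_field_derivative_iff]
    by (intro tendsto_add tendsto_inner) (auto simp: isCont_def)
  moreover have "inner (w s) ((e s - e t) /\<^sub>R (s - t)) + (inner (w s) (e t) - inner (w t) (e t)) / (s - t)
      = (inner (w s) (e s) - inner (w t) (e t)) / (s - t)" for s
    by (simp add: inner_diff_right divide_inverse algebra_simps)
  ultimately show ?thesis unfolding has_field_derivative_iff by simp
qed

subsection \<open>Test functions in the plane\<close>

definition tsupp :: "real \<Rightarrow> real \<Rightarrow> (real \<times> real \<Rightarrow> complex) \<Rightarrow> bool"
  where "tsupp R T \<phi> \<longleftrightarrow> (\<forall>x t. \<bar>x\<bar> > R \<or> \<bar>t\<bar> > T \<longrightarrow> \<phi> (x, t) = 0)"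

definition Dx2 :: "(real \<times> real \<Rightarrow> complex) \<Rightarrow> real \<times> real \<Rightarrow> complex"
  where "Dx2 \<phi> = (\<lambda>z. (1 / \<i>) * dir_deriv (1, 0) \<phi> z)"

definition slice :: "(real \<times> real \<Rightarrow> complex) \<Rightarrow> real \<Rightarrow> real \<Rightarrow> complex"
  where "slice \<phi> t = (\<lambda>x. \<phi> (x, t))"

text \<open>On the compact support \<open>\<bar>t\<bar>\<close> attains its maximum, which is
  strictly below \<open>T\<close>. The support thus fits into a box that leaves room at both ends of
  the time interval.\<close>

lemma test_functionsD:
  assumes "\<phi> \<in> test_functions (UNIV \<times> {-T<..<T})" "T > 0"
  obtains R T' where "R > 0" "0 < T'" "T' < T" "tsupp R T' \<phi>" "smooth \<phi>"
proof -
  define K where "K = closure {z. \<phi> z \<noteq> 0}"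
  have K: "compact K" "K \<subseteq> UNIV \<times> {-T<..<T}" "smooth \<phi>"
    using assms by (auto simp: test_functions_def K_def)
  have z: "\<phi> z = 0" if "z \<notin> K" for z using that closure_subset[of "{z. \<phi> z \<noteq> 0}"] by (auto simp: K_def)
  have "bounded (fst ` K)" using K(1) by (intro compact_imp_bounded compact_continuous_image continuous_intros)
  then obtain R where R: "\<And>p. p \<in> K \<Longrightarrow> \<bar>fst p\<bar> \<le> R" by (auto simp: bounded_iff)
  have "\<exists>T'<T. \<forall>p\<in>K. \<bar>snd p\<bar> \<le> T'"
  proof (cases "K = {}")
    case True then show ?thesis using lt_ex by auto
  next
    case False
    have "continuous_on K (\<lambda>p. \<bar>snd p\<bar>)" by (intro continuous_intros)
    then obtain p where p: "p \<in> K" "\<forall>q\<in>K. \<bar>snd q\<bar> \<le> \<bar>snd p\<bar>"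
      using continuous_attains_sup[OF K(1) False] by blast
    moreover have "\<bar>snd p\<bar> < T" using p(1) K(2) by (auto simp: abs_less_iff)
    ultimately show ?thesis by blast
  qed
  then obtain T' where T': "T' < T" "\<And>p. p \<in> K \<Longrightarrow> \<bar>snd p\<bar> \<le> T'" by blast
  show ?thesis
  proof (rule that[of "max R 1" "max T' (T / 2)"])
    have "\<phi> (x, t) = 0" if "\<bar>x\<bar> > max R 1 \<or> \<bar>t\<bar> > max T' (T / 2)" for x t
    proof (rule z)
      show "(x, t) \<notin> K" using that R[of "(x, t)"] T'(2)[of "(x, t)"] by force
    qed
    then show "tsupp (max R 1) (max T' (T / 2)) \<phi>" by (auto simp: tsupp_def)
  qed (use T' assms K in auto)
qed

lemma test_functionsI:
  assumes "smooth \<phi>" "tsupp R T' \<phi>" "T' < T"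
  shows "\<phi> \<in> test_functions (UNIV \<times> {-T<..<T})"
proof -
  have sub: "closure {z. \<phi> z \<noteq> 0} \<subseteq> {-R..R} \<times> {-T'..T'}"
  proof (rule closure_minimal)
    show "{z. \<phi> z \<noteq> 0} \<subseteq> {-R..R} \<times> {-T'..T'}"
    proof
      fix z assume z: "z \<in> {z. \<phi> z \<noteq> 0}"
      obtain x t where xt: "z = (x, t)" by (cases z)
      have "\<not> (\<bar>x\<bar> > R \<or> \<bar>t\<bar> > T')"
        using assms(2) z unfolding tsupp_def xt by blast
      then show "z \<in> {-R..R} \<times> {-T'..T'}" unfolding xt mem_Times_iff by auto
    qed
  qed (intro closed_Times closed_atLeastAtMost)
  have "bounded ({-R..R} \<times> {-T'..T'})"
    by (intro compact_imp_bounded compact_Times compact_Icc)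
  then have "bounded (closure {z. \<phi> z \<noteq> 0})" using sub by (rule bounded_subset)
  then have "compact (closure {z. \<phi> z \<noteq> 0})" by (simp add: compact_eq_bounded_closed)
  moreover have "{-R..R} \<times> {-T'..T'} \<subseteq> UNIV \<times> {-T<..<T}" using assms(3) by auto
  ultimately show ?thesis using assms(1) sub unfolding test_functions_def by blast
qed

lemma tsupp_dir_deriv:
  assumes "tsupp R T \<phi>" shows "tsupp R T (dir_deriv v \<phi>)"
  unfolding tsupp_def
proof (intro allI impI)
  fix x t :: real assume xt: "\<bar>x\<bar> > R \<or> \<bar>t\<bar> > T"
  define U where "U = {z :: real \<times> real. \<bar>fst z\<bar> > R \<or> \<bar>snd z\<bar> > T}"
  have "open U" unfolding U_def by (intro open_Collect_disj open_Collect_less continuous_intros)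
  moreover have "(x, t) \<in> U" using xt by (simp add: U_def)
  moreover have "\<phi> z = 0" if "z \<in> U" for z
    using that assms by (cases z) (auto simp: U_def tsupp_def)
  ultimately have "(\<phi> has_derivative (\<lambda>v. 0)) (at (x, t))"
    by (intro has_derivative_transform_within_open[OF has_derivative_const]) auto
  then show "dir_deriv v \<phi> (x, t) = 0" by (rule dir_deriv_has_derivative)
qed

lemma tsupp_Dx2: "tsupp R T \<phi> \<Longrightarrow> tsupp R T (Dx2 \<phi>)"
  using tsupp_dir_deriv[of R T \<phi> "(1, 0)"] by (simp add: Dx2_def tsupp_def)

lemma tsupp_Dx2_pow: "tsupp R T \<phi> \<Longrightarrow> tsupp R T ((Dx2 ^^ j) \<phi>)"
  by (induction j) (auto intro: tsupp_Dx2)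

lemma tsupp_mult: "tsupp R T \<phi> \<Longrightarrow> tsupp R T (\<lambda>z. f z * \<phi> z)"
  by (simp add: tsupp_def)

lemma tsupp_add: "tsupp R T \<phi> \<Longrightarrow> tsupp R T \<psi> \<Longrightarrow> tsupp R T (\<lambda>z. \<phi> z + \<psi> z)"
  by (simp add: tsupp_def)

lemma tsupp_sum: "(\<And>j. j \<in> J \<Longrightarrow> tsupp R T (\<phi> j)) \<Longrightarrow> tsupp R T (\<lambda>z. \<Sum>j\<in>J. \<phi> j z)"
  by (auto simp: tsupp_def intro!: sum.neutral)

lemma smooth_Dx2: "smooth \<phi> \<Longrightarrow> smooth (Dx2 \<phi>)"
  unfolding Dx2_def by (intro smooth_mult smooth_const smooth_dir_deriv)

lemma smooth_Dx2_pow: "smooth \<phi> \<Longrightarrow> smooth ((Dx2 ^^ j) \<phi>)"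
  by (induction j) (auto intro: smooth_Dx2)

lemma smooth_fst: "smooth c \<Longrightarrow> smooth (\<lambda>z::real \<times> real. c (fst z))"
  using smooth_affine[of c fst 0] by (simp add: bounded_linear_fst)

lemma smooth_snd: "smooth c \<Longrightarrow> smooth (\<lambda>z::real \<times> real. c (snd z))"
  using smooth_affine[of c snd 0] by (simp add: bounded_linear_snd)

lemma bounded_linear_embed1: "bounded_linear (\<lambda>x::real. (x, 0::real))"
  and bounded_linear_embed2: "bounded_linear (\<lambda>x::real. (0::real, x))"
  by (auto intro: bounded_linear_Pair bounded_linear_ident bounded_linear_zero)

lemma smooth_slice: assumes "smooth \<phi>" shows "smooth (slice \<phi> t)"
  using smooth_affine[OF assms bounded_linear_embed1, of "(0, t)"] by (simp add: slice_def)

lemma slice_Dx2: assumes "smooth \<phi>" shows "slice (Dx2 \<phi>) t = D1 (slice \<phi> t)"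
  using dir_deriv_affine[OF assms bounded_linear_embed1, of 1 "(0, t)"]
  by (simp add: slice_def D1_def Dx2_def fun_eq_iff)

lemma slice_Dx2_pow: "smooth \<phi> \<Longrightarrow> slice ((Dx2 ^^ j) \<phi>) t = (D1 ^^ j) (slice \<phi> t)"
  by (induction j) (auto simp: slice_Dx2 smooth_Dx2_pow)

lemma slice_time_derivative:
  assumes "smooth \<phi>"
  shows "((\<lambda>t. slice \<phi> t x) has_vector_derivative slice (dir_deriv (0, 1) \<phi>) t x) (at t)"
proof -
  have "smooth (\<lambda>t. \<phi> ((x, 0) + (0, t)))" by (rule smooth_affine[OF assms bounded_linear_embed2])
  from smooth_vd[OF this, of t]
  show ?thesis using dir_deriv_affine[OF assms bounded_linear_embed2, of 1 "(x, 0)"]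
    by (simp add: slice_def)
qed

lemma slice_ccs:
  assumes "smooth \<phi>" "tsupp R T \<phi>" shows "slice \<phi> t \<in> ccs"
  by (rule ccsI[OF smooth_slice[OF assms(1)], of R]) (use assms(2) in \<open>auto simp: slice_def tsupp_def\<close>)

lemma slice_joint_continuous:
  assumes "continuous_on UNIV \<phi>"
  shows "continuous_on UNIV (\<lambda>p. slice \<phi> (fst p) (snd p))"
  unfolding slice_def
  by (rule continuous_on_compose2[OF assms]) (auto intro!: continuous_intros)

lemma slice_L2: "continuous_on UNIV \<phi> \<Longrightarrow> tsupp R T \<phi> \<Longrightarrow> slice \<phi> t \<in> L2"
  by (rule support_L2[OF joint_continuous_slice[OF slice_joint_continuous], of _ R])
    (auto simp: tsupp_def slice_def)

subsection \<open>Solutions in the sense of distributions\<close>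

lemma distr_Dx_pow: "(distr_Dx ^^ j) \<Lambda> \<phi> = (-1) ^ j * \<Lambda> ((Dx2 ^^ j) \<phi>)"
proof (induction j arbitrary: \<phi>)
  case (Suc j)
  have "(distr_Dx ^^ Suc j) \<Lambda> \<phi> = - ((distr_Dx ^^ j) \<Lambda> (Dx2 \<phi>))"
    by (simp add: distr_Dx_def Dx2_def)
  also have "\<dots> = (-1) ^ Suc j * \<Lambda> ((Dx2 ^^ j) (Dx2 \<phi>))" by (simp add: Suc.IH)
  also have "(Dx2 ^^ j) (Dx2 \<phi>) = (Dx2 ^^ Suc j) \<phi>" by (metis funpow_Suc_right o_apply)
  finally show ?case .
qed simp

definition tdiff2 :: "nat \<Rightarrow> (nat \<Rightarrow> real \<Rightarrow> complex) \<Rightarrow> (real \<times> real \<Rightarrow> complex) \<Rightarrow> real \<times> real \<Rightarrow> complex"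
  where "tdiff2 n c \<phi> = (\<lambda>z. \<Sum>j\<le>n. (-1) ^ j * (Dx2 ^^ j) (\<lambda>z. c j (fst z) * \<phi> z) z)"

lemma smooth_tdiff2:
  assumes "\<And>j. j \<le> n \<Longrightarrow> smooth (c j)" "smooth \<phi>" shows "smooth (tdiff2 n c \<phi>)"
  unfolding tdiff2_def by (intro smooth_sum smooth_mult smooth_const smooth_Dx2_pow smooth_fst assms) auto

lemma tsupp_tdiff2: "tsupp R T \<phi> \<Longrightarrow> tsupp R T (tdiff2 n c \<phi>)"
  unfolding tdiff2_def by (intro tsupp_sum tsupp_mult tsupp_Dx2_pow)

lemma slice_tdiff2:
  assumes "\<And>j. j \<le> n \<Longrightarrow> smooth (c j)" "smooth \<phi>"
  shows "slice (tdiff2 n c \<phi>) t = tdiff_op n c (slice \<phi> t)"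
proof
  fix x
  have "(Dx2 ^^ j) (\<lambda>z. c j (fst z) * \<phi> z) (x, t) = (D1 ^^ j) (\<lambda>x. c j x * slice \<phi> t x) x" if "j \<le> n" for j
    using slice_Dx2_pow[OF smooth_mult[OF smooth_fst[OF assms(1)[OF that]] assms(2)], of j t]
    by (simp add: slice_def fun_eq_iff)
  then show "slice (tdiff2 n c \<phi>) t x = tdiff_op n c (slice \<phi> t) x"
    by (simp add: slice_def tdiff2_def tdiff_op_def)
qed

text \<open>Passes from the representatives \<open>u t\<close> to a curve \<open>w\<close> in the
  Hilbert space. Its continuity stands in for joint measurability of u when iterated integrals are
  handled.\<close>

locale l2curve =
  fixes T :: real and u :: "real \<Rightarrow> real \<Rightarrow> complex"
  assumes T: "T > 0" and u: "L2_curve T u"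
begin

lemma uL: "\<bar>t\<bar> \<le> T \<Longrightarrow> u t \<in> L2"
  using u by (auto simp: L2_curve_def abs_le_iff)

definition w :: "real \<Rightarrow> ltwo" where "w t = emb (u t)"

lemma w_cont: "continuous_on {-T..T} w"
  unfolding continuous_on_def
proof
  fix t assume t: "t \<in> {-T..T}"
  have "((\<lambda>s. L2_norm (\<lambda>x. u s x - u t x)) \<longlongrightarrow> 0) (at t within {-T..T})"
    using u t by (auto simp: L2_curve_def)
  moreover have "eventually (\<lambda>s. L2_norm (\<lambda>x. u s x - u t x) = norm (w s - w t)) (at t within {-T..T})"
    unfolding eventually_at_filter
    by (rule always_eventually) (use t uL in \<open>auto simp: w_def abs_le_iff simp flip: emb_diff norm_emb[OF L2_diff]\<close>)
  ultimately have "((\<lambda>s. norm (w s - w t)) \<longlongrightarrow> 0) (at t within {-T..T})"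
    by (rule Lim_transform_eventually)
  then show "(w \<longlongrightarrow> w t) (at t within {-T..T})"
    by (simp add: tendsto_norm_zero_iff Lim_null[symmetric])
qed

definition I where "I \<phi> t = (LINT x|lborel. u t x * \<phi> (x, t))"

lemma Re_I: "\<bar>t\<bar> \<le> T \<Longrightarrow> continuous_on UNIV \<phi> \<Longrightarrow> tsupp R T' \<phi> \<Longrightarrow> Re (I \<phi> t) = pair (w t) (slice \<phi> t)"
  using slice_L2[of \<phi> R T' t] by (simp add: w_def pair_emb uL I_def) (simp add: slice_def)

lemma pair_slice_continuous:
  assumes "continuous_on UNIV \<phi>" "tsupp R T' \<phi>" "R > 0"
  shows "continuous_on {-T..T} (\<lambda>t. pair (w t) (slice \<phi> t))"
proof -
  have "isCont (\<lambda>t. emb (\<lambda>x. cnj (slice \<phi> t x))) t" for t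
  proof (rule emb_curve_continuous[where R = R])
    show "continuous_on UNIV (\<lambda>p. cnj (slice \<phi> (fst p) (snd p)))"
      by (intro continuous_intros slice_joint_continuous assms)
  qed (use assms in \<open>auto simp: slice_def tsupp_def\<close>)
  then show ?thesis unfolding pair_def
    by (intro continuous_on_inner w_cont) (simp add: continuous_at_imp_continuous_on)
qed

lemma I_cmult: "I (\<lambda>z. c * \<phi> z) t = c * I \<phi> t"
  by (simp add: I_def mult.left_commute)

lemma I_continuous:
  assumes "continuous_on UNIV \<phi>" "tsupp R T' \<phi>" "R > 0"
  shows "continuous_on {-T..T} (I \<phi>)"
proof -
  have a: "continuous_on UNIV (\<lambda>z. - \<i> * \<phi> z)" "tsupp R T' (\<lambda>z. - \<i> * \<phi> z)"
    by (intro continuous_intros tsupp_mult assms)+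
  \<comment> \<open>Since \<open>Re (- \<i> * z) = Im z\<close>, the imaginary part of
    \<open>I \<phi>\<close> is the real pairing with \<open>- \<i> * \<phi>\<close>.\<close>
  have "continuous_on {-T..T} (\<lambda>t. Complex (pair (w t) (slice \<phi> t)) (pair (w t) (slice (\<lambda>z. - \<i> * \<phi> z) t)))"
    unfolding Complex_eq by (intro continuous_intros pair_slice_continuous[OF assms] pair_slice_continuous[OF a assms(3)])
  moreover have "I \<phi> t = Complex (pair (w t) (slice \<phi> t)) (pair (w t) (slice (\<lambda>z. - \<i> * \<phi> z) t))" if "t \<in> {-T..T}" for t
  proof -
    have t: "\<bar>t\<bar> \<le> T" using that by auto
    show ?thesis using Re_I[OF t assms(1,2)] Re_I[OF t a] I_cmult[of "-\<i>" \<phi> t]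
      by (intro complex_eqI) auto
  qed
  ultimately show ?thesis by (metis (no_types, lifting) continuous_on_cong)
qed

lemma I_zero: "tsupp R T' \<phi> \<Longrightarrow> \<bar>t\<bar> > T' \<Longrightarrow> I \<phi> t = 0"
  by (simp add: I_def tsupp_def)

lemma I_integrable:
  assumes "continuous_on UNIV \<phi>" "tsupp R T' \<phi>" "R > 0" "T' < T"
  shows "integrable lborel (I \<phi>)"
  by (rule support_integrable[OF I_continuous[OF assms(1,2,3)]], rule I_zero[OF assms(2)])
    (use assms(4) in \<open>auto simp: abs_if\<close>)

lemma I_add:
  assumes "continuous_on UNIV \<phi>" "tsupp R T' \<phi>" "continuous_on UNIV \<psi>" "tsupp R T' \<psi>" "T' < T"
  shows "I (\<lambda>z. \<phi> z + \<psi> z) t = I \<phi> t + I \<psi> t"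
proof (cases "\<bar>t\<bar> \<le> T")
  case True
  have "integrable lborel (\<lambda>x. u t x * slice \<phi> t x)" "integrable lborel (\<lambda>x. u t x * slice \<psi> t x)"
    by (intro L2_mult_integrable uL True slice_L2[of _ R T'] assms)+
  then show ?thesis by (simp add: I_def slice_def distrib_left)
next
  case False
  then show ?thesis using assms by (simp add: I_zero[of R T'] tsupp_add)
qed

lemma distr_of_I: "distr_of u \<phi> = (LINT t|lborel. I \<phi> t)"
  by (simp add: distr_of_def I_def)

lemma distr_of_cmult: "distr_of u (\<lambda>z. c * \<phi> z) = c * distr_of u \<phi>"
  by (simp add: distr_of_I I_cmult)

lemma distr_of_add:
  assumes "continuous_on UNIV \<phi>" "tsupp R T' \<phi>" "continuous_on UNIV \<psi>" "tsupp R T' \<psi>" "R > 0" "T' < T"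
  shows "distr_of u (\<lambda>z. \<phi> z + \<psi> z) = distr_of u \<phi> + distr_of u \<psi>"
  using assms by (simp add: distr_of_I I_add[OF assms(1-4)] I_integrable)

lemma distr_of_add4:
  assumes "smooth f1" "smooth f2" "smooth f3" "smooth f4"
    "tsupp R T' f1" "tsupp R T' f2" "tsupp R T' f3" "tsupp R T' f4" "R > 0" "T' < T"
  shows "distr_of u f1 + distr_of u f2 + distr_of u f3 + distr_of u f4 = distr_of u (\<lambda>z. f1 z + f2 z + f3 z + f4 z)"
  using assms by (simp add: distr_of_add[of _ R T'] smooth_continuous smooth_add tsupp_add)

lemma distr_of_sum:
  assumes "finite J" "R > 0" "T' < T"
  shows "(\<And>j. j \<in> J \<Longrightarrow> continuous_on UNIV (\<phi> j) \<and> tsupp R T' (\<phi> j)) \<Longrightarrow>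
    distr_of u (\<lambda>z. \<Sum>j\<in>J. \<phi> j z) = (\<Sum>j\<in>J. distr_of u (\<phi> j))"
  using assms(1)
proof (induction J rule: finite_induct)
  case (insert j J)
  have "distr_of u (\<lambda>z. \<phi> j z + (\<Sum>j\<in>J. \<phi> j z)) = distr_of u (\<phi> j) + distr_of u (\<lambda>z. \<Sum>j\<in>J. \<phi> j z)"
    by (rule distr_of_add[of _ R T']) (use insert assms in \<open>auto intro!: continuous_on_sum tsupp_sum\<close>)
  then show ?case using insert by simp
qed (simp add: distr_of_I I_def)

lemma distr_diff_op_eq:
  assumes "\<And>j. j \<le> n \<Longrightarrow> smooth (c j)" "smooth \<phi>" "tsupp R T' \<phi>" "R > 0" "T' < T"
  shows "distr_diff_op n c (distr_of u) \<phi> = distr_of u (tdiff2 n c \<phi>)"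
proof -
  have "distr_diff_op n c (distr_of u) \<phi> = (\<Sum>j\<le>n. distr_of u (\<lambda>z. (-1) ^ j * (Dx2 ^^ j) (\<lambda>z. c j (fst z) * \<phi> z) z))"
    by (simp add: distr_diff_op_def distr_mult_def distr_Dx_pow distr_of_cmult)
  also have "\<dots> = distr_of u (tdiff2 n c \<phi>)"
    unfolding tdiff2_def
    by (rule distr_of_sum[symmetric, of _ R T'])
      (use assms in \<open>auto intro!: tsupp_mult tsupp_Dx2_pow smooth_continuous smooth_mult smooth_const smooth_Dx2_pow smooth_fst\<close>)
  finally show ?thesis .
qed

end

text \<open>The coefficients of \<open>P = D\<^sup>k + A + \<Sum> b\<^sub>j D\<^sup>j\<close>,
  gathered into one operator of order k. With b = 0 it describes the unperturbed operator.\<close>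

definition opcoeff :: "nat \<Rightarrow> nat \<Rightarrow> (nat \<Rightarrow> real \<Rightarrow> complex) \<Rightarrow> (nat \<Rightarrow> real \<Rightarrow> complex) \<Rightarrow> nat \<Rightarrow> real \<Rightarrow> complex"
  where "opcoeff k m a b j = (\<lambda>x. (if j = k then 1 else 0) + (if j \<le> k - 2 then a j x else 0) + (if j \<le> m then b j x else 0))"

lemma sum_atMost_restrict: "m \<le> k \<Longrightarrow> (\<Sum>j\<le>k. if j \<le> m then f j else 0) = (\<Sum>j\<le>m. f j)" for k m :: nat
  by (rule sum.mono_neutral_cong_right) auto

lemma smooth_if: "(P \<Longrightarrow> smooth f) \<Longrightarrow> smooth (\<lambda>x. if P then f x else 0)"
  by (cases P) auto

lemma Cbar_if: "(P \<Longrightarrow> f \<in> Cbar_infinity) \<Longrightarrow> (\<lambda>x. if P then f x else 0) \<in> Cbar_infinity"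
  by (cases P) auto

lemma tdiff2_opcoeff:
  assumes a: "\<And>j. j \<le> k - 2 \<Longrightarrow> smooth (a j)" and b: "\<And>j. j \<le> m \<Longrightarrow> smooth (b j)"
    and \<phi>: "smooth \<phi>" and m: "m \<le> k - 2"
  shows "tdiff2 k (opcoeff k m a b) \<phi> z = (-1) ^ k * (Dx2 ^^ k) \<phi> z + tdiff2 (k - 2) a \<phi> z + tdiff2 m b \<phi> z"
proof -
  have add: "(Dx2 ^^ j) (\<lambda>z. f z + g z) = (\<lambda>z. (Dx2 ^^ j) f z + (Dx2 ^^ j) g z)" if "smooth f" "smooth g" for f g j
  proof (induction j)
    case (Suc j)
    have "Dx2 (\<lambda>z. F z + G z) = (\<lambda>z. Dx2 F z + Dx2 G z)" if "smooth F" "smooth G" for F G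
      using that by (auto simp: Dx2_def dir_deriv_add smooth_differentiable algebra_simps)
    from this[OF smooth_Dx2_pow[of f j] smooth_Dx2_pow[of g j]]
    show ?case using that Suc by simp
  qed simp
  have zero: "(Dx2 ^^ j) (\<lambda>z. 0) = (\<lambda>z. 0)" for j
  proof (induction j)
    case (Suc j)
    have "dir_deriv v (\<lambda>z::real \<times> real. 0::complex) = (\<lambda>z. 0)" for v
      by (rule ext) (rule dir_deriv_has_derivative[OF has_derivative_const])
    then show ?case using Suc by (simp add: Dx2_def)
  qed simp
  have "(Dx2 ^^ j) (\<lambda>z. opcoeff k m a b j (fst z) * \<phi> z) z
     = (if j = k then (Dx2 ^^ j) \<phi> z else 0)
       + (if j \<le> k - 2 then (Dx2 ^^ j) (\<lambda>z. a j (fst z) * \<phi> z) z else 0)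
       + (if j \<le> m then (Dx2 ^^ j) (\<lambda>z. b j (fst z) * \<phi> z) z else 0)" for j
  proof -
    define f1 f2 f3 where "f1 = (\<lambda>z. if j = k then \<phi> z else 0)"
      and "f2 = (\<lambda>z. if j \<le> k - 2 then a j (fst z) * \<phi> z else 0)"
      and "f3 = (\<lambda>z. if j \<le> m then b j (fst z) * \<phi> z else 0)"
    have s: "smooth f1" "smooth f2" "smooth f3"
      unfolding f1_def f2_def f3_def by (intro smooth_if \<phi> smooth_mult smooth_fst a b; assumption)+
    have "(\<lambda>z. opcoeff k m a b j (fst z) * \<phi> z) = (\<lambda>z. f1 z + f2 z + f3 z)"
      by (rule ext) (simp add: opcoeff_def f1_def f2_def f3_def distrib_right)
    then have "(Dx2 ^^ j) (\<lambda>z. opcoeff k m a b j (fst z) * \<phi> z) z = (Dx2 ^^ j) f1 z + (Dx2 ^^ j) f2 z + (Dx2 ^^ j) f3 z"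
      using s by (simp add: add smooth_add)
    moreover have "(Dx2 ^^ j) f1 z = (if j = k then (Dx2 ^^ j) \<phi> z else 0)"
      by (simp add: f1_def zero)
    moreover have "(Dx2 ^^ j) f2 z = (if j \<le> k - 2 then (Dx2 ^^ j) (\<lambda>z. a j (fst z) * \<phi> z) z else 0)"
      unfolding f2_def by (cases "j \<le> k - 2") (simp_all add: zero)
    moreover have "(Dx2 ^^ j) f3 z = (if j \<le> m then (Dx2 ^^ j) (\<lambda>z. b j (fst z) * \<phi> z) z else 0)"
      unfolding f3_def by (cases "j \<le> m") (simp_all add: zero)
    ultimately show ?thesis by simp
  qed
  then have "tdiff2 k (opcoeff k m a b) \<phi> z
    = (\<Sum>j\<le>k. (if j = k then (-1) ^ j * (Dx2 ^^ j) \<phi> z else 0)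
       + (if j \<le> k - 2 then (-1) ^ j * (Dx2 ^^ j) (\<lambda>z. a j (fst z) * \<phi> z) z else 0)
       + (if j \<le> m then (-1) ^ j * (Dx2 ^^ j) (\<lambda>z. b j (fst z) * \<phi> z) z else 0))"
    unfolding tdiff2_def by (intro sum.cong refl) (simp add: distrib_left)
  also have "\<dots> = (-1) ^ k * (Dx2 ^^ k) \<phi> z + tdiff2 (k - 2) a \<phi> z + tdiff2 m b \<phi> z"
  proof -
    have "m \<le> k" "k - 2 \<le> k" using m by auto
    then show ?thesis by (simp add: sum.distrib sum_atMost_restrict tdiff2_def del: of_nat_diff)
  qed
  finally show ?thesis .
qed

context l2curve
begin

text \<open>Up to sign the transpose of \<open>\<partial>\<^sub>t - \<i> P\<close>, since
  \<open>L u = 0\<close> reads \<open>\<partial>\<^sub>t u = \<i> P u\<close>.\<close>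

definition S where "S n c \<phi> = (\<lambda>z. dir_deriv (0, 1) \<phi> z + \<i> * tdiff2 n c \<phi> z)"

lemma smooth_S: "(\<And>j. j \<le> n \<Longrightarrow> smooth (c j)) \<Longrightarrow> smooth \<phi> \<Longrightarrow> smooth (S n c \<phi>)"
  unfolding S_def by (intro smooth_add smooth_mult smooth_const smooth_tdiff2 smooth_dir_deriv)

lemma tsupp_S: "tsupp R T' \<phi> \<Longrightarrow> tsupp R T' (S n c \<phi>)"
  unfolding S_def by (intro tsupp_add tsupp_mult tsupp_tdiff2 tsupp_dir_deriv)

lemma slice_S:
  assumes "\<And>j. j \<le> n \<Longrightarrow> smooth (c j)" "smooth \<phi>"
  shows "slice (S n c \<phi>) t = (\<lambda>x. slice (dir_deriv (0, 1) \<phi>) t x + \<i> * tdiff_op n c (slice \<phi> t) x)"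
  using slice_tdiff2[OF assms, where t = t] by (auto simp: S_def slice_def fun_eq_iff)

lemma distr_L_eq:
  assumes a: "\<And>j. j \<le> k - 2 \<Longrightarrow> smooth (a j)" and b: "\<And>j. j \<le> m \<Longrightarrow> smooth (b j)" and m: "m \<le> k - 2"
    and \<phi>: "smooth \<phi>" "tsupp R T' \<phi>" "R > 0" "T' < T"
  shows "distr_L k m a b (distr_of u) \<phi> = \<i> * distr_of u (S k (opcoeff k m a b) \<phi>)"
proof -
  let ?n1 = "\<lambda>z. \<i> * dir_deriv (0, 1) \<phi> z" and ?n2 = "\<lambda>z. (- ((-1) ^ k)) * (Dx2 ^^ k) \<phi> z"
  let ?n3 = "\<lambda>z. - 1 * tdiff2 (k - 2) a \<phi> z" and ?n4 = "\<lambda>z. - 1 * tdiff2 m b \<phi> z"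
  note s = smooth_mult smooth_const smooth_dir_deriv smooth_Dx2_pow smooth_tdiff2 a b \<phi>
  have sm: "smooth ?n1" "smooth ?n2" "smooth ?n3" "smooth ?n4" by (intro s | assumption)+
  have ts: "tsupp R T' ?n1" "tsupp R T' ?n2" "tsupp R T' ?n3" "tsupp R T' ?n4"
    by (intro tsupp_mult tsupp_dir_deriv tsupp_Dx2_pow tsupp_tdiff2 \<phi>)+
  have "distr_L k m a b (distr_of u) \<phi> = distr_of u ?n1 + distr_of u ?n2 + distr_of u ?n3 + distr_of u ?n4"
    unfolding distr_of_cmult distr_L_def distr_Dt_def distr_Dx_pow
    using distr_diff_op_eq[of "k - 2" a, OF _ \<phi>] distr_diff_op_eq[of m b, OF _ \<phi>] a b
    by (simp add: distr_of_cmult)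
  also have "\<dots> = distr_of u (\<lambda>z. ?n1 z + ?n2 z + ?n3 z + ?n4 z)"
    by (rule distr_of_add4[OF sm ts \<phi>(3,4)])
  also have "(\<lambda>z. ?n1 z + ?n2 z + ?n3 z + ?n4 z) = (\<lambda>z. \<i> * S k (opcoeff k m a b) \<phi> z)"
    using tdiff2_opcoeff[of k a m b, OF _ _ \<phi>(1) m] a b by (simp add: S_def algebra_simps)
  finally show ?thesis by (simp add: distr_of_cmult)
qed

lemma pair_time_derivative:
  assumes c: "\<And>j. j \<le> n \<Longrightarrow> smooth (c j)" and \<phi>: "smooth \<phi>" "tsupp R T' \<phi>" "R > 0" and t: "t \<in> {-T<..<T}"
    and d: "((\<lambda>s. pair (w s) (slice \<phi> t)) has_real_derivative pair (w t) (\<lambda>x. \<i> * tdiff_op n c (slice \<phi> t) x)) (at t)"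
  shows "((\<lambda>s. pair (w s) (slice \<phi> s)) has_real_derivative pair (w t) (slice (S n c \<phi>) t)) (at t)"
proof -
  have e: "((\<lambda>s. emb (\<lambda>x. cnj (slice \<phi> s x))) has_vector_derivative
      emb (\<lambda>x. cnj (slice (dir_deriv (0, 1) \<phi>) t x))) (at t)"
  proof (rule emb_curve_derivative(2)[where R = R])
    show "((\<lambda>t. cnj (slice \<phi> t x)) has_vector_derivative cnj (slice (dir_deriv (0, 1) \<phi>) t x)) (at t)" for t x
      by (rule bounded_linear.has_vector_derivative[OF bounded_linear_cnj slice_time_derivative[OF \<phi>(1)]])
    show "continuous_on UNIV (\<lambda>p. cnj (slice (dir_deriv (0, 1) \<phi>) (fst p) (snd p)))"
      by (intro continuous_intros slice_joint_continuous smooth_continuous smooth_dir_deriv \<phi>)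
    show "continuous_on UNIV (\<lambda>x. cnj (slice \<phi> t x))" for t
      by (intro continuous_intros smooth_continuous smooth_slice \<phi>)
  qed (use \<phi> in \<open>auto simp: tsupp_def slice_def\<close>)
  have "isCont w t" using continuous_on_interior[OF w_cont] t by (auto simp: interior_atLeastAtMost_real)
  from weak_product_rule[OF this e d[unfolded pair_def]]
  have "((\<lambda>s. pair (w s) (slice \<phi> s)) has_real_derivative
      pair (w t) (slice (dir_deriv (0, 1) \<phi>) t) + pair (w t) (\<lambda>x. \<i> * tdiff_op n c (slice \<phi> t) x)) (at t)"
    by (simp add: pair_def)
  moreover have "pair (w t) (slice (S n c \<phi>) t) =
      pair (w t) (slice (dir_deriv (0, 1) \<phi>) t) + pair (w t) (\<lambda>x. \<i> * tdiff_op n c (slice \<phi> t) x)"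
  proof -
    have "slice (dir_deriv (0, 1) \<phi>) t \<in> ccs"
      by (rule slice_ccs[OF smooth_dir_deriv[OF \<phi>(1)] tsupp_dir_deriv[OF \<phi>(2)]])
    moreover have "(\<lambda>x. \<i> * tdiff_op n c (slice \<phi> t) x) \<in> ccs"
      by (intro ccs_cmult tdiff_op_ccs c slice_ccs[OF \<phi>(1,2)])
    moreover have "slice (S n c \<phi>) t = (\<lambda>x. slice (dir_deriv (0, 1) \<phi>) t x + \<i> * tdiff_op n c (slice \<phi> t) x)"
      by (rule slice_S) (use c \<phi> in auto)
    ultimately show ?thesis by (simp add: pair_add ccs_L2)
  qed
  ultimately show ?thesis by simp
qed

lemma Re_distr_of:
  assumes "continuous_on UNIV \<phi>" "tsupp R T' \<phi>" "R > 0" "T' \<le> T1" "T1 \<le> T" "T' < T"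
  shows "Re (distr_of u \<phi>) = integral {-T1..T1} (\<lambda>t. pair (w t) (slice \<phi> t))"
proof -
  have z: "pair (w t) (slice \<phi> t) = 0" if "\<bar>t\<bar> > T'" for t
  proof -
    have "slice \<phi> t = (\<lambda>x. 0)" using that assms(2) by (auto simp: slice_def tsupp_def)
    then show ?thesis by (simp add: pair_def emb_zero)
  qed
  have "Re (distr_of u \<phi>) = (LINT t|lborel. Re (I \<phi> t))"
    unfolding distr_of_I using I_integrable[OF assms(1-3,6)] by simp
  also have "\<dots> = (LINT t|lborel. pair (w t) (slice \<phi> t))"
  proof (rule Bochner_Integration.integral_cong)
    show "Re (I \<phi> t) = pair (w t) (slice \<phi> t)" for t
      using Re_I[OF _ assms(1,2), of t] I_zero[OF assms(2), of t] z[of t] assms(6)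
      by (cases "\<bar>t\<bar> \<le> T") auto
  qed simp
  also have "\<dots> = integral {-T1..T1} (\<lambda>t. pair (w t) (slice \<phi> t))"
  proof (rule support_integrable(2))
    show "continuous_on {-T1..T1} (\<lambda>t. pair (w t) (slice \<phi> t))"
      by (rule continuous_on_subset[OF pair_slice_continuous[OF assms(1-3)]]) (use assms in auto)
    show "pair (w t) (slice \<phi> t) = 0" if "t \<notin> {-T1..T1}" for t
      by (rule z) (use that assms in \<open>auto simp: abs_if split: if_splits\<close>)
  qed
  finally show ?thesis .
qed

text \<open>From left to right, test functions of product form \<open>\<theta> x * r t\<close> leave
  a weak equation in time alone, to which \<open>du_Bois_Reymond\<close> applies. From right to
  left, the weak equation and the product rule make the time integrand an exact derivative, whose
  integral vanishes by the support condition.\<close>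

lemma distributional_iff_weak:
  assumes a: "\<And>j. j \<le> k - 2 \<Longrightarrow> smooth (a j)" and b: "\<And>j. j \<le> m \<Longrightarrow> smooth (b j)" and m: "m \<le> k - 2"
  shows "(\<forall>\<phi>\<in>test_functions (UNIV \<times> {-T<..<T}). distr_L k m a b (distr_of u) \<phi> = 0) \<longleftrightarrow>
    (\<forall>\<theta>\<in>ccs. \<forall>t\<in>{-T<..<T}. ((\<lambda>s. pair (w s) \<theta>) has_real_derivative
      pair (w t) (\<lambda>x. \<i> * tdiff_op k (opcoeff k m a b) \<theta> x)) (at t))"
    (is "?A \<longleftrightarrow> ?B")
proof -
  let ?c = "opcoeff k m a b"
  have c: "smooth (?c j)" for j
    unfolding opcoeff_def by (intro smooth_add smooth_if a b smooth_const)
  show ?thesis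
  proof
    assume A: ?A
    show ?B
    proof (intro ballI)
      fix \<theta> t assume \<theta>: "\<theta> \<in> ccs" and t: "t \<in> {-T<..<T}"
      obtain R where R: "R > 0" "\<And>x. \<bar>x\<bar> \<ge> R \<Longrightarrow> \<theta> x = 0" using ccsE[OF \<theta>] by blast
      define \<theta>' where "\<theta>' = (\<lambda>x. \<i> * tdiff_op k ?c \<theta> x)"
      have \<theta>': "\<theta>' \<in> ccs" unfolding \<theta>'_def by (intro ccs_cmult tdiff_op_ccs c \<theta>)
      have pc: "continuous_on {-T..T} (\<lambda>s. pair (w s) \<eta>)" for \<eta>
        unfolding pair_def by (intro continuous_intros w_cont)
      show "((\<lambda>s. pair (w s) \<theta>) has_real_derivative pair (w t) \<theta>') (at t)"
      proof (rule du_Bois_Reymond[OF pc pc _ t])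
        fix r r' T' assume r: "\<And>t. (r has_real_derivative r' t) (at t)" "smooth (\<lambda>t. complex_of_real (r t))"
          "T' < T" "\<And>t. \<bar>t\<bar> > T' \<Longrightarrow> r t = 0" "continuous_on UNIV r'"
        define \<phi> where "\<phi> z = \<theta> (fst z) * complex_of_real (r (snd z))" for z
        have \<phi>s: "smooth \<phi>" unfolding \<phi>_def by (intro smooth_mult smooth_fst smooth_snd ccs_smooth \<theta> r)
        have \<phi>t: "tsupp R T' \<phi>" using R r(4) by (auto simp: tsupp_def \<phi>_def)
        have "\<phi> \<in> test_functions (UNIV \<times> {-T<..<T})" by (rule test_functionsI[OF \<phi>s \<phi>t r(3)])
        then have "\<i> * distr_of u (S k ?c \<phi>) = 0"
          using A distr_L_eq[of k a m b, OF _ _ m \<phi>s \<phi>t R(1) r(3)] a b by simp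
        then have 0: "Re (distr_of u (S k ?c \<phi>)) = 0" by simp
        have S': "slice (S k ?c \<phi>) s = (\<lambda>x. r' s *\<^sub>R \<theta> x + r s *\<^sub>R \<theta>' x)" for s
        proof -
          have 1: "slice \<phi> s = (\<lambda>x. complex_of_real (r s) * \<theta> x)" by (auto simp: slice_def \<phi>_def)
          have "((\<lambda>s. slice \<phi> s x) has_vector_derivative \<theta> x * complex_of_real (r' s)) (at s)" for x
          proof -
            have "(r has_vector_derivative r' s) (at s)"
              using r(1) by (simp add: has_real_derivative_iff_has_vector_derivative)
            from bounded_linear.has_vector_derivative[OF bounded_linear_mult_right
                bounded_linear.has_vector_derivative[OF bounded_linear_of_real this], of "\<theta> x"]
            show ?thesis by (simp add: slice_def \<phi>_def)
          qed
          then have 2: "slice (dir_deriv (0, 1) \<phi>) s x = \<theta> x * complex_of_real (r' s)" for x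
            using slice_time_derivative[OF \<phi>s] vector_derivative_unique_at by blast
          have 3: "tdiff_op k ?c (slice \<phi> s) = (\<lambda>x. complex_of_real (r s) * tdiff_op k ?c \<theta> x)"
          proof
            fix x
            have "(D1 ^^ j) (\<lambda>x. ?c j x * (complex_of_real (r s) * \<theta> x)) x
                = complex_of_real (r s) * (D1 ^^ j) (\<lambda>x. ?c j x * \<theta> x) x" for j
              using D1_pow_cmult[OF smooth_mult[OF c ccs_smooth[OF \<theta>]], of j "complex_of_real (r s)" j]
              by (simp add: mult.left_commute)
            then show "tdiff_op k ?c (slice \<phi> s) x = complex_of_real (r s) * tdiff_op k ?c \<theta> x"
              by (simp add: tdiff_op_def 1 sum_distrib_left mult.left_commute)
          qed
          show ?thesis using slice_S[OF c \<phi>s, where ?t = s and n = k]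
            by (simp add: 2 3 \<theta>'_def scaleR_conv_of_real mult_ac fun_eq_iff)
        qed
        have "pair (w s) (slice (S k ?c \<phi>) s) = r' s * pair (w s) \<theta> + r s * pair (w s) \<theta>'" for s
        proof -
          have L: "\<theta> \<in> L2" "\<theta>' \<in> L2" using \<theta> \<theta>' by (auto intro: ccs_L2)
          have sc: "pair (w s) (\<lambda>x. q *\<^sub>R \<eta> x) = q * pair (w s) \<eta>" if "\<eta> \<in> L2" for q \<eta>
            using emb_scaleR[OF L2_cnj[OF that], of q] by (simp add: pair_def)
          show ?thesis unfolding S' using L by (simp add: pair_add L2_scaleR sc)
        qed
        moreover have "Re (distr_of u (S k ?c \<phi>)) = integral {-T..T} (\<lambda>t. pair (w t) (slice (S k ?c \<phi>) t))"
          by (rule Re_distr_of[OF smooth_continuous[OF smooth_S[OF c \<phi>s]] tsupp_S[OF \<phi>t] R(1)])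
            (use r(3) in auto)
        ultimately show "integral {-T..T} (\<lambda>t. r' t * pair (w t) \<theta> + r t * pair (w t) \<theta>') = 0"
          using 0 by simp
      qed
    qed
  next
    assume B: ?B
    have key: "Re (distr_of u (S k ?c \<phi>)) = 0" if \<phi>: "smooth \<phi>" "tsupp R T' \<phi>" "R > 0" "0 < T'" "T' < T" for \<phi> R T'
    proof -
      \<comment> \<open>Strictly between T' and T: the test function already vanishes at the end
        points, while the weak equation, known on the open interval, still holds there.\<close>
      define T1 where "T1 = (T' + T) / 2"
      have T1: "T' < T1" "T1 < T" "0 < T1" using \<phi> by (auto simp: T1_def)
      have d: "((\<lambda>s. pair (w s) (slice \<phi> s)) has_vector_derivative pair (w t) (slice (S k ?c \<phi>) t)) (at t within {-T1..T1})"
        if "t \<in> {-T1..T1}" for t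
      proof -
        have t: "t \<in> {-T<..<T}" using that T1 by auto
        show ?thesis
          using pair_time_derivative[OF c \<phi>(1-3) t, of k] B slice_ccs[OF \<phi>(1,2), of t] t
          by (simp add: has_real_derivative_iff_has_vector_derivative has_vector_derivative_at_within)
      qed
      have "Re (distr_of u (S k ?c \<phi>)) = integral {-T1..T1} (\<lambda>t. pair (w t) (slice (S k ?c \<phi>) t))"
        by (rule Re_distr_of[OF smooth_continuous[OF smooth_S[OF c \<phi>(1)]] tsupp_S[OF \<phi>(2)] \<phi>(3)])
          (use T1 \<phi> in auto)
      also have "\<dots> = pair (w T1) (slice \<phi> T1) - pair (w (-T1)) (slice \<phi> (-T1))"
        by (rule integral_unique, rule fundamental_theorem_of_calculus) (use d T1 in auto)
      also have "\<dots> = 0"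
      proof -
        have "slice \<phi> T1 = (\<lambda>x. 0)" "slice \<phi> (-T1) = (\<lambda>x. 0)"
          using T1 \<phi> by (auto simp: slice_def tsupp_def)
        then show ?thesis by (simp add: pair_def emb_zero)
      qed
      finally show ?thesis .
    qed
    show ?A
    proof
      fix \<phi> assume "\<phi> \<in> test_functions (UNIV \<times> {-T<..<T})"
      then obtain R T' where \<phi>: "R > 0" "0 < T'" "T' < T" "tsupp R T' \<phi>" "smooth \<phi>"
        using test_functionsD T by metis
      \<comment> \<open>\<open>key\<close> only controls real parts; applied to
        \<open>\<i> * \<phi>\<close> it controls the imaginary part too.\<close>
      have "S k ?c (\<lambda>z. \<i> * \<phi> z) = (\<lambda>z. \<i> * S k ?c \<phi> z)"
      proof -
        have cm: "dir_deriv v (\<lambda>z. \<i> * f z) = (\<lambda>z. \<i> * dir_deriv v f z)" if "smooth f" for v and f :: "real \<times> real \<Rightarrow> complex"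
          by (rule ext) (intro dir_deriv_linear bounded_linear_mult_right smooth_differentiable that)
        have "(Dx2 ^^ j) (\<lambda>z. \<i> * f z) = (\<lambda>z. \<i> * (Dx2 ^^ j) f z)" if "smooth f" for j f
        proof (induction j)
          case (Suc j)
          have "Dx2 (\<lambda>z. \<i> * F z) = (\<lambda>z. \<i> * Dx2 F z)" if "smooth F" for F
            using cm[OF that] by (simp add: Dx2_def mult.left_commute)
          from this[OF smooth_Dx2_pow[OF that, of j]] show ?case using Suc by simp
        qed simp
        from this[OF smooth_mult[OF smooth_fst[OF c] \<phi>(5)]]
        have "tdiff2 k ?c (\<lambda>z. \<i> * \<phi> z) = (\<lambda>z. \<i> * tdiff2 k ?c \<phi> z)"
          by (simp add: tdiff2_def mult.left_commute sum_distrib_left)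
        then show ?thesis by (simp add: S_def cm[OF \<phi>(5)] algebra_simps)
      qed
      then have "Re (\<i> * distr_of u (S k ?c \<phi>)) = 0"
        using key[of "\<lambda>z. \<i> * \<phi> z" R T'] \<phi> by (simp add: distr_of_cmult smooth_mult tsupp_mult)
      moreover have "Re (distr_of u (S k ?c \<phi>)) = 0" using key \<phi> by blast
      ultimately have "distr_of u (S k ?c \<phi>) = 0" by (simp add: complex_eq_iff)
      then show "distr_L k m a b (distr_of u) \<phi> = 0"
        using distr_L_eq[of k a m b, OF _ _ m \<phi>(5,4,1,3)] a b by simp
    qed
  qed
qed

end

section \<open>Wellposedness as a solution flow on the Hilbert space\<close>

definition wsol :: "nat \<Rightarrow> (nat \<Rightarrow> real \<Rightarrow> complex) \<Rightarrow> real \<Rightarrow> (real \<Rightarrow> ltwo) \<Rightarrow> bool"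
  where "wsol n c T w \<longleftrightarrow> continuous_on {-T..T} w \<and>
    (\<forall>\<theta>\<in>ccs. \<forall>t\<in>{-T<..<T}. ((\<lambda>s. pair (w s) \<theta>) has_real_derivative
      pair (w t) (\<lambda>x. \<i> * tdiff_op n c \<theta> x)) (at t))"

lemma pair_add_left: "pair (v + w) \<theta> = pair v \<theta> + pair w \<theta>"
  by (simp add: pair_def inner_add_left)

lemma pair_scaleR_left: "pair (r *\<^sub>R w) \<theta> = r * pair w \<theta>"
  by (simp add: pair_def)

lemma wsol_add: "wsol n c T v \<Longrightarrow> wsol n c T w \<Longrightarrow> wsol n c T (\<lambda>t. v t + w t)"
  unfolding wsol_def pair_add_left by (auto intro!: continuous_on_add DERIV_add)

lemma wsol_scaleR: "wsol n c T w \<Longrightarrow> wsol n c T (\<lambda>t. r *\<^sub>R w t)"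
  unfolding wsol_def pair_scaleR_left by (auto intro!: continuous_on_scaleR continuous_on_const DERIV_cmult)

text \<open>Dictionary in both directions between weak solutions in the quotient and curves of
  representatives, so that existence, uniqueness and the bound can all be transported.\<close>

lemma wsol_curve:
  assumes a: "\<And>j. j \<le> k - 2 \<Longrightarrow> smooth (a j)" and b: "\<And>j. j \<le> m \<Longrightarrow> smooth (b j)" and m: "m \<le> k - 2"
    and T: "T > 0"
  shows "L2_curve T u \<Longrightarrow> \<forall>\<phi>\<in>test_functions (UNIV \<times> {-T<..<T}). distr_L k m a b (distr_of u) \<phi> = 0 \<Longrightarrow>
      wsol k (opcoeff k m a b) T (\<lambda>t. emb (u t))"
    and "wsol k (opcoeff k m a b) T w \<Longrightarrow> AE x in lborel. rep (w 0) x = u0 x \<Longrightarrow>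
      cauchy_solution (distr_L k m a b) T u0 (\<lambda>t. rep (w t))"
proof -
  {
    assume u: "L2_curve T u" and A: "\<forall>\<phi>\<in>test_functions (UNIV \<times> {-T<..<T}). distr_L k m a b (distr_of u) \<phi> = 0"
    interpret l2curve T u by unfold_locales (use T u in auto)
    show "wsol k (opcoeff k m a b) T (\<lambda>t. emb (u t))"
      using w_cont A distributional_iff_weak[of k a m b] a b m unfolding wsol_def w_def[abs_def] by blast
  next
    assume w: "wsol k (opcoeff k m a b) T w" and i: "AE x in lborel. rep (w 0) x = u0 x"
    have n: "L2_norm (\<lambda>x. rep (w s) x - rep (w t) x) = norm (w s - w t)" for s t
      by (simp add: emb_diff flip: norm_emb[OF L2_diff])
    have u: "L2_curve T (\<lambda>t. rep (w t))"
      unfolding L2_curve_def n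
    proof (intro ballI conjI)
      fix t assume t: "t \<in> {-T..T}"
      have "(w \<longlongrightarrow> w t) (at t within {-T..T})"
        using w t by (auto simp: wsol_def continuous_on_def)
      then show "((\<lambda>s. norm (w s - w t)) \<longlongrightarrow> 0) (at t within {-T..T})"
        by (simp add: tendsto_norm_zero_iff Lim_null[symmetric])
    qed simp
    interpret X: l2curve T "\<lambda>t. rep (w t)" by unfold_locales (use T u in auto)
    have "X.w = w" by (auto simp: X.w_def)
    then have "\<forall>\<phi>\<in>test_functions (UNIV \<times> {-T<..<T}). distr_L k m a b (distr_of (\<lambda>t. rep (w t))) \<phi> = 0"
      using w X.distributional_iff_weak[of k a m b] a b m unfolding wsol_def by metis
    then show "cauchy_solution (distr_L k m a b) T u0 (\<lambda>t. rep (w t))"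
      using u i unfolding cauchy_solution_def by blast
  }
qed

text \<open>What wellposedness supplies on \<open>{-T..T}\<close>: \<open>U h\<close> is the weak
  solution with initial value \<open>h\<close>. Uniqueness is stated against every weak solution,
  and the linearity of the flow is drawn from it.\<close>

locale solution_group =
  fixes n :: nat and c :: "nat \<Rightarrow> real \<Rightarrow> complex" and T M :: real and U :: "ltwo \<Rightarrow> real \<Rightarrow> ltwo"
  assumes T: "T > 0" and M: "M \<ge> 0" and c: "\<And>j. smooth (c j)"
    and sol: "\<And>h. wsol n c T (U h)" and init: "\<And>h. U h 0 = h"
    and uniq: "\<And>v t. wsol n c T v \<Longrightarrow> \<bar>t\<bar> \<le> T \<Longrightarrow> v t = U (v 0) t"
    and bound: "\<And>h t. \<bar>t\<bar> \<le> T \<Longrightarrow> norm (U h t) \<le> M * norm h"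

lemma opcoeff_smooth:
  assumes a: "\<And>j. j \<le> k - 2 \<Longrightarrow> smooth (a j)" and b: "\<And>j. j \<le> m \<Longrightarrow> smooth (b j)"
  shows "smooth (opcoeff k m a b j)"
proof -
  have "smooth (\<lambda>x. if j \<le> k - 2 then a j x else 0)" by (rule smooth_if) (rule a)
  moreover have "smooth (\<lambda>x. if j \<le> m then b j x else 0)" by (rule smooth_if) (rule b)
  ultimately show ?thesis unfolding opcoeff_def by (intro smooth_add smooth_const)
qed

text \<open>Uniqueness almost everywhere turns into equality of classes, so that a solution operator
  can be chosen as a function of the initial class.\<close>

lemma wellposed_solution_group:
  assumes a: "\<And>j. j \<le> k - 2 \<Longrightarrow> smooth (a j)" and b: "\<And>j. j \<le> m \<Longrightarrow> smooth (b j)" and m: "m \<le> k - 2"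
    and T: "T > 0" and wp: "L2_wellposed (distr_L k m a b)"
  shows "\<exists>M U. solution_group k (opcoeff k m a b) T M U"
proof -
  let ?L = "distr_L k m a b" and ?c = "opcoeff k m a b"
  have cs1: "wsol k ?c T (\<lambda>t. emb (u t))"
    if "L2_curve T u" "\<forall>\<phi>\<in>test_functions (UNIV \<times> {-T<..<T}). ?L (distr_of u) \<phi> = 0" for u
    using wsol_curve(1)[of k a m b T u] a b m T that by blast
  have cs2: "cauchy_solution ?L T u0 (\<lambda>t. rep (w t))"
    if "wsol k ?c T w" "AE x in lborel. rep (w 0) x = u0 x" for w u0
    using wsol_curve(2)[of k a m b T w u0] a b m T that by blast
  from wp T obtain M where ex: "\<And>u0. u0 \<in> L2 \<Longrightarrow> \<exists>u. cauchy_solution ?L T u0 u \<and>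
        (\<forall>v. cauchy_solution ?L T u0 v \<longrightarrow> (\<forall>t\<in>{-T..T}. AE x in lborel. v t x = u t x))"
    and M: "\<And>u0 u t. u0 \<in> L2 \<Longrightarrow> cauchy_solution ?L T u0 u \<Longrightarrow> t \<in> {-T..T} \<Longrightarrow> L2_norm (u t) \<le> M * L2_norm u0"
    unfolding L2_wellposed_def by blast
  have uniq: "v t = w t" if v: "wsol k ?c T v" and w: "wsol k ?c T w" and 0: "v 0 = w 0" and t: "t \<in> {-T..T}" for v w t
  proof -
    have "cauchy_solution ?L T (rep (w 0)) (\<lambda>t. rep (v t))" "cauchy_solution ?L T (rep (w 0)) (\<lambda>t. rep (w t))"
      by (rule cs2; use v w 0 in simp)+
    moreover obtain u where u: "\<And>v. cauchy_solution ?L T (rep (w 0)) v \<Longrightarrow> (AE x in lborel. v t x = u t x)"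
      using ex[OF rep_L2[of "w 0"]] t by blast
    ultimately have "AE x in lborel. rep (v t) x = u t x" "AE x in lborel. rep (w t) x = u t x" by blast+
    then have "AE x in lborel. rep (v t) x = rep (w t) x" by eventually_elim simp
    then have "emb (rep (v t)) = emb (rep (w t))" by (simp only: emb_eq_iff rep_L2)
    then show ?thesis by simp
  qed
  have "\<exists>w. wsol k ?c T w \<and> w 0 = h" for h
  proof -
    obtain u where u: "cauchy_solution ?L T (rep h) u" using ex[OF rep_L2[of h]] by blast
    then have u': "L2_curve T u" "AE x in lborel. u 0 x = rep h x"
      "\<forall>\<phi>\<in>test_functions (UNIV \<times> {-T<..<T}). ?L (distr_of u) \<phi> = 0"
      by (auto simp: cauchy_solution_def)
    have "u 0 \<in> L2" using u'(1) T by (auto simp: L2_curve_def)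
    then have "emb (u 0) = emb (rep h)" using u'(2) by (simp only: emb_eq_iff rep_L2)
    then show ?thesis using cs1[OF u'(1,3)] by auto
  qed
  then obtain U where U: "\<And>h. wsol k ?c T (U h)" "\<And>h. U h 0 = h" by metis
  \<comment> \<open>The constant supplied by wellposedness carries no sign; the maximum makes it
    nonnegative.\<close>
  have "solution_group k ?c T (max M 0) U"
  proof
    show "smooth (?c j)" for j
      by (rule opcoeff_smooth) (use a b in auto)
    show "v t = U (v 0) t" if "wsol k ?c T v" "\<bar>t\<bar> \<le> T" for v t
    proof (rule uniq[OF that(1) U(1)])
      show "v 0 = U (v 0) 0" by (rule U(2)[symmetric])
      show "t \<in> {-T..T}" using that(2) by auto
    qed
    show "norm (U h t) \<le> max M 0 * norm h" if t: "\<bar>t\<bar> \<le> T" for h t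
    proof -
      have "cauchy_solution ?L T (rep h) (\<lambda>t. rep (U h t))"
        by (rule cs2) (use U in auto)
      moreover have "t \<in> {-T..T}" using t by auto
      ultimately have "L2_norm (rep (U h t)) \<le> M * L2_norm (rep h)"
        by (rule M[OF rep_L2])
      then have "norm (U h t) \<le> M * norm h"
        using norm_emb[OF rep_L2, of h] norm_emb[OF rep_L2, of "U h t"] by simp
      also have "\<dots> \<le> max M 0 * norm h" by (intro mult_right_mono) auto
      finally show ?thesis .
    qed
  qed (use T U in auto)
  then show ?thesis by blast
qed

text \<open>Negative \<open>\<tau>\<close> is included: a packet moves towards decreasing x for positive time, and both
  directions are needed.\<close>

definition energy_bound :: "nat \<Rightarrow> (nat \<Rightarrow> real \<Rightarrow> complex) \<Rightarrow> real \<Rightarrow> bool"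
  where "energy_bound n c M \<longleftrightarrow> (\<forall>\<tau> u u' S. \<bar>\<tau>\<bar> \<le> 1 \<longrightarrow>
    (\<forall>t\<in>closed_segment 0 \<tau>. u t \<in> ccs \<and> u' t \<in> L2 \<and>
      ((\<lambda>t. emb (u t)) has_vector_derivative emb (u' t)) (at t) \<and>
      L2_norm (\<lambda>x. u' t x - \<i> * diff_op n c (u t) x) \<le> S) \<longrightarrow>
    L2_norm (u \<tau>) \<le> M * (L2_norm (u 0) + \<bar>\<tau>\<bar> * S))"

context solution_group
begin

lemma U_cont: "continuous_on {-T..T} (U h)" using sol[of h] by (simp add: wsol_def)

lemma U_isCont: "\<bar>t\<bar> < T \<Longrightarrow> isCont (U h) t"
  using continuous_on_interior[OF U_cont, of t] by (auto simp: interior_atLeastAtMost_real abs_less_iff)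

text \<open>Sums of weak solutions are weak solutions, hence uniqueness makes the flow additive;
  multiples are treated in the same way.\<close>

lemma U_add: "\<bar>t\<bar> \<le> T \<Longrightarrow> U (g + h) t = U g t + U h t"
  using uniq[OF wsol_add[OF sol[of g] sol[of h]], of t] by (simp add: init)

lemma U_scaleR: "\<bar>t\<bar> \<le> T \<Longrightarrow> U (r *\<^sub>R h) t = r *\<^sub>R U h t"
  using uniq[OF wsol_scaleR[OF sol[of h]], of t r] by (simp add: init)

lemma U_diff: "\<bar>t\<bar> \<le> T \<Longrightarrow> U (g - h) t = U g t - U h t"
  using U_add[of t g "(-1) *\<^sub>R h"] U_scaleR[of t "-1" h] by simp

lemma generator_symmetry:
  assumes f: "f \<in> ccs" and \<theta>: "\<theta> \<in> ccs"
  shows "pair (emb (\<lambda>x. \<i> * diff_op n c f x)) \<theta> = pair (emb f) (\<lambda>x. \<i> * tdiff_op n c \<theta> x)"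
proof -
  have L: "(\<lambda>x. \<i> * diff_op n c f x) \<in> L2" "(\<lambda>x. \<i> * tdiff_op n c \<theta> x) \<in> L2" "f \<in> L2" "\<theta> \<in> L2"
    by (intro ccs_L2 ccs_cmult ccs_diff_op tdiff_op_ccs c f \<theta>)+
  have "(LINT x|lborel. \<i> * diff_op n c f x * \<theta> x) = \<i> * (LINT x|lborel. diff_op n c f x * \<theta> x)"
    by (simp add: mult.assoc)
  also have "\<dots> = \<i> * (LINT x|lborel. f x * tdiff_op n c \<theta> x)"
    using diff_op_transpose[OF c f \<theta>] by simp
  also have "\<dots> = (LINT x|lborel. f x * (\<i> * tdiff_op n c \<theta> x))"
    by (simp add: mult.left_commute)
  finally show ?thesis by (simp add: pair_emb L)
qed

text \<open>The function \<open>emb f + \<integral>\<^sub>0\<^sup>t U (\<i> P f)\<close> is again a weak solution, so by uniqueness it is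
  \<open>U (emb f)\<close>; this avoids showing that \<open>U\<close> commutes with \<open>P\<close>.\<close>

lemma U_derivative:
  assumes f: "f \<in> ccs" and t: "\<bar>t\<bar> < T"
  shows "(U (emb f) has_vector_derivative U (emb (\<lambda>x. \<i> * diff_op n c f x)) t) (at t)"
proof -
  define v where "v = U (emb (\<lambda>x. \<i> * diff_op n c f x))"
  define G where "G t = integral {-T..t} v" for t
  define \<psi> where "\<psi> t = emb f + (G t - G 0)" for t
  have vc: "continuous_on {-T..T} v" unfolding v_def by (rule U_cont)
  have Gd: "(G has_vector_derivative v t) (at t within {-T..T})" if "t \<in> {-T..T}" for t
    unfolding G_def by (rule integral_has_vector_derivative[OF vc that])
  have \<psi>d': "(\<psi> has_vector_derivative 0 + (v t - 0)) (at t within {-T..T})" if "t \<in> {-T..T}" for t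
    unfolding \<psi>_def
    by (intro has_vector_derivative_add has_vector_derivative_diff has_vector_derivative_const Gd that)
  have \<psi>d: "(\<psi> has_vector_derivative v t) (at t)" if "t \<in> {-T<..<T}" for t
    using \<psi>d'[of t] that at_within_Icc_at[of "-T" t T] by auto
  have \<psi>c: "continuous_on {-T..T} \<psi>"
    using \<psi>d' by (meson continuous_on_eq_continuous_within has_vector_derivative_continuous)
  have pd: "((\<lambda>s. pair (\<psi> s) \<theta>) has_real_derivative pair (v t) \<theta>) (at t)" if "t \<in> {-T<..<T}" for t \<theta>
    unfolding pair_def has_real_derivative_iff_has_vector_derivative
    by (rule bounded_linear.has_vector_derivative[OF bounded_linear_inner_left \<psi>d[OF that]])
  have "wsol n c T \<psi>"
    unfolding wsol_def
  proof (intro conjI ballI \<psi>c)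
    fix \<theta> t assume \<theta>: "\<theta> \<in> ccs" and t: "t \<in> {-T<..<T}"
    define \<theta>' where "\<theta>' = (\<lambda>x. \<i> * tdiff_op n c \<theta> x)"
    \<comment> \<open>The amount by which \<open>\<psi>\<close> fails the weak equation. The weak
      equation of \<open>v\<close> and the identity \<open>\<psi>' = v\<close> produce the same
      derivative for both terms, so \<open>D\<close> is constant; \<open>D 0 = 0\<close> is
      \<open>generator_symmetry\<close>.\<close>
    define D where "D s = pair (v s) \<theta> - pair (\<psi> s) \<theta>'" for s
    have "(D has_real_derivative pair (v s) \<theta>' - pair (v s) \<theta>') (at s)" if "s \<in> {-T<..<T}" for s
      unfolding D_def
      by (intro DERIV_diff pd that) (use sol \<theta> that in \<open>simp add: v_def wsol_def \<theta>'_def\<close>)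
    then have "(D has_vector_derivative 0) (at s within {-T<..<T})" if "s \<in> {-T<..<T}" for s
      using that by (simp add: has_real_derivative_iff_has_vector_derivative has_vector_derivative_at_within)
    then obtain d where d: "\<And>s. s \<in> {-T<..<T} \<Longrightarrow> D s = d"
      using has_vector_derivative_zero_constant[of "{-T<..<T}" D] by (metis convex_real_interval(8))
    have "D 0 = 0"
      unfolding D_def \<psi>_def v_def \<theta>'_def by (simp add: init generator_symmetry f \<theta>)
    then have "D t = 0" using d[of 0] d[OF t] T by simp
    then have "pair (v t) \<theta> = pair (\<psi> t) \<theta>'" by (simp add: D_def)
    then show "((\<lambda>s. pair (\<psi> s) \<theta>) has_real_derivative pair (\<psi> t) (\<lambda>x. \<i> * tdiff_op n c \<theta> x)) (at t)"
      using pd[OF t, of \<theta>] by (simp add: \<theta>'_def)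
  qed
  then have eq: "\<psi> s = U (emb f) s" if "s \<in> {-T<..<T}" for s
    using uniq[of \<psi> s] that by (simp add: \<psi>_def abs_le_iff)
  have t': "t \<in> {-T<..<T}" using t by auto
  have "(U (emb f) has_vector_derivative v t) (at t)"
    by (rule has_vector_derivative_transform_within_open[OF \<psi>d[OF t'], where S = "{-T<..<T}"])
      (use t' eq in auto)
  then show ?thesis by (simp add: v_def)
qed

text \<open>In the derivative of \<open>F s = U (e s) (\<tau> - s)\<close> the generator cancels,
  and what remains is the flow applied to the defect \<open>u' - \<i> P u\<close>. Since
  \<open>F\<close> leads from the propagated initial value to \<open>emb (u \<tau>)\<close>, the
  mean value inequality gives the estimate.\<close>

lemma Duhamel_bound:
  assumes \<tau>: "\<bar>\<tau>\<bar> < T"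
    and u: "\<And>t. t \<in> closed_segment 0 \<tau> \<Longrightarrow> u t \<in> ccs" and u': "\<And>t. t \<in> closed_segment 0 \<tau> \<Longrightarrow> u' t \<in> L2"
    and d: "\<And>t. t \<in> closed_segment 0 \<tau> \<Longrightarrow> ((\<lambda>t. emb (u t)) has_vector_derivative emb (u' t)) (at t)"
    and S: "\<And>t. t \<in> closed_segment 0 \<tau> \<Longrightarrow> L2_norm (\<lambda>x. u' t x - \<i> * diff_op n c (u t) x) \<le> S"
  shows "L2_norm (u \<tau>) \<le> M * (L2_norm (u 0) + \<bar>\<tau>\<bar> * S)"
proof -
  define e where "e t = emb (u t)" for t
  define F where "F s = U (e s) (\<tau> - s)" for s
  define g where "g s = (\<lambda>x. u' s x - \<i> * diff_op n c (u s) x)" for s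
  have seg: "\<bar>\<tau> - s\<bar> < T" if "s \<in> closed_segment 0 \<tau>" for s
    using that \<tau> by (auto simp: closed_segment_eq_real_ivl split: if_splits)
  have Fd: "(F has_vector_derivative U (emb (g s)) (\<tau> - s)) (at s)" if s: "s \<in> closed_segment 0 \<tau>" for s
  proof -
    note sT = seg[OF s]
    have Pu: "(\<lambda>x. \<i> * diff_op n c (u s) x) \<in> L2"
      by (intro ccs_L2 ccs_cmult ccs_diff_op c u s)
    have ev: "eventually (\<lambda>s'. \<bar>\<tau> - s'\<bar> \<le> T) (at s)"
    proof -
      have "eventually (\<lambda>s'. s' \<in> {s'. \<bar>\<tau> - s'\<bar> < T}) (at s)"
        by (rule eventually_at_in_open') (use sT in \<open>auto intro!: open_Collect_less continuous_intros\<close>)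
      then show ?thesis by eventually_elim simp
    qed
    have q: "((\<lambda>s'. (e s' - e s) /\<^sub>R (s' - s)) \<longlongrightarrow> emb (u' s)) (at s)"
      using d[OF s] by (simp add: has_vector_derivative_quotient e_def)
    \<comment> \<open>The error of the difference quotient is propagated over a time that varies
      with \<open>s'\<close>; the bound by \<open>M\<close>, uniform in time, still sends it to
      0.\<close>
    have "((\<lambda>s'. U ((e s' - e s) /\<^sub>R (s' - s) - emb (u' s)) (\<tau> - s')) \<longlongrightarrow> 0) (at s)"
    proof (rule Lim_null_comparison)
      show "eventually (\<lambda>s'. norm (U ((e s' - e s) /\<^sub>R (s' - s) - emb (u' s)) (\<tau> - s'))
          \<le> M * norm ((e s' - e s) /\<^sub>R (s' - s) - emb (u' s))) (at s)"
        using ev by eventually_elim (rule bound)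
      show "((\<lambda>s'. M * norm ((e s' - e s) /\<^sub>R (s' - s) - emb (u' s))) \<longlongrightarrow> 0) (at s)"
        using q by (intro tendsto_mult_right_zero tendsto_norm_zero) (simp add: Lim_null[symmetric])
    qed
    moreover have "((\<lambda>s'. U (emb (u' s)) (\<tau> - s')) \<longlongrightarrow> U (emb (u' s)) (\<tau> - s)) (at s)"
      by (rule isCont_tendsto_compose[OF U_isCont[OF sT]]) (intro tendsto_intros)
    moreover have "((\<lambda>s'. U (e s) (\<tau> - s')) has_vector_derivative - U (emb (\<lambda>x. \<i> * diff_op n c (u s) x)) (\<tau> - s)) (at s)"
    proof -
      have 1: "((\<lambda>s'. \<tau> - s') has_vector_derivative -1) (at s)"
        by (auto intro!: derivative_eq_intros)
      have 2: "(U (e s) has_vector_derivative U (emb (\<lambda>x. \<i> * diff_op n c (u s) x)) (\<tau> - s)) (at (\<tau> - s))"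
        unfolding e_def by (rule U_derivative[OF u[OF s] sT])
      show ?thesis using vector_diff_chain_at[OF 1 2] by (simp add: o_def)
    qed
    ultimately have "((\<lambda>s'. U ((e s' - e s) /\<^sub>R (s' - s) - emb (u' s)) (\<tau> - s') + U (emb (u' s)) (\<tau> - s')
        + (U (e s) (\<tau> - s') - U (e s) (\<tau> - s)) /\<^sub>R (s' - s)) \<longlongrightarrow>
        0 + U (emb (u' s)) (\<tau> - s) + - U (emb (\<lambda>x. \<i> * diff_op n c (u s) x)) (\<tau> - s)) (at s)"
      unfolding has_vector_derivative_quotient by (intro tendsto_add)
    moreover have "0 + U (emb (u' s)) (\<tau> - s) + - U (emb (\<lambda>x. \<i> * diff_op n c (u s) x)) (\<tau> - s) = U (emb (g s)) (\<tau> - s)"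
      using sT u'[OF s] Pu by (simp add: g_def emb_diff U_diff)
    moreover have "eventually (\<lambda>s'. U ((e s' - e s) /\<^sub>R (s' - s) - emb (u' s)) (\<tau> - s') + U (emb (u' s)) (\<tau> - s')
        + (U (e s) (\<tau> - s') - U (e s) (\<tau> - s)) /\<^sub>R (s' - s) = (F s' - F s) /\<^sub>R (s' - s)) (at s)"
      using ev
    proof eventually_elim
      case (elim s')
      have "U ((e s' - e s) /\<^sub>R (s' - s) - emb (u' s)) (\<tau> - s')
          = (U (e s') (\<tau> - s') - U (e s) (\<tau> - s')) /\<^sub>R (s' - s) - U (emb (u' s)) (\<tau> - s')"
        by (simp only: U_diff[OF elim] U_scaleR[OF elim])
      then show ?case by (simp only: F_def scaleR_diff_right) simp
    qed
    ultimately show ?thesis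
      unfolding has_vector_derivative_quotient by (simp only: Lim_transform_eventually)
  qed
  have "norm (F \<tau> - F 0) \<le> (M * S) * norm (\<tau> - 0)"
  proof (rule differentiable_bound[where S = "closed_segment 0 \<tau>" and f' = "\<lambda>s h. h *\<^sub>R U (emb (g s)) (\<tau> - s)"])
    fix s assume s: "s \<in> closed_segment 0 \<tau>"
    show "(F has_derivative (\<lambda>h. h *\<^sub>R U (emb (g s)) (\<tau> - s))) (at s within closed_segment 0 \<tau>)"
      using Fd[OF s] unfolding has_vector_derivative_def by (rule has_derivative_at_withinI)
    have gL: "g s \<in> L2" unfolding g_def
      by (intro L2_diff u'[OF s] ccs_L2 ccs_cmult ccs_diff_op c u[OF s])
    have "norm (U (emb (g s)) (\<tau> - s)) \<le> M * norm (emb (g s))"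
      by (rule bound) (use seg[OF s] in simp)
    also have "\<dots> \<le> M * S"
    proof (rule mult_left_mono[OF _ M])
      show "norm (emb (g s)) \<le> S" unfolding norm_emb[OF gL] unfolding g_def by (rule S[OF s])
    qed
    finally have le: "norm (U (emb (g s)) (\<tau> - s)) \<le> M * S" .
    show "onorm (\<lambda>h. h *\<^sub>R U (emb (g s)) (\<tau> - s)) \<le> M * S"
      by (rule onorm_le) (use le in \<open>simp add: mult.commute mult_left_mono\<close>)
  qed auto
  moreover have "F \<tau> = emb (u \<tau>)" by (simp add: F_def init e_def)
  moreover have "norm (F 0) \<le> M * norm (emb (u 0))"
    unfolding F_def e_def by (rule bound) (use \<tau> in simp)
  ultimately have "norm (emb (u \<tau>)) \<le> M * norm (emb (u 0)) + M * S * \<bar>\<tau>\<bar>"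
    using norm_triangle_ineq2[of "F \<tau>" "F 0"] by simp
  moreover have "u \<tau> \<in> L2" "u 0 \<in> L2" by (intro ccs_L2 u, simp)+
  ultimately show ?thesis by (simp add: norm_emb algebra_simps)
qed

lemma energy_bound:
  assumes "T > 1" shows "energy_bound n c M"
  unfolding energy_bound_def
proof (intro allI impI)
  fix \<tau> u u' S assume \<tau>: "\<bar>\<tau>\<bar> \<le> (1::real)" and *: "\<forall>t\<in>closed_segment 0 \<tau>. u t \<in> ccs \<and> u' t \<in> L2 \<and>
      ((\<lambda>t. emb (u t)) has_vector_derivative emb (u' t)) (at t) \<and>
      L2_norm (\<lambda>x. u' t x - \<i> * diff_op n c (u t) x) \<le> S"
  show "L2_norm (u \<tau>) \<le> M * (L2_norm (u 0) + \<bar>\<tau>\<bar> * S)"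
    by (rule Duhamel_bound[where u' = u']) (use * \<tau> assms in simp_all)
qed

end

section \<open>Conjugation by exponentials\<close>

text \<open>With \<open>\<Phi>' = \<theta>\<close> this is \<open>e\<^bsup>-i\<Phi>\<^esup> D e\<^bsup>i\<Phi>\<^esup>\<close>.\<close>

definition tw :: "(real \<Rightarrow> complex) \<Rightarrow> op1"
  where "tw \<theta> f = (\<lambda>x. D1 f x + \<theta> x * f x)"

lemma smooth_tw: "smooth \<theta> \<Longrightarrow> smooth f \<Longrightarrow> smooth (tw \<theta> f)"
  unfolding tw_def by (intro smooth_add smooth_D1 smooth_mult)

lemma smooth_tw_pow: "smooth \<theta> \<Longrightarrow> smooth f \<Longrightarrow> smooth ((tw \<theta> ^^ j) f)"
  by (induction j) (auto intro: smooth_tw)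

text \<open>The hypothesis on \<open>D1 \<Phi>\<close> encodes \<open>\<Phi>' = \<theta>\<close>,
  because \<open>D1\<close> is the derivative divided by \<open>\<i>\<close>.\<close>

lemma D1_exp_mult:
  assumes \<Phi>: "smooth \<Phi>" "\<And>x. D1 \<Phi> x = - \<i> * \<theta> x" and f: "smooth f"
  shows "D1 (\<lambda>x. exp (\<i> * \<Phi> x) * f x) = (\<lambda>x. exp (\<i> * \<Phi> x) * tw \<theta> f x)"
proof -
  have s: "smooth (\<lambda>x. \<i> * \<Phi> x)" by (intro smooth_mult smooth_const \<Phi>)
  have "D1 (\<lambda>x. exp (\<i> * \<Phi> x)) = (\<lambda>x. exp (\<i> * \<Phi> x) * \<theta> x)"
  proof
    fix x
    have "dir_deriv 1 (\<lambda>x. exp (\<i> * \<Phi> x)) x = dir_deriv 1 (\<lambda>x. \<i> * \<Phi> x) x * exp (\<i> * \<Phi> x)"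
      by (rule dir_deriv_has_derivative[OF dir_deriv_exp[OF smooth_differentiable[OF s]]])
    then have "D1 (\<lambda>x. exp (\<i> * \<Phi> x)) x = D1 (\<lambda>x. \<i> * \<Phi> x) x * exp (\<i> * \<Phi> x)"
      by (simp add: D1_def)
    also have "D1 (\<lambda>x. \<i> * \<Phi> x) x = \<theta> x" using \<Phi> by (simp add: D1_cmult)
    finally show "D1 (\<lambda>x. exp (\<i> * \<Phi> x)) x = exp (\<i> * \<Phi> x) * \<theta> x" by simp
  qed
  then show ?thesis using D1_mult[OF smooth_exp[OF s] f]
    by (simp add: tw_def algebra_simps)
qed

lemma D1_pow_exp_mult:
  assumes \<Phi>: "smooth \<Phi>" "\<And>x. D1 \<Phi> x = - \<i> * \<theta> x" and \<theta>: "smooth \<theta>" and f: "smooth f"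
  shows "(D1 ^^ j) (\<lambda>x. exp (\<i> * \<Phi> x) * f x) = (\<lambda>x. exp (\<i> * \<Phi> x) * (tw \<theta> ^^ j) f x)"
  by (induction j) (auto simp: D1_exp_mult[OF \<Phi> smooth_tw_pow[OF \<theta> f]])

lemma Pascal_sum:
  fixes A B :: "nat \<Rightarrow> complex"
  shows "(\<Sum>l\<le>j. of_nat (j choose l) * (A (Suc j - l) * B l + A (j - l) * B (Suc l)))
    = (\<Sum>l\<le>Suc j. of_nat (Suc j choose l) * (A (Suc j - l) * B l))"
proof -
  have 1: "(\<Sum>l\<le>j. of_nat (j choose l) * (A (Suc j - l) * B l))
      = A (Suc j) * B 0 + (\<Sum>l\<le>j. of_nat (j choose Suc l) * (A (j - l) * B (Suc l)))"
  proof -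
    have "(\<Sum>l\<le>j. of_nat (j choose l) * (A (Suc j - l) * B l))
        = (\<Sum>l\<le>Suc j. of_nat (j choose l) * (A (Suc j - l) * B l))" by simp
    also have "\<dots> = A (Suc j) * B 0 + (\<Sum>l\<le>j. of_nat (j choose Suc l) * (A (j - l) * B (Suc l)))"
      by (subst sum.atMost_Suc_shift) simp
    finally show ?thesis .
  qed
  have "(\<Sum>l\<le>Suc j. of_nat (Suc j choose l) * (A (Suc j - l) * B l))
      = A (Suc j) * B 0 + (\<Sum>l\<le>j. of_nat (Suc j choose Suc l) * (A (j - l) * B (Suc l)))"
    by (subst sum.atMost_Suc_shift) simp
  also have "\<dots> = A (Suc j) * B 0 + (\<Sum>l\<le>j. of_nat (j choose Suc l) * (A (j - l) * B (Suc l)))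
      + (\<Sum>l\<le>j. of_nat (j choose l) * (A (j - l) * B (Suc l)))"
    by (simp add: algebra_simps sum.distrib)
  finally show ?thesis by (simp add: 1 distrib_left sum.distrib)
qed

text \<open>\<open>tw \<theta> (f g) = (tw \<theta> f) g + f (D1 g)\<close>: the twist falls on one
  factor only. Hence the expansion separates the phase from the plain derivatives of the cutoff,
  with ordinary binomial coefficients.\<close>

lemma tw_Leibniz:
  assumes \<theta>: "smooth \<theta>" and f: "smooth f" and g: "smooth g"
  shows "(tw \<theta> ^^ j) (\<lambda>x. f x * g x) = (\<lambda>x. \<Sum>l\<le>j. of_nat (j choose l) * ((tw \<theta> ^^ (j - l)) f x * (D1 ^^ l) g x))"
proof (induction j)
  case (Suc j)
  have s: "smooth ((tw \<theta> ^^ i) f)" "smooth ((D1 ^^ i) g)" for i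
    by (intro smooth_tw_pow smooth_D1_pow \<theta> f g)+
  show ?case
  proof
    fix x
    have "(tw \<theta> ^^ Suc j) (\<lambda>x. f x * g x) x
        = tw \<theta> (\<lambda>x. \<Sum>l\<le>j. of_nat (j choose l) * ((tw \<theta> ^^ (j - l)) f x * (D1 ^^ l) g x)) x"
      by (simp add: Suc)
    also have "\<dots> = (\<Sum>l\<le>j. of_nat (j choose l) * ((tw \<theta> ^^ (Suc j - l)) f x * (D1 ^^ l) g x + (tw \<theta> ^^ (j - l)) f x * (D1 ^^ Suc l) g x))"
    proof -
      have D: "D1 (\<lambda>x. \<Sum>l\<le>j. of_nat (j choose l) * ((tw \<theta> ^^ (j - l)) f x * (D1 ^^ l) g x)) x
          = (\<Sum>l\<le>j. of_nat (j choose l) * (D1 ((tw \<theta> ^^ (j - l)) f) x * (D1 ^^ l) g x + (tw \<theta> ^^ (j - l)) f x * (D1 ^^ Suc l) g x))"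
        by (subst D1_sum) (auto intro!: smooth_mult smooth_const s simp: D1_cmult smooth_mult s D1_mult)
      have e: "(tw \<theta> ^^ (Suc j - l)) f x = D1 ((tw \<theta> ^^ (j - l)) f) x + \<theta> x * (tw \<theta> ^^ (j - l)) f x" if "l \<le> j" for l
        using that by (simp add: Suc_diff_le tw_def)
      note D
      then have "tw \<theta> (\<lambda>x. \<Sum>l\<le>j. of_nat (j choose l) * ((tw \<theta> ^^ (j - l)) f x * (D1 ^^ l) g x)) x
          = (\<Sum>l\<le>j. of_nat (j choose l) * (D1 ((tw \<theta> ^^ (j - l)) f) x * (D1 ^^ l) g x + (tw \<theta> ^^ (j - l)) f x * (D1 ^^ Suc l) g x)
              + \<theta> x * (of_nat (j choose l) * ((tw \<theta> ^^ (j - l)) f x * (D1 ^^ l) g x)))"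
        by (simp only: tw_def[of \<theta> "\<lambda>x. \<Sum>l\<le>j. of_nat (j choose l) * ((tw \<theta> ^^ (j - l)) f x * (D1 ^^ l) g x)"]
            sum_distrib_left sum.distrib)
      also have "\<dots> = (\<Sum>l\<le>j. of_nat (j choose l) * ((tw \<theta> ^^ (Suc j - l)) f x * (D1 ^^ l) g x + (tw \<theta> ^^ (j - l)) f x * (D1 ^^ Suc l) g x))"
        by (intro sum.cong refl) (simp add: e algebra_simps)
      finally show ?thesis .
    qed
    also have "\<dots> = (\<Sum>l\<le>Suc j. of_nat (Suc j choose l) * ((tw \<theta> ^^ (Suc j - l)) f x * (D1 ^^ l) g x))"
      by (rule Pascal_sum)
    finally show "(tw \<theta> ^^ Suc j) (\<lambda>x. f x * g x) x
      = (\<Sum>l\<le>Suc j. of_nat (Suc j choose l) * ((tw \<theta> ^^ (Suc j - l)) f x * (D1 ^^ l) g x))" .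
  qed
qed simp

lemma tw_const_pow: "(tw (\<lambda>x. \<eta>) ^^ j) (\<lambda>x. 1) = (\<lambda>x. \<eta> ^ j)"
  by (induction j) (auto simp: tw_def)

lemma tw_const:
  assumes "smooth f"
  shows "(tw (\<lambda>x. \<eta>) ^^ j) f = (\<lambda>x. \<Sum>l\<le>j. of_nat (j choose l) * (\<eta> ^ (j - l) * (D1 ^^ l) f x))"
  using tw_Leibniz[OF smooth_const[of \<eta>] smooth_const[of 1] assms, of j] by (simp add: tw_const_pow)

section \<open>The energy estimate for the unperturbed operator\<close>

text \<open>Records that an operator is differential with bounded coefficients, without computing
  them. Agreement is asked on smooth functions because the Leibniz rule behind it requires
  differentiability.\<close>

definition cbar_op :: "nat \<Rightarrow> op1 \<Rightarrow> bool"
  where "cbar_op n F \<longleftrightarrow> (\<exists>d. (\<forall>l. d l \<in> Cbar_infinity) \<and> (\<forall>f. smooth f \<longrightarrow> F f = diff_op n d f))"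

lemma cbar_op_mono:
  assumes "cbar_op n F" "n \<le> n'" shows "cbar_op n' F"
proof -
  obtain d where d: "\<And>l. d l \<in> Cbar_infinity" "\<And>f. smooth f \<Longrightarrow> F f = diff_op n d f"
    using assms by (auto simp: cbar_op_def)
  have "F f = diff_op n' (\<lambda>l x. if l \<le> n then d l x else 0) f" if "smooth f" for f
  proof
    fix x
    have "(if l \<le> n then d l x else 0) * (D1 ^^ l) f x = (if l \<le> n then d l x * (D1 ^^ l) f x else 0)" for l by simp
    then show "F f x = diff_op n' (\<lambda>l x. if l \<le> n then d l x else 0) f x"
      using d(2)[OF that] sum_atMost_restrict[OF assms(2), of "\<lambda>l. d l x * (D1 ^^ l) f x"]
      by (simp add: diff_op_def)
  qed
  moreover have "(\<lambda>x. if l \<le> n then d l x else 0) \<in> Cbar_infinity" for l by (rule Cbar_if) (rule d)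
  ultimately show ?thesis unfolding cbar_op_def by (intro exI[of _ "\<lambda>l x. if l \<le> n then d l x else 0"]) blast
qed

lemma cbar_op_add:
  assumes "cbar_op n F" "cbar_op n G" shows "cbar_op n (\<lambda>f x. F f x + G f x)"
proof -
  obtain d e where d: "\<And>l. d l \<in> Cbar_infinity" "\<And>f. smooth f \<Longrightarrow> F f = diff_op n d f"
    and e: "\<And>l. e l \<in> Cbar_infinity" "\<And>f. smooth f \<Longrightarrow> G f = diff_op n e f"
    using assms by (auto simp: cbar_op_def)
  show ?thesis unfolding cbar_op_def
    by (rule exI[of _ "\<lambda>l x. d l x + e l x"])
      (auto simp: d e diff_op_def algebra_simps sum.distrib intro!: Cbar_add)
qed

lemma cbar_op_cmult:
  assumes "cbar_op n F" shows "cbar_op n (\<lambda>f x. k * F f x)"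
proof -
  obtain d where d: "\<And>l. d l \<in> Cbar_infinity" "\<And>f. smooth f \<Longrightarrow> F f = diff_op n d f"
    using assms by (auto simp: cbar_op_def)
  show ?thesis unfolding cbar_op_def
    by (rule exI[of _ "\<lambda>l x. k * d l x"])
      (auto simp: d diff_op_def sum_distrib_left mult_ac intro!: Cbar_cmult)
qed

lemma cbar_op_sum:
  "(\<And>j. j \<in> J \<Longrightarrow> cbar_op n (F j)) \<Longrightarrow> cbar_op n (\<lambda>f x. \<Sum>j\<in>J. F j f x)"
proof (induction J rule: infinite_finite_induct)
  case (insert j J)
  then show ?case using cbar_op_add[of n "F j" "\<lambda>f x. \<Sum>j\<in>J. F j f x"] by simp
qed (auto simp: cbar_op_def diff_op_def intro!: exI[of _ "\<lambda>l x. 0"])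

lemma cbar_op_D1:
  assumes "cbar_op n F" shows "cbar_op (Suc n) (\<lambda>f. D1 (F f))"
proof -
  obtain d where d: "\<And>l. d l \<in> Cbar_infinity" "\<And>f. smooth f \<Longrightarrow> F f = diff_op n d f"
    using assms by (auto simp: cbar_op_def)
  define e where "e l = (case l of 0 \<Rightarrow> (\<lambda>x. 0) | Suc l \<Rightarrow> d l)" for l
  have 1: "cbar_op (Suc n) (diff_op n (\<lambda>l. D1 (d l)))"
    by (rule cbar_op_mono[of n]) (auto simp: cbar_op_def d intro!: exI[of _ "\<lambda>l. D1 (d l)"] Cbar_D1)
  have 2: "cbar_op (Suc n) (diff_op (Suc n) e)"
    unfolding cbar_op_def by (rule exI[of _ e]) (auto simp: e_def d split: nat.split)
  have "D1 (F f) = (\<lambda>x. diff_op n (\<lambda>l. D1 (d l)) f x + diff_op (Suc n) e f x)" if "smooth f" for f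
  proof
    fix x
    have s: "smooth (d l)" "smooth ((D1 ^^ l) f)" for l using d Cbar_smooth smooth_D1_pow that by auto
    have "D1 (F f) x = (\<Sum>l\<le>n. D1 (d l) x * (D1 ^^ l) f x + d l x * (D1 ^^ Suc l) f x)"
      using d(2)[OF that] by (simp add: diff_op_def D1_sum smooth_mult s D1_mult)
    also have "\<dots> = diff_op n (\<lambda>l. D1 (d l)) f x + (\<Sum>l\<le>n. d l x * (D1 ^^ Suc l) f x)"
      by (simp add: sum.distrib diff_op_def)
    also have "(\<Sum>l\<le>n. d l x * (D1 ^^ Suc l) f x) = diff_op (Suc n) e f x"
      unfolding diff_op_def by (subst sum.atMost_Suc_shift) (simp add: e_def)
    finally show "D1 (F f) x = diff_op n (\<lambda>l. D1 (d l)) f x + diff_op (Suc n) e f x" .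
  qed
  then show ?thesis using cbar_op_add[OF 1 2] unfolding cbar_op_def by metis
qed

lemma cbar_op_D1_pow_mult:
  assumes "c \<in> Cbar_infinity" shows "cbar_op j (\<lambda>f. (D1 ^^ j) (\<lambda>x. c x * f x))"
proof (induction j)
  case 0
  then show ?case unfolding cbar_op_def diff_op_def using assms by (intro exI[of _ "\<lambda>l. c"]) auto
next
  case (Suc j) from cbar_op_D1[OF Suc] show ?case by simp
qed

lemma inner_cnj: "L2_inner g f = cnj (L2_inner f g)"
proof -
  have "L2_inner g f = (LINT x|lborel. cnj (f x * cnj (g x)))"
    by (simp add: L2_inner_def mult.commute)
  then show ?thesis unfolding L2_inner_def by (simp only: Bochner_Integration.integral_cnj)
qed

lemma D1_pow_cnj: "smooth f \<Longrightarrow> (D1 ^^ j) (\<lambda>x. cnj (f x)) = (\<lambda>x. (-1) ^ j * cnj ((D1 ^^ j) f x))"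
proof (induction j)
  case (Suc j)
  have "smooth (\<lambda>x. cnj ((D1 ^^ j) f x))"
    by (rule smooth_linear[OF bounded_linear_cnj smooth_D1_pow[OF Suc.prems]])
  then show ?case using Suc by (simp add: D1_cmult D1_cnj smooth_D1_pow)
qed simp

lemma ccs_inner_integrable: "f \<in> ccs \<Longrightarrow> smooth g \<Longrightarrow> integrable lborel (\<lambda>x. f x * cnj (g x))"
  by (intro ccs_integrable ccs_mult2 smooth_linear[OF bounded_linear_cnj])

text \<open>The formal adjoint, the sum of the maps
  \<open>f \<mapsto> D\<^sup>j (cnj a\<^sub>j f)\<close>, is again differential of order at most
  \<open>n\<close> by the Leibniz rule; \<open>d\<close> collects the coefficients of the
  difference.\<close>

lemma adjoint_difference:
  assumes a: "\<And>j. j \<le> n \<Longrightarrow> a j \<in> Cbar_infinity"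
  shows "\<exists>d. (\<forall>l. d l \<in> Cbar_infinity) \<and> (\<forall>f\<in>ccs. \<forall>g\<in>ccs.
      L2_inner (diff_op n a f) g - L2_inner f (diff_op n a g) = L2_inner (diff_op n d f) g)"
proof -
  define B where "B f x = (\<Sum>j\<le>n. (D1 ^^ j) (\<lambda>x. cnj (a j x) * f x) x)" for f x
  have s: "smooth (a j)" "smooth (\<lambda>x. cnj (a j x))" if "j \<le> n" for j
    using a[OF that] Cbar_smooth smooth_linear[OF bounded_linear_cnj] by auto
  have "cbar_op n (\<lambda>f x. \<Sum>j\<in>{..n}. (D1 ^^ j) (\<lambda>x. cnj (a j x) * f x) x)"
  proof (rule cbar_op_sum)
    fix j assume "j \<in> {..n}"
    then show "cbar_op n (\<lambda>f. (D1 ^^ j) (\<lambda>x. cnj (a j x) * f x))"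
      using cbar_op_mono[OF cbar_op_D1_pow_mult[OF Cbar_cnj[OF a[of j]], of j], of n] by simp
  qed
  then have "cbar_op n (\<lambda>f x. (-1) * B f x)" unfolding B_def by (rule cbar_op_cmult)
  moreover have "cbar_op n (diff_op n a)"
    unfolding cbar_op_def
    by (rule exI[of _ "\<lambda>l x. if l \<le> n then a l x else 0"]) (auto simp: diff_op_def intro!: Cbar_if a)
  ultimately have "cbar_op n (\<lambda>f x. diff_op n a f x + (-1) * B f x)" by (rule cbar_op_add[rotated])
  then obtain d where d: "\<And>l. d l \<in> Cbar_infinity"
    "\<And>f. smooth f \<Longrightarrow> (\<lambda>x. diff_op n a f x + (-1) * B f x) = diff_op n d f"
    by (auto simp: cbar_op_def)
  show ?thesis
  proof (intro exI[of _ d] conjI allI ballI d(1))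
    fix f g assume f: "f \<in> ccs" and g: "g \<in> ccs"
    note sf = ccs_smooth[OF f] and sg = ccs_smooth[OF g]
    have Bc: "B f \<in> ccs" unfolding B_def
      by (intro ccs_sum ccs_D1_pow ccs_mult s f) auto
    have Ac: "diff_op n a f \<in> ccs" by (rule ccs_diff_op[OF s(1) f])
    have "L2_inner f (diff_op n a g) = (LINT x|lborel. (\<Sum>j\<le>n. f x * (cnj (a j x) * cnj ((D1 ^^ j) g x))))"
      by (simp add: L2_inner_def diff_op_def sum_distrib_left)
    also have "\<dots> = (\<Sum>j\<le>n. LINT x|lborel. f x * (cnj (a j x) * cnj ((D1 ^^ j) g x)))"
      by (intro Bochner_Integration.integral_sum ccs_integrable ccs_mult2 f smooth_mult s
          smooth_linear[OF bounded_linear_cnj] smooth_D1_pow sg) auto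
    also have "\<dots> = (\<Sum>j\<le>n. LINT x|lborel. (D1 ^^ j) (\<lambda>x. cnj (a j x) * f x) x * cnj (g x))"
    proof (rule sum.cong[OF refl])
      fix j assume "j \<in> {..n}"
      then have j: "j \<le> n" by simp
      have "(LINT x|lborel. (D1 ^^ j) (\<lambda>x. cnj (a j x) * f x) x * cnj (g x))
          = (-1) ^ j * (LINT x|lborel. cnj (a j x) * f x * (D1 ^^ j) (\<lambda>x. cnj (g x)) x)"
        by (rule integration_by_parts_pow) (intro smooth_linear[OF bounded_linear_cnj] sg ccs_mult s j f)+
      also have "\<dots> = (LINT x|lborel. (-1) ^ j * (cnj (a j x) * f x * ((-1) ^ j * cnj ((D1 ^^ j) g x))))"
        by (simp add: D1_pow_cnj[OF sg])
      also have "\<dots> = (LINT x|lborel. f x * (cnj (a j x) * cnj ((D1 ^^ j) g x)))"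
      proof -
        \<comment> \<open>One sign comes from j integrations by parts, the other from conjugating
          \<open>D1 ^^ j\<close>; they cancel.\<close>
        have "(-1) ^ j * (p * q * ((-1) ^ j * r)) = q * (p * r)" for p q r :: complex
          by (cases "even j") auto
        then show ?thesis by (simp only:)
      qed
      finally show "(LINT x|lborel. f x * (cnj (a j x) * cnj ((D1 ^^ j) g x)))
          = (LINT x|lborel. (D1 ^^ j) (\<lambda>x. cnj (a j x) * f x) x * cnj (g x))" ..
    qed
    also have "\<dots> = (LINT x|lborel. (\<Sum>j\<le>n. (D1 ^^ j) (\<lambda>x. cnj (a j x) * f x) x * cnj (g x)))"
      by (intro Bochner_Integration.integral_sum[symmetric] ccs_integrable ccs_mult2 f s ccs_D1_pow ccs_mult
          smooth_linear[OF bounded_linear_cnj] sg) auto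
    also have "\<dots> = L2_inner (B f) g" by (simp add: L2_inner_def B_def sum_distrib_right)
    finally have "L2_inner (diff_op n a f) g - L2_inner f (diff_op n a g)
        = (LINT x|lborel. diff_op n a f x * cnj (g x)) - (LINT x|lborel. B f x * cnj (g x))"
      by (simp add: L2_inner_def)
    also have "\<dots> = (LINT x|lborel. diff_op n a f x * cnj (g x) - B f x * cnj (g x))"
      by (intro Bochner_Integration.integral_diff[symmetric] ccs_inner_integrable Ac Bc sg)
    also have "\<dots> = L2_inner (diff_op n d f) g"
      by (simp add: L2_inner_def d(2)[OF sf, symmetric] algebra_simps)
    finally show "L2_inner (diff_op n a f) g - L2_inner f (diff_op n a g) = L2_inner (diff_op n d f) g" .
  qed
qed

lemma ccs_bounded: assumes "f \<in> ccs" shows "bounded (range f)"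
proof -
  obtain R where R: "R > 0" "\<And>x. \<bar>x\<bar> \<ge> R \<Longrightarrow> f x = 0" using ccsE[OF assms] by blast
  have "range f \<subseteq> insert 0 (f ` {-R..R})"
  proof
    fix y assume "y \<in> range f"
    then obtain x where x: "y = f x" by blast
    show "y \<in> insert 0 (f ` {-R..R})"
      by (cases "\<bar>x\<bar> \<ge> R") (use R(2)[of x] x in \<open>auto simp: abs_if split: if_splits\<close>)
  qed
  moreover have "bounded (f ` {-R..R})"
    by (intro compact_imp_bounded compact_continuous_image smooth_continuous ccs_smooth assms compact_Icc)
  ultimately show ?thesis using bounded_subset bounded_insert by blast
qed

lemma ccs_schwartz: assumes "f \<in> ccs" shows "f \<in> schwartz"
proof -
  have 1: "dir_deriv 1 g \<in> ccs" if "g \<in> ccs" for g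
    using ccs_cmult[OF ccs_D1[OF that], of \<i>] by (simp add: D1_def)
  have 2: "(dir_deriv 1 ^^ j) f \<in> ccs" for j by (induction j) (auto intro: 1 assms)
  have "smooth (\<lambda>x::real. complex_of_real x)" by (rule smooth_bounded_linear[OF bounded_linear_of_real])
  then have "smooth (\<lambda>x::real. complex_of_real (x ^ n))" for n
    by (induction n) (auto intro: smooth_mult)
  then have "bounded (range (\<lambda>x. complex_of_real (x ^ n) * (dir_deriv 1 ^^ j) f x))" for n j
    by (intro ccs_bounded ccs_mult 2)
  then show ?thesis using ccs_smooth[OF assms] by (simp add: schwartz_def)
qed

section \<open>Operators of class S0 on modulated test functions\<close>

lemma integral_norm_bound_majorant:
  fixes f :: "'a \<Rightarrow> 'b::{banach, second_countable_topology}"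
  assumes "integrable M g" "\<And>x. norm (f x) \<le> g x"
  shows "norm (LINT x|M. f x) \<le> (LINT x|M. g x)"
proof (cases "integrable M f")
  case True
  have "norm (LINT x|M. f x) \<le> (LINT x|M. norm (f x))" by (rule integral_norm_bound)
  also have "\<dots> \<le> (LINT x|M. g x)" using True assms by (intro integral_mono) auto
  finally show ?thesis .
next
  \<comment> \<open>The integral of a non-integrable function is 0, so the estimate holds here as
    well.\<close>
  case False
  have "0 \<le> g x" for x using assms(2) norm_ge_zero order_trans by blast
  then show ?thesis using False by (simp add: not_integrable_integral_eq)
qed

text \<open>Two integrations by parts turn the factor \<open>1 + \<xi>\<^sup>2\<close> into the
  operator \<open>f + D1 (D1 f)\<close>, whose L1 norm is \<open>K\<close>. Modulation only
  translates the transform, so \<open>K\<close> is independent of \<open>\<eta>\<close>.\<close>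

lemma fourier_decay:
  assumes f: "f \<in> ccs"
  obtains K where "K \<ge> 0" "\<And>\<eta> \<xi>. cmod (fourier (\<lambda>x. exp (\<i> * complex_of_real (\<eta> * x)) * f x) \<xi>) \<le> K * (1 / (1 + (\<xi> - \<eta>)\<^sup>2))"
proof -
  define h where "h = (\<lambda>x. f x + D1 (D1 f) x)"
  have hc: "h \<in> ccs" unfolding h_def by (intro ccs_add f ccs_D1)
  define K where "K = (LINT x|lborel. cmod (h x))"
  have sf: "smooth f" by (rule ccs_smooth[OF f])
  have key: "cmod (fourier f \<xi>) \<le> K * (1 / (1 + \<xi>\<^sup>2))" for \<xi>
  proof -
    define E where "E x = exp (\<i> * complex_of_real (- \<xi> * x)) * 1" for x
    have \<Phi>: "smooth (\<lambda>x. complex_of_real (- \<xi> * x))"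
      by (rule smooth_bounded_linear) (intro bounded_linear_compose[OF bounded_linear_of_real] bounded_linear_mult_right)
    have d\<Phi>: "D1 (\<lambda>x. complex_of_real (- \<xi> * x)) x = - \<i> * complex_of_real (- \<xi>)" for x
      by (rule D1_eqI) (auto intro!: derivative_eq_intros)
    have Es: "smooth E" unfolding E_def by (intro smooth_mult smooth_exp smooth_const \<Phi>)
    have DE: "D1 E = (\<lambda>x. - complex_of_real \<xi> * E x)"
      unfolding E_def D1_exp_mult[OF \<Phi> d\<Phi> smooth_const] by (simp add: tw_def mult.commute)
    have ibp: "(LINT x|lborel. D1 g x * E x) = complex_of_real \<xi> * (LINT x|lborel. g x * E x)" if "g \<in> ccs" for g
      using integration_by_parts[OF that Es] by (simp add: DE mult.left_commute)
    have "(LINT x|lborel. h x * E x) = (LINT x|lborel. f x * E x) + (LINT x|lborel. D1 (D1 f) x * E x)"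
      unfolding h_def distrib_right
      by (intro Bochner_Integration.integral_add ccs_integrable ccs_mult2 ccs_D1 f Es)
    also have "(LINT x|lborel. D1 (D1 f) x * E x) = complex_of_real \<xi> * (complex_of_real \<xi> * (LINT x|lborel. f x * E x))"
      using ibp[OF ccs_D1[OF f]] ibp[OF f] by simp
    also have "(LINT x|lborel. f x * E x) + \<dots> = complex_of_real (1 + \<xi>\<^sup>2) * (LINT x|lborel. f x * E x)"
      by (simp add: power2_eq_square algebra_simps)
    finally have 1: "complex_of_real (1 + \<xi>\<^sup>2) * (LINT x|lborel. f x * E x) = (LINT x|lborel. h x * E x)" ..
    have "cmod (LINT x|lborel. h x * E x) \<le> K" unfolding K_def
    proof (rule integral_norm_bound_majorant)
      show "cmod (h x * E x) \<le> cmod (h x)" for x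
        using norm_exp_i_times[of "- \<xi> * x"] by (simp add: E_def norm_mult)
    qed (use ccs_integrable[OF hc] in auto)
    moreover have "cmod (LINT x|lborel. h x * E x) = (1 + \<xi>\<^sup>2) * cmod (LINT x|lborel. f x * E x)"
      unfolding 1[symmetric] norm_mult by (simp add: abs_of_pos add_pos_nonneg del: of_real_add of_real_power)
    ultimately have 2: "cmod (LINT x|lborel. f x * E x) \<le> K * (1 / (1 + \<xi>\<^sup>2))"
      by (simp add: field_simps add_pos_nonneg)
    have "fourier f \<xi> = complex_of_real (1 / (2 * pi)) * (LINT x|lborel. f x * E x)"
      unfolding fourier_def E_def by (simp add: mult_ac)
    then have "cmod (fourier f \<xi>) = (1 / (2 * pi)) * cmod (LINT x|lborel. f x * E x)"
      by (simp add: norm_mult norm_divide)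
    also have "\<dots> \<le> 1 * cmod (LINT x|lborel. f x * E x)"
      by (rule mult_right_mono) (use pi_gt3 in auto)
    finally show ?thesis using 2 by simp
  qed
  have K0: "K \<ge> 0" unfolding K_def by (rule integral_nonneg_AE) simp
  show ?thesis
  proof (rule that[OF K0])
    fix \<eta> \<xi>
    have "exp (- \<i> * complex_of_real (x * \<xi>)) * (exp (\<i> * complex_of_real (\<eta> * x)) * f x) = exp (- \<i> * complex_of_real (x * (\<xi> - \<eta>))) * f x" for x
    proof -
      have "- \<i> * complex_of_real (x * (\<xi> - \<eta>)) = - \<i> * complex_of_real (x * \<xi>) + \<i> * complex_of_real (\<eta> * x)"
        by (simp add: algebra_simps)
      then show ?thesis by (simp only: exp_add mult.assoc)
    qed
    then have "fourier (\<lambda>x. exp (\<i> * complex_of_real (\<eta> * x)) * f x) \<xi> = fourier f (\<xi> - \<eta>)"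
      unfolding fourier_def by (simp only:)
    then show "cmod (fourier (\<lambda>x. exp (\<i> * complex_of_real (\<eta> * x)) * f x) \<xi>) \<le> K * (1 / (1 + (\<xi> - \<eta>)\<^sup>2))"
      using key by (simp only:)
  qed
qed

text \<open>A nonconstant polynomial is unbounded in modulus already along the real axis.\<close>

lemma bounded_poly_coeff:
  fixes p :: "complex poly"
  assumes b: "\<And>\<eta>::real. cmod (poly p (complex_of_real \<eta>)) \<le> B" and J: "J \<ge> 1"
  shows "poly.coeff p J = 0"
proof -
  obtain a q where p: "p = pCons a q" by (cases p)
  have "q = 0"
  proof (rule ccontr)
    assume "q \<noteq> 0"
    from poly_infinity[OF this, of "B + 1" a] obtain r where
      r: "\<And>z. r \<le> norm z \<Longrightarrow> B + 1 \<le> norm (poly (pCons a q) z)" by blast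
    have "B + 1 \<le> cmod (poly p (complex_of_real (\<bar>r\<bar>)))" unfolding p by (rule r) simp
    then show False using b[of "\<bar>r\<bar>"] by simp
  qed
  then show ?thesis using J by (cases J) (auto simp: p)
qed

text \<open>Modulating both arguments by \<open>e\<^bsup>i\<eta>x\<^esup>\<close> makes the pairing a polynomial in \<open>\<eta>\<close> whose coefficient of
  the highest power only sees the leading coefficient of the operator.\<close>

lemma high_coefficients_vanish:
  assumes d: "\<And>l. d l \<in> Cbar_infinity"
    and bd: "\<And>f g. f \<in> ccs \<Longrightarrow> g \<in> ccs \<Longrightarrow> \<exists>B. \<forall>\<eta>::real.
      cmod (L2_inner (diff_op n d (\<lambda>x. exp (\<i> * complex_of_real (\<eta> * x)) * f x))
        (\<lambda>x. exp (\<i> * complex_of_real (\<eta> * x)) * g x)) \<le> B"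
  shows "1 \<le> J \<Longrightarrow> J \<le> n \<Longrightarrow> f \<in> ccs \<Longrightarrow> g \<in> ccs \<Longrightarrow> L2_inner (\<lambda>x. d J x * f x) g = 0"
proof (induction "n - J" arbitrary: J f g rule: less_induct)
  \<comment> \<open>Downward induction on \<open>J\<close>: the coefficients above \<open>J\<close>
    are already known to annihilate all pairs, in particular those with \<open>(D1 ^^ i) f\<close>
    in place of \<open>f\<close>.\<close>
  case less
  note f = less.prems(3) and g = less.prems(4)
  note sf = ccs_smooth[OF f] and sg = ccs_smooth[OF g]
  define q where "q l i = L2_inner (\<lambda>x. d l x * (D1 ^^ i) f x) g" for l i
  define p where "p = (\<Sum>l\<le>n. \<Sum>i\<le>l. monom (of_nat (l choose i) * q l i) (l - i))"
  obtain B where B: "\<And>\<eta>::real. cmod (L2_inner (diff_op n d (\<lambda>x. exp (\<i> * complex_of_real (\<eta> * x)) * f x))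
        (\<lambda>x. exp (\<i> * complex_of_real (\<eta> * x)) * g x)) \<le> B" using bd[OF f g] by blast
  have val: "L2_inner (diff_op n d (\<lambda>x. exp (\<i> * complex_of_real (\<eta> * x)) * f x))
        (\<lambda>x. exp (\<i> * complex_of_real (\<eta> * x)) * g x) = poly p (complex_of_real \<eta>)" for \<eta> :: real
  proof -
    let ?E = "\<lambda>x. exp (\<i> * complex_of_real (\<eta> * x))" and ?\<eta> = "complex_of_real \<eta>"
    have \<Phi>: "smooth (\<lambda>x. complex_of_real (\<eta> * x))"
      by (rule smooth_bounded_linear) (intro bounded_linear_compose[OF bounded_linear_of_real] bounded_linear_mult_right)
    have d\<Phi>: "D1 (\<lambda>x. complex_of_real (\<eta> * x)) x = - \<i> * ?\<eta>" for x
      by (rule D1_eqI) (auto intro!: derivative_eq_intros)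
    have E1: "?E x * cnj (?E x) = 1" for x
      by (simp only: complex_norm_square[symmetric] norm_exp_i_times) simp
    have Dl: "(D1 ^^ l) (\<lambda>x. ?E x * f x) x = ?E x * (\<Sum>i\<le>l. of_nat (l choose i) * (?\<eta> ^ (l - i) * (D1 ^^ i) f x))" for l x
      by (simp only: D1_pow_exp_mult[OF \<Phi> d\<Phi> smooth_const sf] tw_const[OF sf])
    have "diff_op n d (\<lambda>x. ?E x * f x) x * cnj (?E x * g x)
        = (\<Sum>l\<le>n. \<Sum>i\<le>l. of_nat (l choose i) * ?\<eta> ^ (l - i) * (d l x * (D1 ^^ i) f x * cnj (g x)))" for x
    proof -
      have "diff_op n d (\<lambda>x. ?E x * f x) x * cnj (?E x * g x)
          = (\<Sum>l\<le>n. (?E x * cnj (?E x)) * (d l x * (\<Sum>i\<le>l. of_nat (l choose i) * (?\<eta> ^ (l - i) * (D1 ^^ i) f x)) * cnj (g x)))"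
        unfolding diff_op_def Dl complex_cnj_mult sum_distrib_right by (intro sum.cong refl) (simp only: mult_ac)
      also have "\<dots> = (\<Sum>l\<le>n. \<Sum>i\<le>l. of_nat (l choose i) * ?\<eta> ^ (l - i) * (d l x * (D1 ^^ i) f x * cnj (g x)))"
        unfolding E1 by (simp add: sum_distrib_left sum_distrib_right mult_ac)
      finally show ?thesis .
    qed
    then have "L2_inner (diff_op n d (\<lambda>x. ?E x * f x)) (\<lambda>x. ?E x * g x)
        = (LINT x|lborel. (\<Sum>l\<le>n. \<Sum>i\<le>l. of_nat (l choose i) * ?\<eta> ^ (l - i) * (d l x * (D1 ^^ i) f x * cnj (g x))))"
      by (simp only: L2_inner_def)
    also have "\<dots> = (\<Sum>l\<le>n. LINT x|lborel. (\<Sum>i\<le>l. of_nat (l choose i) * ?\<eta> ^ (l - i) * (d l x * (D1 ^^ i) f x * cnj (g x))))"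
      by (intro Bochner_Integration.integral_sum ccs_integrable ccs_sum ccs_cmult ccs_mult2 ccs_mult ccs_D1_pow f
          Cbar_smooth d smooth_linear[OF bounded_linear_cnj] sg)
    also have "\<dots> = (\<Sum>l\<le>n. \<Sum>i\<le>l. LINT x|lborel. of_nat (l choose i) * ?\<eta> ^ (l - i) * (d l x * (D1 ^^ i) f x * cnj (g x)))"
      by (intro sum.cong refl Bochner_Integration.integral_sum ccs_integrable ccs_cmult ccs_mult2 ccs_mult ccs_D1_pow f
          Cbar_smooth d smooth_linear[OF bounded_linear_cnj] sg)
    also have "\<dots> = poly p ?\<eta>"
      unfolding integral_mult_right_zero
      by (simp add: p_def poly_sum poly_monom q_def L2_inner_def mult_ac)
    finally show ?thesis .
  qed
  have "poly.coeff p J = 0"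
    by (rule bounded_poly_coeff[OF B[unfolded val] less.prems(1)])
  moreover have "poly.coeff p J = (\<Sum>l\<le>n. \<Sum>i\<le>l. if l - i = J then of_nat (l choose i) * q l i else 0)"
    by (simp add: p_def coeff_sum)
  \<comment> \<open>Only l = J with i = 0 survives: smaller l cannot reach the power
    \<open>J\<close>, and for larger l the induction hypothesis removes the term.\<close>
  moreover have "(\<Sum>i\<le>l. if l - i = J then of_nat (l choose i) * q l i else 0) = (if l = J then q J 0 else 0)" if l: "l \<le> n" for l
  proof (cases "l = J")
    case True
    have "(\<Sum>i\<le>l. if l - i = J then of_nat (l choose i) * q l i else 0) = (\<Sum>i\<le>l. if i = 0 then q J 0 else 0)"
      by (rule sum.cong) (use True less.prems in auto)
    then show ?thesis using True by simp
  next
    case False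
    have "(if l - i = J then of_nat (l choose i) * q l i else 0) = 0" if i: "i \<le> l" for i
    proof (cases "l - i = J")
      case True
      then have "J < l" using False by auto
      then have "q l i = 0" unfolding q_def
        by (intro less.hyps) (use l less.prems in \<open>auto intro: ccs_D1_pow\<close>)
      then show ?thesis by simp
    qed simp
    then show ?thesis using False by simp
  qed
  ultimately have "q J 0 = 0" using less.prems by simp
  then show ?case by (simp add: q_def)
qed

text \<open>The symbol is bounded by the estimate without derivatives, and modulation translates a
  fixed integrable majorant of the Fourier transform. Both bounds are uniform in the frequency
  \<open>\<eta>\<close>.\<close>

lemma S0_modulated_bound:
  assumes b: "symbol_S0 b" and B: "\<And>f x. f \<in> ccs \<Longrightarrow>
      B f x = (LINT \<xi>|lborel. exp (\<i> * complex_of_real (x * \<xi>)) * b (x, \<xi>) * fourier f \<xi>)" and f: "f \<in> ccs"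
  shows "\<exists>K. \<forall>(\<eta>::real) x. cmod (B (\<lambda>x. exp (\<i> * complex_of_real (\<eta> * x)) * f x) x) \<le> K"
proof -
  have "\<exists>C. \<forall>x \<xi>. cmod ((dir_deriv (1, 0) ^^ 0) ((dir_deriv (0, 1) ^^ 0) b) (x, \<xi>)) \<le> C * (1 + \<bar>\<xi>\<bar>\<^sup>2) powr (- real 0 / 2)"
    using b unfolding symbol_S0_def by blast
  \<comment> \<open>\<open>powr\<close> with exponent 0 equals 1 only for a nonzero base.\<close>
  moreover have "1 + \<xi>\<^sup>2 \<noteq> 0" for \<xi> :: real using zero_le_power2[of \<xi>] by linarith
  ultimately obtain C where C: "\<And>x \<xi>. cmod (b (x, \<xi>)) \<le> C" by auto
  have C0: "C \<ge> 0" using C norm_ge_zero order_trans by blast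
  obtain K where K: "K \<ge> 0" "\<And>\<eta> \<xi>. cmod (fourier (\<lambda>x. exp (\<i> * complex_of_real (\<eta> * x)) * f x) \<xi>) \<le> K * (1 / (1 + (\<xi> - \<eta>)\<^sup>2))"
    using fourier_decay[OF f] by blast
  define W where "W = (LINT x|lborel. 1 / (1 + x\<^sup>2) :: real)"
  have "cmod (B (\<lambda>x. exp (\<i> * complex_of_real (\<eta> * x)) * f x) x) \<le> C * K * W" for \<eta> x :: real
  proof -
    have \<Phi>: "smooth (\<lambda>x. complex_of_real (\<eta> * x))"
      by (rule smooth_bounded_linear) (intro bounded_linear_compose[OF bounded_linear_of_real] bounded_linear_mult_right)
    have fc: "(\<lambda>x. exp (\<i> * complex_of_real (\<eta> * x)) * f x) \<in> ccs"
      by (intro ccs_mult f smooth_exp smooth_mult smooth_const \<Phi>)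
    have i: "integrable lborel (\<lambda>\<xi>. 1 / (1 + (\<xi> - \<eta>)\<^sup>2))"
      using lborel_integrable_real_affine[OF integrable_weight, of 1 "- \<eta>"] by simp
    have w: "(LINT \<xi>|lborel. 1 / (1 + (\<xi> - \<eta>)\<^sup>2)) = W"
      using lborel_integral_real_affine[of 1 "\<lambda>x. 1 / (1 + x\<^sup>2)" "- \<eta>"] by (simp add: W_def)
    have "cmod (B (\<lambda>x. exp (\<i> * complex_of_real (\<eta> * x)) * f x) x) \<le> (LINT \<xi>|lborel. C * K * (1 / (1 + (\<xi> - \<eta>)\<^sup>2)))"
      unfolding B[OF fc]
    proof (rule integral_norm_bound_majorant)
      show "integrable lborel (\<lambda>\<xi>. C * K * (1 / (1 + (\<xi> - \<eta>)\<^sup>2)))" by (intro integrable_mult_right i)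
      fix \<xi>
      have "cmod (exp (\<i> * complex_of_real (x * \<xi>)) * b (x, \<xi>) * fourier (\<lambda>x. exp (\<i> * complex_of_real (\<eta> * x)) * f x) \<xi>)
          = cmod (b (x, \<xi>)) * cmod (fourier (\<lambda>x. exp (\<i> * complex_of_real (\<eta> * x)) * f x) \<xi>)"
        unfolding norm_mult norm_exp_i_times by simp
      also have "\<dots> \<le> C * (K * (1 / (1 + (\<xi> - \<eta>)\<^sup>2)))"
        by (rule mult_mono[OF C K(2) C0]) simp
      finally show "cmod (exp (\<i> * complex_of_real (x * \<xi>)) * b (x, \<xi>) * fourier (\<lambda>x. exp (\<i> * complex_of_real (\<eta> * x)) * f x) \<xi>)
          \<le> C * K * (1 / (1 + (\<xi> - \<eta>)\<^sup>2))" by (simp only: mult.assoc)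
    qed
    also have "\<dots> = C * K * W" by (simp only: integral_mult_right_zero w)
    finally show ?thesis .
  qed
  then show ?thesis by blast
qed

text \<open>The difference of A and its adjoint is described twice: as a differential operator with
  coefficients \<open>d\<close>, and as an operator in \<open>S0\<close> with bounded modulated
  pairings. Hence only \<open>d 0\<close> contributes to pairings, and twice the imaginary part of
  \<open>L2_inner (A u) u\<close> is controlled by a bounded multiplication operator.\<close>

lemma self_adjoint_energy:
  assumes a: "\<And>j. j \<le> n \<Longrightarrow> a j \<in> Cbar_infinity" and sa: "self_adjoint_mod_S0 (diff_op n a)"
  shows "\<exists>K\<ge>0. \<forall>u\<in>ccs. \<bar>Im (L2_inner (diff_op n a u) u)\<bar> \<le> K * (L2_norm u)\<^sup>2"
proof -
  let ?A = "diff_op n a"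
  obtain A' where A': "formal_adjoint ?A A'" "equiv_mod_S0 ?A A'" using sa by (auto simp: self_adjoint_mod_S0_def)
  obtain b where b: "symbol_S0 b" "\<And>f x. f \<in> schwartz \<Longrightarrow>
      ?A f x - A' f x = (LINT \<xi>|lborel. exp (\<i> * complex_of_real (x * \<xi>)) * b (x, \<xi>) * fourier f \<xi>)"
    using A'(2) unfolding equiv_mod_S0_def S0_def by blast
  define B where "B f x = ?A f x - A' f x" for f x
  have Bb: "B f x = (LINT \<xi>|lborel. exp (\<i> * complex_of_real (x * \<xi>)) * b (x, \<xi>) * fourier f \<xi>)" if "f \<in> ccs" for f x
    unfolding B_def by (rule b(2)[OF ccs_schwartz[OF that]])
  obtain d where d: "\<And>l. d l \<in> Cbar_infinity" "\<And>f g. f \<in> ccs \<Longrightarrow> g \<in> ccs \<Longrightarrow>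
      L2_inner (?A f) g - L2_inner f (?A g) = L2_inner (diff_op n d f) g"
    using adjoint_difference[of n a] a by blast
  have sm: "smooth (a j)" if "j \<le> n" for j using a[OF that] Cbar_smooth by blast
  \<comment> \<open>Since \<open>A'\<close> is the formal adjoint, the operator with coefficients
    \<open>d\<close> and the \<open>S0\<close> operator \<open>B\<close> have the same pairings on
    \<open>ccs\<close>.\<close>
  have dB: "L2_inner (diff_op n d f) g = (LINT x|lborel. B f x * cnj (g x))"
    and bi: "cmod (L2_inner (diff_op n d f) g) \<le> K * (LINT x|lborel. cmod (g x))" if fg: "f \<in> ccs" "g \<in> ccs"
      and K: "\<And>x. cmod (B f x) \<le> K" for f g K
  proof -
    have S: "A' f \<in> schwartz" using A'(1) ccs_schwartz[OF fg(1)] by (auto simp: formal_adjoint_def)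
    have sA': "smooth (A' f)" using S by (simp add: schwartz_def)
    have "L2_inner f (?A g) = cnj (L2_inner (?A g) f)" by (rule inner_cnj)
    also have "\<dots> = cnj (L2_inner g (A' f))" using A'(1) fg ccs_schwartz by (simp add: formal_adjoint_def)
    also have "\<dots> = L2_inner (A' f) g" by (rule inner_cnj[symmetric])
    finally have "L2_inner (diff_op n d f) g = L2_inner (?A f) g - L2_inner (A' f) g"
      using d(2)[OF fg] by simp
    also have "\<dots> = (LINT x|lborel. ?A f x * cnj (g x) - A' f x * cnj (g x))"
      unfolding L2_inner_def
    proof (rule Bochner_Integration.integral_diff[symmetric])
      show "integrable lborel (\<lambda>x. ?A f x * cnj (g x))"
        by (intro ccs_integrable ccs_mult ccs_cnj fg smooth_diff_op sm ccs_smooth)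
      show "integrable lborel (\<lambda>x. A' f x * cnj (g x))"
        by (intro ccs_integrable ccs_mult ccs_cnj fg sA')
    qed
    finally show eq: "L2_inner (diff_op n d f) g = (LINT x|lborel. B f x * cnj (g x))"
      by (simp add: B_def left_diff_distrib)
    have "cmod (LINT x|lborel. B f x * cnj (g x)) \<le> (LINT x|lborel. K * cmod (g x))"
      by (rule integral_norm_bound_majorant)
        (use K ccs_integrable[OF fg(2)] in \<open>auto simp: norm_mult intro!: mult_right_mono\<close>)
    then show "cmod (L2_inner (diff_op n d f) g) \<le> K * (LINT x|lborel. cmod (g x))"
      by (simp add: eq)
  qed
  have bd: "\<exists>B. \<forall>\<eta>::real. cmod (L2_inner (diff_op n d (\<lambda>x. exp (\<i> * complex_of_real (\<eta> * x)) * f x))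
        (\<lambda>x. exp (\<i> * complex_of_real (\<eta> * x)) * g x)) \<le> B" if fg: "f \<in> ccs" "g \<in> ccs" for f g
  proof -
    obtain K where K: "\<And>(\<eta>::real) x. cmod (B (\<lambda>x. exp (\<i> * complex_of_real (\<eta> * x)) * f x) x) \<le> K"
      using S0_modulated_bound[OF b(1) Bb fg(1)] by blast
    have "cmod (L2_inner (diff_op n d (\<lambda>x. exp (\<i> * complex_of_real (\<eta> * x)) * f x))
        (\<lambda>x. exp (\<i> * complex_of_real (\<eta> * x)) * g x)) \<le> K * (LINT x|lborel. cmod (g x))" for \<eta> :: real
    proof -
      have \<Phi>: "smooth (\<lambda>x. complex_of_real (\<eta> * x))"
        by (rule smooth_bounded_linear) (intro bounded_linear_compose[OF bounded_linear_of_real] bounded_linear_mult_right)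
      have "(\<lambda>x. exp (\<i> * complex_of_real (\<eta> * x)) * h x) \<in> ccs" if "h \<in> ccs" for h
        by (intro ccs_mult that smooth_exp smooth_mult smooth_const \<Phi>)
      from bi[OF this[OF fg(1)] this[OF fg(2)] K] show ?thesis
        by (simp only: norm_mult norm_exp_i_times mult_1_left)
    qed
    then show ?thesis by blast
  qed
  obtain K0 where K0: "K0 \<ge> 0" "\<And>x. cmod (d 0 x) \<le> K0" using Cbar_bound[OF d(1)] by blast
  have "\<bar>Im (L2_inner (?A u) u)\<bar> \<le> K0 * (L2_norm u)\<^sup>2" if u: "u \<in> ccs" for u
  proof -
    have c: "(\<lambda>x. d l x * (D1 ^^ l) u x * cnj (u x)) \<in> ccs" for l
      by (rule ccs_mult2[OF ccs_mult[OF Cbar_smooth[OF d(1)] ccs_D1_pow[OF u]]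
            smooth_linear[OF bounded_linear_cnj ccs_smooth[OF u]]])
    have "L2_inner (diff_op n d u) u = (LINT x|lborel. (\<Sum>l\<le>n. d l x * (D1 ^^ l) u x * cnj (u x)))"
      by (simp add: L2_inner_def diff_op_def sum_distrib_right)
    also have "\<dots> = (\<Sum>l\<le>n. L2_inner (\<lambda>x. d l x * (D1 ^^ l) u x) u)"
      unfolding L2_inner_def
      by (intro Bochner_Integration.integral_sum ccs_integrable c)
    also have "\<dots> = (\<Sum>l\<le>n. if l = 0 then L2_inner (\<lambda>x. d 0 x * u x) u else 0)"
    proof (rule sum.cong[OF refl])
      fix l assume "l \<in> {..n}"
      then have "L2_inner (\<lambda>x. d l x * (D1 ^^ l) u x) u = 0" if "l \<noteq> 0"
        using that by (intro high_coefficients_vanish[OF d(1) bd _ _ ccs_D1_pow[OF u] u]) simp_all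
      then show "L2_inner (\<lambda>x. d l x * (D1 ^^ l) u x) u = (if l = 0 then L2_inner (\<lambda>x. d 0 x * u x) u else 0)"
        by (cases "l = 0") simp_all
    qed
    finally have 1: "L2_inner (diff_op n d u) u = L2_inner (\<lambda>x. d 0 x * u x) u" by simp
    have "cmod (L2_inner (\<lambda>x. d 0 x * u x) u) \<le> (LINT x|lborel. K0 * (cmod (u x))\<^sup>2)"
      unfolding L2_inner_def
      by (rule integral_norm_bound_majorant)
        (use K0 L2_integrable[OF ccs_L2[OF u]] in
          \<open>auto simp: norm_mult power2_eq_square mult.assoc intro!: mult_right_mono\<close>)
    also have "\<dots> = K0 * (L2_norm u)\<^sup>2"
      by (simp add: L2_norm_def integral_nonneg_AE)
    finally have 2: "cmod (L2_inner (diff_op n d u) u) \<le> K0 * (L2_norm u)\<^sup>2" by (simp add: 1)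
    have "L2_inner (?A u) u - cnj (L2_inner (?A u) u) = L2_inner (diff_op n d u) u"
      using d(2)[OF u u] inner_cnj[of u "?A u"] by simp
    then have "2 * Im (L2_inner (?A u) u) = Im (L2_inner (diff_op n d u) u)"
      by (auto simp: complex_eq_iff)
    then have "2 * \<bar>Im (L2_inner (?A u) u)\<bar> \<le> K0 * (L2_norm u)\<^sup>2"
      using abs_Im_le_cmod[of "L2_inner (diff_op n d u) u"] 2 by linarith
    moreover have "0 \<le> K0 * (L2_norm u)\<^sup>2" using K0 by simp
    ultimately show ?thesis by linarith
  qed
  then show ?thesis using K0(1) by blast
qed

lemma diff_op_opcoeff:
  assumes "m \<le> k - 2" "k \<ge> 2"
  shows "diff_op k (opcoeff k m a b) f x = (D1 ^^ k) f x + diff_op (k - 2) (\<lambda>j x. a j x + (if j \<le> m then b j x else 0)) f x"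
proof -
  have e: "opcoeff k m a b j x * y = (if j = k then y else 0)
      + (if j \<le> k - 2 then (a j x + (if j \<le> m then b j x else 0)) * y else 0)" for j y
    using assms by (auto simp: opcoeff_def distrib_right)
  have k: "k - 2 \<le> k" by simp
  show ?thesis
    unfolding diff_op_def e by (simp only: sum.distrib sum_atMost_restrict[OF k]) simp
qed

text \<open>\<open>D1 ^^ k\<close> is symmetric, so \<open>\<i> P\<^sub>0\<close> is skew up to the
  constant \<open>K\<close> from A. A Gronwall argument for the squared norm then takes the place of
  Duhamel's formula; wellposedness is not assumed for this operator.\<close>

lemma self_adjoint_energy_bound:
  assumes a: "\<And>j. j \<le> k - 2 \<Longrightarrow> a j \<in> Cbar_infinity" and sa: "self_adjoint_mod_S0 (diff_op (k - 2) a)"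
    and m: "m \<le> k - 2" "k \<ge> 2"
  shows "\<exists>M. energy_bound k (opcoeff k m a (\<lambda>j x. 0)) M"
proof -
  let ?P = "diff_op k (opcoeff k m a (\<lambda>j x. 0))"
  obtain K where K: "K \<ge> 0" "\<And>u. u \<in> ccs \<Longrightarrow> \<bar>Im (L2_inner (diff_op (k - 2) a u) u)\<bar> \<le> K * (L2_norm u)\<^sup>2"
    using self_adjoint_energy[of "k - 2" a] a sa by blast
  have sm: "smooth (opcoeff k m a (\<lambda>j x. 0) j)" for j
    by (rule opcoeff_smooth) (use a Cbar_smooth in auto)
  have P: "?P u x = (D1 ^^ k) u x + diff_op (k - 2) a u x" for u x
    by (simp add: diff_op_opcoeff m)
  have gen: "\<bar>inner (emb (\<lambda>x. \<i> * ?P u x)) (emb u)\<bar> \<le> K * inner (emb u) (emb u)" if u: "u \<in> ccs" for u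
  proof -
    note su = ccs_smooth[OF u]
    have "L2_inner ((D1 ^^ k) u) u = (-1) ^ k * (LINT x|lborel. u x * (D1 ^^ k) (\<lambda>x. cnj (u x)) x)"
      unfolding L2_inner_def by (rule integration_by_parts_pow[OF smooth_linear[OF bounded_linear_cnj su] u])
    also have "\<dots> = (LINT x|lborel. (-1) ^ k * (u x * ((-1) ^ k * cnj ((D1 ^^ k) u x))))"
      by (simp add: D1_pow_cnj[OF su])
    also have "\<dots> = L2_inner u ((D1 ^^ k) u)"
    proof -
      have "(-1) ^ k * (p * ((-1) ^ k * r)) = p * r" for p r :: complex
        by (cases "even k") auto
      then show ?thesis unfolding L2_inner_def by (simp only:)
    qed
    also have "\<dots> = cnj (L2_inner ((D1 ^^ k) u) u)" by (rule inner_cnj)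
    finally have r: "Im (L2_inner ((D1 ^^ k) u) u) = 0" by (simp add: complex_eq_iff)
    have "L2_inner (?P u) u = L2_inner ((D1 ^^ k) u) u + L2_inner (diff_op (k - 2) a u) u"
      unfolding L2_inner_def P distrib_right
      by (intro Bochner_Integration.integral_add ccs_inner_integrable ccs_D1_pow u su ccs_diff_op Cbar_smooth a)
    then have i: "\<bar>Im (L2_inner (?P u) u)\<bar> \<le> K * (L2_norm u)\<^sup>2" using r K(2)[OF u] by simp
    have L: "(\<lambda>x. \<i> * ?P u x) \<in> L2" "u \<in> L2" by (intro ccs_L2 ccs_cmult ccs_diff_op sm u)+
    have "inner (emb (\<lambda>x. \<i> * ?P u x)) (emb u) = Re (\<i> * L2_inner (?P u) u)"
      by (simp add: inner_emb L L2_inner_def mult.assoc)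
    moreover have "inner (emb u) (emb u) = (L2_norm u)\<^sup>2"
      using norm_emb[OF L(2)] by (simp add: power2_norm_eq_inner[symmetric])
    ultimately show ?thesis using i by simp
  qed
  \<comment> \<open>The exponent is half of \<open>2 * K + 1\<close>, the bound found below for
    \<open>l * T\<close>; the half comes from returning from the squared norm to the norm.\<close>
  have "energy_bound k (opcoeff k m a (\<lambda>j x. 0)) (exp (K + 1 / 2))"
    unfolding energy_bound_def
  proof (intro allI impI)
    fix \<tau> u u' S assume \<tau>: "\<bar>\<tau>\<bar> \<le> (1::real)" and *: "\<forall>t\<in>closed_segment 0 \<tau>. u t \<in> ccs \<and> u' t \<in> L2 \<and>
      ((\<lambda>t. emb (u t)) has_vector_derivative emb (u' t)) (at t) \<and>
      L2_norm (\<lambda>x. u' t x - \<i> * ?P (u t) x) \<le> S"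
    have u: "u t \<in> ccs" "u' t \<in> L2" "((\<lambda>t. emb (u t)) has_vector_derivative emb (u' t)) (at t)"
      "L2_norm (\<lambda>x. u' t x - \<i> * ?P (u t) x) \<le> S" if "t \<in> closed_segment 0 \<tau>" for t
      using * that by auto
    have S0: "S \<ge> 0" using u(4)[of 0] L2_norm_nonneg order_trans by (metis ends_in_segment(1))
    have e1: "exp (K + 1 / 2) \<ge> 1" using K by simp
    show "L2_norm (u \<tau>) \<le> exp (K + 1 / 2) * (L2_norm (u 0) + \<bar>\<tau>\<bar> * S)"
    proof (cases "\<tau> = 0")
      case True
      then show ?thesis using mult_right_mono[OF e1, of "L2_norm (u 0)"] by simp
    next
      case False
      define T where "T = \<bar>\<tau>\<bar>"
      \<comment> \<open>The direction of time: with the parameter s running from 0 to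
        |\<open>\<tau>\<close>| both signs of \<open>\<tau>\<close> are treated at once.\<close>
      define \<sigma> where "\<sigma> = sgn \<tau>"
      have T: "T > 0" "\<sigma> * T = \<tau>" "\<bar>\<sigma>\<bar> = 1" using False by (auto simp: T_def \<sigma>_def abs_sgn_eq sgn_mult_abs)
      have seg: "\<sigma> * s \<in> closed_segment 0 \<tau>" if "0 \<le> s" "s \<le> T" for s
        using that False by (auto simp: T_def \<sigma>_def closed_segment_eq_real_ivl sgn_if split: if_splits)
      define e where "e t = emb (u t)" for t
      define Y where "Y s = inner (e (\<sigma> * s)) (e (\<sigma> * s))" for s
      \<comment> \<open>\<open>2 * K\<close> covers the growth due to the operator, and
        \<open>1 / T\<close> pays for the first term in
        \<open>2 S N \<le> N\<^sup>2 / T + T S\<^sup>2\<close>.\<close>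
      define l where "l = 2 * K + 1 / T"
      have l: "l > 0" unfolding l_def using K T by (intro add_nonneg_pos) auto
      \<comment> \<open>The added constant makes the inhomogeneous differential inequality for
        \<open>Y\<close> a plain monotonicity statement.\<close>
      define y where "y s = exp (- l * s) * (Y s + T * S\<^sup>2 / l)" for s
      have "y T \<le> y 0"
      proof (rule DERIV_nonpos_imp_nonincreasing[of 0 T y])
        fix s assume s: "0 \<le> s" "s \<le> T"
        define t where "t = \<sigma> * s"
        have t: "t \<in> closed_segment 0 \<tau>" unfolding t_def by (rule seg[OF s])
        define N where "N = norm (e t)"
        have ed: "((\<lambda>s. e (\<sigma> * s)) has_vector_derivative \<sigma> *\<^sub>R emb (u' t)) (at s)"
        proof -
          have 1: "((\<lambda>s. \<sigma> * s) has_vector_derivative \<sigma>) (at s)" by (auto intro!: derivative_eq_intros)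
          have 2: "(e has_vector_derivative emb (u' t)) (at (\<sigma> * s))"
            using u(3)[OF t] by (simp add: e_def[abs_def] t_def)
          show ?thesis using vector_diff_chain_at[OF 1 2] by (simp add: o_def)
        qed
        have Yd: "(Y has_real_derivative 2 * \<sigma> * inner (emb (u' t)) (e t)) (at s)"
        proof -
          have "(Y has_derivative (\<lambda>h. inner (e (\<sigma> * s)) (h *\<^sub>R (\<sigma> *\<^sub>R emb (u' t))) + inner (h *\<^sub>R (\<sigma> *\<^sub>R emb (u' t))) (e (\<sigma> * s)))) (at s)"
            unfolding Y_def[abs_def] by (rule has_derivative_inner) (use ed in \<open>simp_all add: has_vector_derivative_def\<close>)
          moreover have "(\<lambda>h. inner (e (\<sigma> * s)) (h *\<^sub>R (\<sigma> *\<^sub>R emb (u' t))) + inner (h *\<^sub>R (\<sigma> *\<^sub>R emb (u' t))) (e (\<sigma> * s)))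
              = (\<lambda>h. 2 * \<sigma> * inner (emb (u' t)) (e t) * h)"
            by (rule ext) (simp add: t_def inner_commute algebra_simps)
          ultimately show ?thesis by (simp add: has_field_derivative_def)
        qed
        define g where "g = (\<lambda>x. u' t x - \<i> * ?P (u t) x)"
        have L: "(\<lambda>x. \<i> * ?P (u t) x) \<in> L2" by (intro ccs_L2 ccs_cmult ccs_diff_op sm u(1)[OF t])
        have gL: "g \<in> L2" unfolding g_def by (intro L2_diff u(2)[OF t] L)
        have sp: "emb (u' t) = emb (\<lambda>x. \<i> * ?P (u t) x) + emb g"
          unfolding g_def by (simp add: emb_diff u(2)[OF t] L)
        have "\<bar>inner (emb g) (e t)\<bar> \<le> norm (emb g) * norm (e t)" by (rule Cauchy_Schwarz_ineq2)
        also have "\<dots> \<le> S * N" unfolding N_def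
        proof (rule mult_right_mono)
          show "norm (emb g) \<le> S" unfolding norm_emb[OF gL] unfolding g_def by (rule u(4)[OF t])
        qed simp
        finally have 1: "\<bar>inner (emb g) (e t)\<bar> \<le> S * N" .
        have 2: "\<bar>inner (emb (\<lambda>x. \<i> * ?P (u t) x)) (e t)\<bar> \<le> K * N\<^sup>2"
          using gen[OF u(1)[OF t]] by (simp add: e_def N_def power2_norm_eq_inner)
        have 3: "\<bar>2 * \<sigma> * inner (emb (u' t)) (e t)\<bar> \<le> 2 * (K * N\<^sup>2 + S * N)"
        proof -
          have "\<bar>2 * \<sigma> * inner (emb (u' t)) (e t)\<bar> = 2 * \<bar>inner (emb (u' t)) (e t)\<bar>"
            by (simp add: abs_mult T(3))
          moreover have "\<bar>inner (emb (u' t)) (e t)\<bar> \<le> \<bar>inner (emb (\<lambda>x. \<i> * ?P (u t) x)) (e t)\<bar> + \<bar>inner (emb g) (e t)\<bar>"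
            unfolding sp inner_add_left by (rule abs_triangle_ineq)
          moreover have "\<dots> \<le> K * N\<^sup>2 + S * N" by (intro add_mono 1 2)
          ultimately show ?thesis by simp
        qed
        have 4: "2 * (S * N) \<le> N\<^sup>2 / T + T * S\<^sup>2"
        proof -
          have "0 \<le> (N - T * S)\<^sup>2" by simp
          then have "2 * (S * N) * T \<le> N\<^sup>2 + T * S\<^sup>2 * T" by (simp add: power2_eq_square algebra_simps)
          also have "\<dots> = (N\<^sup>2 / T + T * S\<^sup>2) * T" using T(1) by (simp add: field_simps)
          finally show ?thesis using T(1) by (simp add: mult_le_cancel_right)
        qed
        have YN: "Y s = N\<^sup>2" by (simp add: Y_def N_def t_def power2_norm_eq_inner)
        have 5: "2 * \<sigma> * inner (emb (u' t)) (e t) - l * (Y s + T * S\<^sup>2 / l) \<le> 0"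
        proof -
          have "l * (Y s + T * S\<^sup>2 / l) = 2 * (K * N\<^sup>2) + N\<^sup>2 / T + T * S\<^sup>2"
            using l by (simp add: distrib_left YN) (simp add: l_def distrib_right)
          moreover have "2 * \<sigma> * inner (emb (u' t)) (e t) \<le> 2 * (K * N\<^sup>2) + 2 * (S * N)"
            using order_trans[OF abs_ge_self 3] by (simp only: distrib_left)
          ultimately show ?thesis using 4 by simp
        qed
        have "(y has_real_derivative exp (- l * s) * (2 * \<sigma> * inner (emb (u' t)) (e t)) + exp (- l * s) * (- l) * (Y s + T * S\<^sup>2 / l)) (at s)"
          unfolding y_def[abs_def] by (auto intro!: derivative_eq_intros Yd)
        moreover have "exp (- l * s) * (2 * \<sigma> * inner (emb (u' t)) (e t)) + exp (- l * s) * (- l) * (Y s + T * S\<^sup>2 / l)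
            = exp (- l * s) * (2 * \<sigma> * inner (emb (u' t)) (e t) - l * (Y s + T * S\<^sup>2 / l))"
          by (simp add: right_diff_distrib)
        moreover have "\<dots> \<le> 0" using 5 by (intro mult_nonneg_nonpos) auto
        ultimately show "\<exists>d. (y has_real_derivative d) (at s) \<and> d \<le> 0" by metis
      qed (use T in simp)
      moreover have "exp (- l * T) * Y T \<le> y T"
        unfolding y_def using l T(1) by (intro mult_left_mono) auto
      ultimately have "exp (- l * T) * Y T \<le> y 0" by (rule order_trans[rotated])
      moreover have "y 0 = Y 0 + T * S\<^sup>2 / l" by (simp add: y_def)
      ultimately have "exp (- l * T) * Y T \<le> Y 0 + T * S\<^sup>2 / l" by (simp only:)
      moreover have "T * S\<^sup>2 / l \<le> (T * S)\<^sup>2"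
      proof -
        have "1 / T \<le> l" using K by (simp add: l_def)
        then have "1 \<le> l * T" using T(1) by (simp add: field_simps)
        then have "T * S\<^sup>2 * 1 \<le> T * S\<^sup>2 * (l * T)" using T by (intro mult_left_mono) auto
        then show ?thesis using l by (simp add: field_simps power2_eq_square)
      qed
      ultimately have "exp (- l * T) * Y T \<le> Y 0 + (T * S)\<^sup>2" by linarith
      then have "Y T \<le> exp (l * T) * (Y 0 + (T * S)\<^sup>2)"
        by (simp add: exp_minus field_simps)
      also have "\<dots> \<le> exp (2 * K + 1) * (Y 0 + (T * S)\<^sup>2)"
      proof (rule mult_right_mono)
        have "2 * K * T \<le> 2 * K * 1" using K \<tau> by (intro mult_left_mono) (auto simp: T_def)
        then have "l * T \<le> 2 * K + 1" using T by (simp add: l_def distrib_right)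
        then show "exp (l * T) \<le> exp (2 * K + 1)" by simp
        show "0 \<le> Y 0 + (T * S)\<^sup>2" by (simp add: Y_def)
      qed
      also have "exp (2 * K + 1) = (exp (K + 1 / 2))\<^sup>2" by (simp add: power2_eq_square flip: exp_add)
      also have "Y 0 + (T * S)\<^sup>2 \<le> (norm (e 0) + T * S)\<^sup>2"
        using S0 T(1) by (simp add: Y_def power2_norm_eq_inner[symmetric] power2_sum)
      finally have "(norm (e \<tau>))\<^sup>2 \<le> (exp (K + 1 / 2) * (norm (e 0) + T * S))\<^sup>2"
        using T(2) by (simp add: Y_def power2_norm_eq_inner[symmetric] power_mult_distrib)
      then have "norm (e \<tau>) \<le> exp (K + 1 / 2) * (norm (e 0) + T * S)"
        by (rule power2_le_imp_le) (use S0 T(1) in auto)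
      moreover have "u \<tau> \<in> L2" "u 0 \<in> L2" by (intro ccs_L2 u(1), simp)+
      ultimately show ?thesis by (simp add: e_def norm_emb T_def)
    qed
  qed
  then show ?thesis by blast
qed

section \<open>Expansions in powers of the frequency\<close>

text \<open>The first argument is the frequency \<open>\<xi>\<close>; functions are only compared for \<open>\<xi> \<ge> 1\<close>.\<close>

definition LP :: "int \<Rightarrow> (real \<Rightarrow> real \<Rightarrow> complex) set"
  where "LP d = {f. \<exists>N g. (\<forall>i. g i \<in> Cbar_infinity) \<and>
    (\<forall>\<xi>\<ge>1. \<forall>x. f \<xi> x = (\<Sum>i\<le>(N::nat). g i x * complex_of_real (\<xi> powi (d - int i))))}"

lemma LP_cong: "f \<in> LP d \<Longrightarrow> (\<And>\<xi> x. \<xi> \<ge> 1 \<Longrightarrow> g \<xi> x = f \<xi> x) \<Longrightarrow> g \<in> LP d"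
  by (simp add: LP_def)

lemma LP_monom: "g \<in> Cbar_infinity \<Longrightarrow> (\<lambda>\<xi> x. g x * complex_of_real (\<xi> powi d)) \<in> LP d"
  unfolding LP_def by (auto intro!: exI[of _ 0] exI[of _ "\<lambda>i. g"])

text \<open>The degree is raised by padding the expansion with zero leading coefficients.\<close>

lemma LP_mono_aux: assumes "f \<in> LP d" shows "f \<in> LP (d + int n)"
proof (induction n)
  case (Suc n)
  then obtain N g where g: "\<forall>i. g i \<in> Cbar_infinity"
    "\<And>\<xi> x. \<xi> \<ge> 1 \<Longrightarrow> f \<xi> x = (\<Sum>i\<le>(N::nat). g i x * complex_of_real (\<xi> powi (d + int n - int i)))"
    by (auto simp: LP_def)
  define h where "h i = (case i of 0 \<Rightarrow> (\<lambda>x. 0) | Suc i \<Rightarrow> g i)" for i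
  have "f \<xi> x = (\<Sum>i\<le>Suc N. h i x * complex_of_real (\<xi> powi (d + int (Suc n) - int i)))" if "\<xi> \<ge> 1" for \<xi> x
    unfolding sum.atMost_Suc_shift by (simp add: h_def g(2)[OF that] algebra_simps)
  moreover have "h i \<in> Cbar_infinity" for i by (cases i) (auto simp: h_def g(1))
  ultimately show ?case unfolding LP_def by blast
qed (use assms in simp)

lemma LP_mono: assumes "f \<in> LP d" "d \<le> d'" shows "f \<in> LP d'"
  using LP_mono_aux[OF assms(1), of "nat (d' - d)"] assms(2) by simp

lemma LP_add: assumes "f \<in> LP d" "h \<in> LP d" shows "(\<lambda>\<xi> x. f \<xi> x + h \<xi> x) \<in> LP d"
proof -
  obtain N g where g: "\<forall>i. g i \<in> Cbar_infinity"
    "\<And>\<xi> x. \<xi> \<ge> 1 \<Longrightarrow> f \<xi> x = (\<Sum>i\<le>(N::nat). g i x * complex_of_real (\<xi> powi (d - int i)))"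
    using assms(1) by (auto simp: LP_def)
  obtain N' g' where g': "\<forall>i. g' i \<in> Cbar_infinity"
    "\<And>\<xi> x. \<xi> \<ge> 1 \<Longrightarrow> h \<xi> x = (\<Sum>i\<le>(N'::nat). g' i x * complex_of_real (\<xi> powi (d - int i)))"
    using assms(2) by (auto simp: LP_def)
  define k where "k i x = (if i \<le> N then g i x else 0) + (if i \<le> N' then g' i x else 0)" for i x
  have "f \<xi> x + h \<xi> x = (\<Sum>i\<le>max N N'. k i x * complex_of_real (\<xi> powi (d - int i)))" if "\<xi> \<ge> 1" for \<xi> x
  proof -
    have e: "k i x * y = (if i \<le> N then g i x * y else 0) + (if i \<le> N' then g' i x * y else 0)" for i y
      by (simp add: k_def distrib_right)
    show ?thesis unfolding e sum.distrib
      by (simp only: sum_atMost_restrict[of N "max N N'"] sum_atMost_restrict[of N' "max N N'"] max.cobounded1 max.cobounded2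
          g(2)[OF that] g'(2)[OF that])
  qed
  moreover have "k i \<in> Cbar_infinity" for i unfolding k_def using g g' by (intro Cbar_add Cbar_if) auto
  ultimately show ?thesis unfolding LP_def by blast
qed

lemma LP_zero: "(\<lambda>\<xi> x. 0) \<in> LP d"
  using LP_monom[of "\<lambda>x. 0" d] by simp

lemma LP_sum: "(\<And>i. i \<in> I \<Longrightarrow> f i \<in> LP d) \<Longrightarrow> (\<lambda>\<xi> x. \<Sum>i\<in>I. f i \<xi> x) \<in> LP d"
proof (induction I rule: infinite_finite_induct)
  case (insert i I)
  then show ?case using LP_add[of "f i" d "\<lambda>\<xi> x. \<Sum>i\<in>I. f i \<xi> x"] by simp
qed (auto intro: LP_zero)

lemma LP_mult: assumes "f \<in> LP d" "h \<in> LP e" shows "(\<lambda>\<xi> x. f \<xi> x * h \<xi> x) \<in> LP (d + e)"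
proof -
  obtain N g where g: "\<forall>i. g i \<in> Cbar_infinity"
    "\<And>\<xi> x. \<xi> \<ge> 1 \<Longrightarrow> f \<xi> x = (\<Sum>i\<le>(N::nat). g i x * complex_of_real (\<xi> powi (d - int i)))"
    using assms(1) by (auto simp: LP_def)
  obtain N' g' where g': "\<forall>i. g' i \<in> Cbar_infinity"
    "\<And>\<xi> x. \<xi> \<ge> 1 \<Longrightarrow> h \<xi> x = (\<Sum>i\<le>(N'::nat). g' i x * complex_of_real (\<xi> powi (e - int i)))"
    using assms(2) by (auto simp: LP_def)
  have "(\<lambda>\<xi> x. \<Sum>i\<le>N. \<Sum>j\<le>N'. (g i x * g' j x) * complex_of_real (\<xi> powi (d + e - int i - int j))) \<in> LP (d + e)"
  proof (intro LP_sum)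
    fix i j
    show "(\<lambda>\<xi> x. (g i x * g' j x) * complex_of_real (\<xi> powi (d + e - int i - int j))) \<in> LP (d + e)"
      by (rule LP_mono[OF LP_monom]) (use g g' in \<open>auto intro: Cbar_mult\<close>)
  qed
  then show ?thesis
  proof (rule LP_cong)
    fix \<xi> x :: real assume \<xi>: "\<xi> \<ge> 1"
    have p: "\<xi> powi (d + e - int i - int j) = \<xi> powi (d - int i) * \<xi> powi (e - int j)" for i j
      using power_int_add[of \<xi> "d - int i" "e - int j"] \<xi> by (simp add: algebra_simps)
    show "f \<xi> x * h \<xi> x = (\<Sum>i\<le>N. \<Sum>j\<le>N'. (g i x * g' j x) * complex_of_real (\<xi> powi (d + e - int i - int j)))"
      unfolding g(2)[OF \<xi>] g'(2)[OF \<xi>] p sum_product by (intro sum.cong refl) (simp add: mult_ac)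
  qed
qed

text \<open>Derivatives in x act on the coefficients and do not raise the degree. Therefore each
  derivative falling on a coefficient is one order weaker than a factor \<xi>, on which all
  expansions below rest.\<close>

lemma LP_D1: assumes "f \<in> LP d" shows "(\<lambda>\<xi>. D1 (f \<xi>)) \<in> LP d"
proof -
  obtain N g where g: "\<forall>i. g i \<in> Cbar_infinity"
    "\<And>\<xi> x. \<xi> \<ge> 1 \<Longrightarrow> f \<xi> x = (\<Sum>i\<le>(N::nat). g i x * complex_of_real (\<xi> powi (d - int i)))"
    using assms(1) by (auto simp: LP_def)
  have "D1 (f \<xi>) x = (\<Sum>i\<le>N. D1 (g i) x * complex_of_real (\<xi> powi (d - int i)))" if "\<xi> \<ge> 1" for \<xi> x
  proof -
    have "f \<xi> = (\<lambda>x. \<Sum>i\<le>N. g i x * complex_of_real (\<xi> powi (d - int i)))" using g(2)[OF that] by auto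
    then show ?thesis using g(1) by (simp add: D1_sum smooth_mult Cbar_smooth D1_mult)
  qed
  then show ?thesis unfolding LP_def using g(1) Cbar_D1 by (auto intro!: exI[of _ N] exI[of _ "\<lambda>i. D1 (g i)"])
qed

lemma LP_Cbar: assumes "f \<in> LP d" "\<xi> \<ge> 1" shows "f \<xi> \<in> Cbar_infinity"
proof -
  obtain N g where g: "\<forall>i. g i \<in> Cbar_infinity"
    "\<And>\<xi> x. \<xi> \<ge> 1 \<Longrightarrow> f \<xi> x = (\<Sum>i\<le>(N::nat). g i x * complex_of_real (\<xi> powi (d - int i)))"
    using assms(1) by (auto simp: LP_def)
  have "f \<xi> = (\<lambda>x. \<Sum>i\<le>N. g i x * complex_of_real (\<xi> powi (d - int i)))" using g(2)[OF assms(2)] by auto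
  then show ?thesis using g(1) by (auto intro!: Cbar_sum Cbar_mult)
qed

lemma LP_bound: assumes "f \<in> LP d" shows "\<exists>C\<ge>0. \<forall>\<xi>\<ge>1. \<forall>x. cmod (f \<xi> x) \<le> C * \<xi> powi d"
proof -
  obtain N g where g: "\<forall>i. g i \<in> Cbar_infinity"
    "\<And>\<xi> x. \<xi> \<ge> 1 \<Longrightarrow> f \<xi> x = (\<Sum>i\<le>(N::nat). g i x * complex_of_real (\<xi> powi (d - int i)))"
    using assms(1) by (auto simp: LP_def)
  have "\<exists>C\<ge>0. \<forall>x. cmod (g i x) \<le> C" for i using Cbar_bound[of "g i"] g(1) by metis
  then obtain C where C: "\<And>i. C i \<ge> 0" "\<And>i x. cmod (g i x) \<le> C i" by metis
  have "cmod (f \<xi> x) \<le> (\<Sum>i\<le>N. C i) * \<xi> powi d" if \<xi>: "\<xi> \<ge> 1" for \<xi> x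
  proof -
    have "cmod (f \<xi> x) \<le> (\<Sum>i\<le>N. cmod (g i x * complex_of_real (\<xi> powi (d - int i))))"
      unfolding g(2)[OF \<xi>] by (rule norm_sum)
    also have "\<dots> \<le> (\<Sum>i\<le>N. C i * \<xi> powi d)"
    proof (rule sum_mono)
      fix i
      have "\<xi> powi (d - int i) \<le> \<xi> powi d" by (rule power_int_increasing) (use \<xi> in auto)
      moreover have n: "\<xi> powi (d - int i) \<ge> 0" using \<xi> by simp
      ultimately show "cmod (g i x * complex_of_real (\<xi> powi (d - int i))) \<le> C i * \<xi> powi d"
        unfolding norm_mult norm_of_real abs_of_nonneg[OF n] using C by (intro mult_mono) auto
    qed
    finally show ?thesis by (simp add: sum_distrib_right)
  qed
  then show ?thesis using C(1) by (intro exI[of _ "\<Sum>i\<le>N. C i"]) (auto intro: sum_nonneg)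
qed

lemma LP_powi: "(\<lambda>\<xi> x. complex_of_real (\<xi> powi d)) \<in> LP d"
  using LP_monom[of "\<lambda>x. 1" d] by simp

lemma LP_coeff: "g \<in> Cbar_infinity \<Longrightarrow> (\<lambda>\<xi> x. g x) \<in> LP 0"
  using LP_monom[of g 0] by simp

lemma LP_cmult: "f \<in> LP d \<Longrightarrow> (\<lambda>\<xi> x. c * f \<xi> x) \<in> LP d"
  using LP_mult[OF LP_coeff[OF Cbar_const[of c]], of f d] by simp

lemma LP_diff: "f \<in> LP d \<Longrightarrow> h \<in> LP d \<Longrightarrow> (\<lambda>\<xi> x. f \<xi> x - h \<xi> x) \<in> LP d"
  using LP_add[OF _ LP_cmult[of h d "-1"], of f] by simp

lemma LP_shift: "f \<in> LP d \<Longrightarrow> (\<lambda>\<xi> x. complex_of_real (\<xi> powi e) * f \<xi> x) \<in> LP (d + e)"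
  using LP_mult[OF LP_powi[of e], of f d] by (simp add: add.commute)

section \<open>Approximate exponential solutions\<close>

text \<open>With \<open>\<phi>' = \<xi> + \<psi>\<close> and \<open>P = D\<^sup>k + \<Sum>\<^sub>j q\<^sub>j D\<^sup>j\<close> these are \<open>e\<^bsup>-i\<phi>\<^esup> D\<^sup>j e\<^bsup>i\<phi>\<^esup>\<close> and
  \<open>e\<^bsup>-i\<phi>\<^esup> (P - \<xi>\<^sup>k) e\<^bsup>i\<phi>\<^esup>\<close>.\<close>

definition E :: "(real \<Rightarrow> real \<Rightarrow> complex) \<Rightarrow> nat \<Rightarrow> real \<Rightarrow> real \<Rightarrow> complex"
  where "E \<psi> j \<xi> = (tw (\<lambda>x. complex_of_real \<xi> + \<psi> \<xi> x) ^^ j) (\<lambda>x. 1)"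

definition Res :: "nat \<Rightarrow> (nat \<Rightarrow> real \<Rightarrow> complex) \<Rightarrow> (real \<Rightarrow> real \<Rightarrow> complex) \<Rightarrow> real \<Rightarrow> real \<Rightarrow> complex"
  where "Res k q \<psi> \<xi> x = E \<psi> k \<xi> x + (\<Sum>j\<le>k - 2. q j x * E \<psi> j \<xi> x) - complex_of_real (\<xi> ^ k)"

lemma E_0: "E \<psi> 0 \<xi> = (\<lambda>x. 1)" by (simp add: E_def)

lemma E_Suc: "E \<psi> (Suc j) \<xi> x = D1 (E \<psi> j \<xi>) x + (complex_of_real \<xi> + \<psi> \<xi> x) * E \<psi> j \<xi> x"
  by (simp add: E_def tw_def)

lemma LP_smooth: "f \<in> LP d \<Longrightarrow> \<xi> \<ge> 1 \<Longrightarrow> smooth (f \<xi>)"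
  using LP_Cbar Cbar_smooth by blast

lemma smooth_E: "\<psi> \<in> LP d \<Longrightarrow> \<xi> \<ge> 1 \<Longrightarrow> smooth (E \<psi> j \<xi>)"
  unfolding E_def by (intro smooth_tw_pow smooth_add smooth_const LP_smooth)

lemma LP_xi: "f \<in> LP d \<Longrightarrow> (\<lambda>\<xi> x. complex_of_real \<xi> * f \<xi> x) \<in> LP (d + 1)"
  using LP_shift[of f d 1] by simp

lemma LP_xi_pow: "(\<lambda>\<xi> x. complex_of_real (\<xi> ^ j)) \<in> LP (int j)"
  using LP_powi[of "int j"] by (simp add: power_int_of_nat)

text \<open>The error is two orders down, not one: \<open>\<psi>\<close> has order -1, and the
  leading term \<open>\<xi> ^ j\<close> is constant in x, so its derivative disappears in the
  recursion.\<close>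

lemma E_asymptotics:
  assumes \<psi>: "\<psi> \<in> LP (-1)"
  shows "(\<lambda>\<xi> x. E \<psi> j \<xi> x - complex_of_real (\<xi> ^ j)) \<in> LP (int j - 2)" and "E \<psi> j \<in> LP (int j)"
proof -
  have 2: "E \<psi> j \<in> LP (int j)" if "(\<lambda>\<xi> x. E \<psi> j \<xi> x - complex_of_real (\<xi> ^ j)) \<in> LP (int j - 2)" for j
    using LP_add[OF LP_mono[OF that, of "int j"] LP_xi_pow[of j]] by simp
  show 1: "(\<lambda>\<xi> x. E \<psi> j \<xi> x - complex_of_real (\<xi> ^ j)) \<in> LP (int j - 2)"
  proof (induction j)
    case 0 show ?case by (simp add: E_0 LP_zero)
  next
    case (Suc j)
    let ?f = "\<lambda>\<xi> x. E \<psi> j \<xi> x - complex_of_real (\<xi> ^ j)"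
    have a: "(\<lambda>\<xi>. D1 (?f \<xi>)) \<in> LP (int (Suc j) - 2)"
      by (rule LP_mono[OF LP_D1[OF Suc]]) simp
    have b: "(\<lambda>\<xi> x. complex_of_real \<xi> * ?f \<xi> x) \<in> LP (int (Suc j) - 2)"
      using LP_xi[OF Suc] by (simp add: algebra_simps)
    have c: "(\<lambda>\<xi> x. \<psi> \<xi> x * E \<psi> j \<xi> x) \<in> LP (int (Suc j) - 2)"
      using LP_mult[OF \<psi> 2[OF Suc]] by (simp add: algebra_simps)
    show ?case
    proof (rule LP_cong[OF LP_add[OF LP_add[OF a b] c]])
      fix \<xi> x :: real assume \<xi>: "\<xi> \<ge> 1"
      have "D1 (?f \<xi>) = D1 (\<lambda>x. E \<psi> j \<xi> x + (- complex_of_real (\<xi> ^ j)))" by simp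
      also have "\<dots> = D1 (E \<psi> j \<xi>)" 
        using D1_add[OF smooth_E[OF \<psi> \<xi>] smooth_const[of "- complex_of_real (\<xi> ^ j)"]]
        by (simp only: D1_const add_0_right)
      finally show "E \<psi> (Suc j) \<xi> x - complex_of_real (\<xi> ^ Suc j) = D1 (?f \<xi>) x + complex_of_real \<xi> * ?f \<xi> x + \<psi> \<xi> x * E \<psi> j \<xi> x"
        by (simp add: E_Suc algebra_simps)
    qed
  qed
  show "E \<psi> j \<in> LP (int j)" by (rule 2[OF 1])
qed

text \<open>The leading term is the linearization of the j-th power,
  \<open>j \<xi>\<^sup>j\<^sup>-\<^sup>1\<close> times the change of phase derivative. Every other
  term of the recursion in \<open>E_Suc\<close> is at least one order lower.\<close>

lemma E_difference:
  assumes \<psi>: "\<psi> \<in> LP (-1)" and \<psi>': "\<psi>' \<in> LP (-1)" and \<delta>: "(\<lambda>\<xi> x. \<psi> \<xi> x - \<psi>' \<xi> x) \<in> LP (- p)"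
  shows "(\<lambda>\<xi> x. E \<psi> j \<xi> x - E \<psi>' j \<xi> x - of_nat j * (complex_of_real (\<xi> powi (int j - 1)) * (\<psi> \<xi> x - \<psi>' \<xi> x)))
      \<in> LP (int j - p - 2)" (is "?r j \<in> _")
    and "(\<lambda>\<xi> x. E \<psi> j \<xi> x - E \<psi>' j \<xi> x) \<in> LP (int j - 1 - p)" (is "?d j \<in> _")
proof -
  let ?\<delta> = "\<lambda>\<xi> x. \<psi> \<xi> x - \<psi>' \<xi> x"
  have 2: "?d j \<in> LP (int j - 1 - p)" if "?r j \<in> LP (int j - p - 2)" for j
  proof -
    have "(\<lambda>\<xi> x. of_nat j * (complex_of_real (\<xi> powi (int j - 1)) * ?\<delta> \<xi> x)) \<in> LP (int j - 1 - p)"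
      using LP_cmult[OF LP_shift[OF \<delta>, of "int j - 1"], of "of_nat j"] by (simp add: algebra_simps)
    from LP_add[OF LP_mono[OF that] this] show ?thesis by simp
  qed
  show 1: "?r j \<in> LP (int j - p - 2)"
  proof (induction j)
    case 0 show ?case by (simp add: E_0 LP_zero)
  next
    case (Suc j)
    have a: "(\<lambda>\<xi>. D1 (?d j \<xi>)) \<in> LP (int (Suc j) - p - 2)"
      by (rule LP_mono[OF LP_D1[OF 2[OF Suc]]]) simp
    have b: "(\<lambda>\<xi> x. complex_of_real \<xi> * ?r j \<xi> x) \<in> LP (int (Suc j) - p - 2)"
      using LP_xi[OF Suc] by (simp add: algebra_simps)
    have c: "(\<lambda>\<xi> x. \<psi>' \<xi> x * ?d j \<xi> x) \<in> LP (int (Suc j) - p - 2)"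
      by (rule LP_mono[OF LP_mult[OF \<psi>' 2[OF Suc]]]) simp
    have d: "(\<lambda>\<xi> x. ?\<delta> \<xi> x * (E \<psi> j \<xi> x - complex_of_real (\<xi> ^ j))) \<in> LP (int (Suc j) - p - 2)"
      by (rule LP_mono[OF LP_mult[OF \<delta> E_asymptotics(1)[OF \<psi>]]]) simp
    show ?case
    proof (rule LP_cong[OF LP_add[OF LP_add[OF LP_add[OF a b] c] d]])
      fix \<xi> x :: real assume \<xi>: "\<xi> \<ge> 1"
      have "D1 (?d j \<xi>) = D1 (\<lambda>x. E \<psi> j \<xi> x + (-1) * E \<psi>' j \<xi> x)" by simp
      also have "\<dots> = (\<lambda>x. D1 (E \<psi> j \<xi>) x + (-1) * D1 (E \<psi>' j \<xi>) x)"
        using D1_add[OF smooth_E[OF \<psi> \<xi>] smooth_mult[OF smooth_const smooth_E[OF \<psi>' \<xi>]], of j "-1" j]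
        by (simp only: D1_cmult[OF smooth_E[OF \<psi>' \<xi>]])
      finally have D: "D1 (?d j \<xi>) x = D1 (E \<psi> j \<xi>) x - D1 (E \<psi>' j \<xi>) x" by simp
      have p: "complex_of_real (\<xi> powi (int (Suc j) - 1)) = complex_of_real (\<xi> ^ j)" by (simp add: power_int_of_nat)
      have p': "complex_of_real \<xi> * (of_nat j * (complex_of_real (\<xi> powi (int j - 1)) * z)) = of_nat j * (complex_of_real (\<xi> ^ j) * z)" for z
      proof (cases j)
        case (Suc i)
        have "\<xi> powi (int j - 1) = \<xi> ^ i" by (simp add: Suc power_int_of_nat)
        then show ?thesis by (simp add: Suc mult_ac)
      qed simp
      show "?r (Suc j) \<xi> x = D1 (?d j \<xi>) x + complex_of_real \<xi> * ?r j \<xi> x + \<psi>' \<xi> x * ?d j \<xi> x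
          + ?\<delta> \<xi> x * (E \<psi> j \<xi> x - complex_of_real (\<xi> ^ j))"
        unfolding D p E_Suc right_diff_distrib[of "complex_of_real \<xi>"] p' by (simp add: algebra_simps)
    qed
  qed
  show "?d j \<in> LP (int j - 1 - p)" by (rule 2[OF 1])
qed

text \<open>The terms with j at most k-2 contribute order k-3-p at most, so the leading change of
  the residual comes from \<open>D1 ^^ k\<close> alone and can be inverted by division.\<close>

lemma Res_difference:
  assumes k: "k \<ge> 2" and q: "\<And>j. j \<le> k - 2 \<Longrightarrow> q j \<in> Cbar_infinity"
    and \<psi>: "\<psi> \<in> LP (-1)" "\<psi>' \<in> LP (-1)" "(\<lambda>\<xi> x. \<psi> \<xi> x - \<psi>' \<xi> x) \<in> LP (- p)"
  shows "(\<lambda>\<xi> x. Res k q \<psi> \<xi> x - Res k q \<psi>' \<xi> x - of_nat k * (complex_of_real (\<xi> powi (int k - 1)) * (\<psi> \<xi> x - \<psi>' \<xi> x)))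
    \<in> LP (int k - 2 - p)"
proof -
  have 1: "(\<lambda>\<xi> x. E \<psi> k \<xi> x - E \<psi>' k \<xi> x - of_nat k * (complex_of_real (\<xi> powi (int k - 1)) * (\<psi> \<xi> x - \<psi>' \<xi> x)))
      \<in> LP (int k - 2 - p)"
    using E_difference(1)[OF \<psi>, of k] by (simp add: algebra_simps)
  have 2: "(\<lambda>\<xi> x. \<Sum>j\<le>k - 2. q j x * (E \<psi> j \<xi> x - E \<psi>' j \<xi> x)) \<in> LP (int k - 2 - p)"
  proof (rule LP_sum)
    fix j assume "j \<in> {..k - 2}"
    then have j: "j \<le> k - 2" by simp
    show "(\<lambda>\<xi> x. q j x * (E \<psi> j \<xi> x - E \<psi>' j \<xi> x)) \<in> LP (int k - 2 - p)"
      by (rule LP_mono[OF LP_mult[OF LP_coeff[OF q[OF j]] E_difference(2)[OF \<psi>]]]) (use j k in linarith)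
  qed
  show ?thesis
    by (rule LP_cong[OF LP_add[OF 1 2]]) (simp add: Res_def right_diff_distrib sum_subtractf)
qed

lemma E_zero_phase: "E (\<lambda>\<xi> x. 0) j \<xi> = (\<lambda>x. complex_of_real (\<xi> ^ j))"
  using tw_const_pow[where \<eta> = "complex_of_real \<xi>" and j = j] by (simp add: E_def)

text \<open>A Newton step with the leading linearization: correcting \<open>\<psi>\<close> by minus
  the residual over \<open>k \<xi>\<^sup>k\<^sup>-\<^sup>1\<close> cancels the residual to leading
  order. Each step gains one power, starting from order k-2 at \<open>\<psi> = 0\<close>.\<close>

lemma WKB_iteration:
  assumes k: "k \<ge> 2" and q: "\<And>j. j \<le> k - 2 \<Longrightarrow> q j \<in> Cbar_infinity"
  shows "\<exists>\<psi>\<in>LP (-1). Res k q \<psi> \<in> LP (int k - 2 - int i)"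
proof (induction i)
  case 0
  have "(\<lambda>\<xi> x. \<Sum>j\<le>k - 2. q j x * complex_of_real (\<xi> ^ j)) \<in> LP (int k - 2)"
  proof (rule LP_sum)
    fix j assume "j \<in> {..k - 2}"
    then have j: "j \<le> k - 2" by simp
    show "(\<lambda>\<xi> x. q j x * complex_of_real (\<xi> ^ j)) \<in> LP (int k - 2)"
      by (rule LP_mono[OF LP_mult[OF LP_coeff[OF q[OF j]] LP_xi_pow]]) (use j k in linarith)
  qed
  then have "Res k q (\<lambda>\<xi> x. 0) \<in> LP (int k - 2)"
    by (rule LP_cong) (simp add: Res_def E_zero_phase)
  then show ?case using LP_zero[of "-1"] by (intro bexI[of _ "\<lambda>\<xi> x. 0"]) auto
next
  case (Suc i)
  then obtain \<psi> where \<psi>: "\<psi> \<in> LP (-1)" "Res k q \<psi> \<in> LP (int k - 2 - int i)" by blast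
  define \<delta> where "\<delta> \<xi> x = - (1 / of_nat k) * (complex_of_real (\<xi> powi (1 - int k)) * Res k q \<psi> \<xi> x)" for \<xi> x
  have \<delta>: "\<delta> \<in> LP (- (int i + 1))"
    unfolding \<delta>_def using LP_cmult[OF LP_shift[OF \<psi>(2), of "1 - int k"], of "- (1 / of_nat k)"] by (simp add: algebra_simps)
  define \<psi>' where "\<psi>' \<xi> x = \<psi> \<xi> x + \<delta> \<xi> x" for \<xi> x
  have \<psi>': "\<psi>' \<in> LP (-1)" unfolding \<psi>'_def by (intro LP_add \<psi> LP_mono[OF \<delta>]) simp
  have d: "(\<lambda>\<xi> x. \<psi>' \<xi> x - \<psi> \<xi> x) \<in> LP (- (int i + 1))" using \<delta> by (simp add: \<psi>'_def)
  have "Res k q \<psi>' \<in> LP (int k - 2 - (int i + 1))"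
  proof (rule LP_cong[OF Res_difference[OF k q \<psi>' \<psi>(1) d]])
    fix \<xi> x :: real assume \<xi>: "\<xi> \<ge> 1"
    have "complex_of_real (\<xi> powi (int k - 1)) * complex_of_real (\<xi> powi (1 - int k)) = 1"
      unfolding of_real_mult[symmetric] using power_int_add[of \<xi> "int k - 1" "1 - int k"] \<xi> by simp
    then have "of_nat k * (complex_of_real (\<xi> powi (int k - 1)) * (\<psi>' \<xi> x - \<psi> \<xi> x)) = - Res k q \<psi> \<xi> x"
      using k by (simp add: \<psi>'_def \<delta>_def field_simps)
    then show "Res k q \<psi>' \<xi> x = Res k q \<psi>' \<xi> x - Res k q \<psi> \<xi> x - of_nat k * (complex_of_real (\<xi> powi (int k - 1)) * (\<psi>' \<xi> x - \<psi> \<xi> x))"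
      by simp
  qed auto
  then show ?case using \<psi>' by (intro bexI[of _ \<psi>']) (simp_all add: algebra_simps)
qed

lemma WKB_exists:
  assumes k: "k \<ge> 2" and q: "\<And>j. j \<le> k - 2 \<Longrightarrow> q j \<in> Cbar_infinity"
  shows "\<exists>\<psi>\<in>LP (-1). Res k q \<psi> \<in> LP 0"
  using WKB_iteration[of k q "k - 2"] k q by (simp add: of_nat_diff)

text \<open>Subtracting the two residual equations expresses \<open>k \<xi>\<^sup>k\<^sup>-\<^sup>1
  \<delta> + b\<^sub>m \<xi>\<^sup>m\<close> through terms that depend on the size already known for
  \<open>\<delta> = \<psi> - \<psi>0\<close>. This is bootstrapped from order -1 downwards.\<close>

lemma WKB_compare:
  assumes k: "k \<ge> 3" and m: "1 \<le> m" "m \<le> k - 2"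
    and a: "\<And>j. j \<le> k - 2 \<Longrightarrow> a j \<in> Cbar_infinity" and b: "\<And>j. j \<le> m \<Longrightarrow> b j \<in> Cbar_infinity"
    and \<psi>: "\<psi> \<in> LP (-1)" "Res k (\<lambda>j x. a j x + (if j \<le> m then b j x else 0)) \<psi> \<in> LP 0"
    and \<psi>0: "\<psi>0 \<in> LP (-1)" "Res k a \<psi>0 \<in> LP 0"
  shows "(\<lambda>\<xi> x. \<psi> \<xi> x - \<psi>0 \<xi> x + b m x / of_nat k * complex_of_real (\<xi> powi (int m - int k + 1))) \<in> LP (int m - int k)"
proof -
  let ?q = "\<lambda>j x. a j x + (if j \<le> m then b j x else 0)"
  let ?\<delta> = "\<lambda>\<xi> x. \<psi> \<xi> x - \<psi>0 \<xi> x"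
  have km: "int m + 2 \<le> int k" using m k by linarith
  have sumb: "(\<lambda>\<xi> x. (\<Sum>j\<le>m. b j x * E \<psi> j \<xi> x) - b m x * complex_of_real (\<xi> ^ m)) \<in> LP (int m - 1)"
  proof -
    obtain m' where m': "m = Suc m'" using m(1) by (cases m) auto
    have 1: "(\<lambda>\<xi> x. \<Sum>j\<le>m'. b j x * E \<psi> j \<xi> x) \<in> LP (int m - 1)"
    proof (rule LP_sum)
      fix j assume "j \<in> {..m'}"
      then have j: "j \<le> m'" by simp
      then show "(\<lambda>\<xi> x. b j x * E \<psi> j \<xi> x) \<in> LP (int m - 1)"
        by (intro LP_mono[OF LP_mult[OF LP_coeff[OF b] E_asymptotics(2)[OF \<psi>(1)]]]) (use m' in auto)
    qed
    have 2: "(\<lambda>\<xi> x. b m x * (E \<psi> m \<xi> x - complex_of_real (\<xi> ^ m))) \<in> LP (int m - 1)"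
      by (rule LP_mono[OF LP_mult[OF LP_coeff[OF b[OF order_refl]] E_asymptotics(1)[OF \<psi>(1)]]]) simp
    show ?thesis by (rule LP_cong[OF LP_add[OF 1 2]]) (simp add: m' algebra_simps)
  qed
  have Rq: "Res k ?q \<psi> \<xi> x = Res k a \<psi> \<xi> x + (\<Sum>j\<le>m. b j x * E \<psi> j \<xi> x)" for \<xi> x
  proof -
    have "(\<Sum>j\<le>k - 2. ?q j x * E \<psi> j \<xi> x) = (\<Sum>j\<le>k - 2. a j x * E \<psi> j \<xi> x) + (\<Sum>j\<le>k - 2. if j \<le> m then b j x * E \<psi> j \<xi> x else 0)"
      unfolding sum.distrib[symmetric] by (intro sum.cong refl) (simp add: distrib_right)
    then show ?thesis by (simp add: Res_def sum_atMost_restrict[OF m(2)])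
  qed
  \<comment> \<open>In the maximum, m-1 comes from the lower b-terms and from corrections to
    \<open>E \<psi> m\<close>, and k-2-p from the linearization error. At p = k-1-m they coincide
    and give the asserted order m-k.\<close>
  have step: "(\<lambda>\<xi> x. ?\<delta> \<xi> x + b m x / of_nat k * complex_of_real (\<xi> powi (int m - int k + 1))) \<in> LP (max (int m - 1) (int k - 2 - p) - int k + 1)"
    if p: "?\<delta> \<in> LP (- p)" for p
  proof -
    let ?M = "max (int m - 1) (int k - 2 - p)"
    have k2: "k \<ge> 2" using k by simp
    note D = Res_difference[OF k2 a \<psi>(1) \<psi>0(1) p]
    have "(\<lambda>\<xi> x. Res k ?q \<psi> \<xi> x - ((\<Sum>j\<le>m. b j x * E \<psi> j \<xi> x) - b m x * complex_of_real (\<xi> ^ m)) - Res k a \<psi>0 \<xi> x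
        - (Res k a \<psi> \<xi> x - Res k a \<psi>0 \<xi> x - of_nat k * (complex_of_real (\<xi> powi (int k - 1)) * ?\<delta> \<xi> x))) \<in> LP ?M"
      by (intro LP_diff LP_mono[OF \<psi>(2)] LP_mono[OF \<psi>0(2)] LP_mono[OF sumb] LP_mono[OF D]) (use m in auto)
    then have "(\<lambda>\<xi> x. b m x * complex_of_real (\<xi> ^ m) + of_nat k * (complex_of_real (\<xi> powi (int k - 1)) * ?\<delta> \<xi> x)) \<in> LP ?M"
      by (rule LP_cong) (simp add: Rq algebra_simps)
    then have "(\<lambda>\<xi> x. 1 / of_nat k * (complex_of_real (\<xi> powi (1 - int k)) * (b m x * complex_of_real (\<xi> ^ m) + of_nat k * (complex_of_real (\<xi> powi (int k - 1)) * ?\<delta> \<xi> x)))) \<in> LP (?M + (1 - int k))"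
      by (intro LP_cmult LP_shift)
    then have "(\<lambda>\<xi> x. ?\<delta> \<xi> x + b m x / of_nat k * complex_of_real (\<xi> powi (int m - int k + 1))) \<in> LP (?M + (1 - int k))"
    proof (rule LP_cong)
      fix \<xi> x :: real assume \<xi>: "\<xi> \<ge> 1"
      have p1: "complex_of_real (\<xi> powi (1 - int k)) * complex_of_real (\<xi> powi (int k - 1)) = 1"
        unfolding of_real_mult[symmetric] using power_int_add[of \<xi> "1 - int k" "int k - 1"] \<xi> by simp
      have p2: "complex_of_real (\<xi> powi (1 - int k)) * complex_of_real (\<xi> ^ m) = complex_of_real (\<xi> powi (int m - int k + 1))"
        unfolding of_real_mult[symmetric] using power_int_add[of \<xi> "1 - int k" "int m"] \<xi>
        by (simp add: algebra_simps)
      have "1 / of_nat k * (complex_of_real (\<xi> powi (1 - int k)) * (b m x * complex_of_real (\<xi> ^ m) + of_nat k * (complex_of_real (\<xi> powi (int k - 1)) * ?\<delta> \<xi> x)))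
          = b m x / of_nat k * (complex_of_real (\<xi> powi (1 - int k)) * complex_of_real (\<xi> ^ m))
            + of_nat k / of_nat k * (complex_of_real (\<xi> powi (1 - int k)) * complex_of_real (\<xi> powi (int k - 1))) * ?\<delta> \<xi> x"
        by (simp add: distrib_left)
      then show "?\<delta> \<xi> x + b m x / of_nat k * complex_of_real (\<xi> powi (int m - int k + 1))
          = 1 / of_nat k * (complex_of_real (\<xi> powi (1 - int k)) * (b m x * complex_of_real (\<xi> ^ m) + of_nat k * (complex_of_real (\<xi> powi (int k - 1)) * ?\<delta> \<xi> x)))"
        unfolding p1 p2 using k by simp
    qed
    then show ?thesis by (simp add: algebra_simps)
  qed
  \<comment> \<open>The bootstrap gains one order per round and stops at p = k-1-m, where
    \<open>\<delta>\<close> has reached the order of the \<open>b m\<close> term itself.\<close>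
  have "int p \<le> int k - 1 - int m \<Longrightarrow> 1 \<le> p \<Longrightarrow> ?\<delta> \<in> LP (- int p)" for p
  proof (induction p)
    case (Suc p)
    show ?case
    proof (cases "p = 0")
      case True
      then show ?thesis using LP_diff[OF \<psi>(1) \<psi>0(1)] by simp
    next
      case False
      then have "?\<delta> \<in> LP (- int p)" using Suc by simp
      from step[OF this] have 1: "(\<lambda>\<xi> x. ?\<delta> \<xi> x + b m x / of_nat k * complex_of_real (\<xi> powi (int m - int k + 1))) \<in> LP (- int (Suc p))"
        by (rule LP_mono) (use Suc in auto)
      have "(\<lambda>x. b m x / of_nat k) \<in> Cbar_infinity"
        using Cbar_cmult[OF b[OF order_refl], of "1 / of_nat k"] by simp
      from LP_monom[OF this] have 2: "(\<lambda>\<xi> x. b m x / of_nat k * complex_of_real (\<xi> powi (int m - int k + 1))) \<in> LP (- int (Suc p))"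
        by (rule LP_mono) (use Suc in auto)
      from LP_diff[OF 1 2] show ?thesis by simp
    qed
  qed simp
  moreover have "int (k - 1 - m) = int k - 1 - int m" "1 \<le> k - 1 - m" using km by linarith+
  ultimately have "?\<delta> \<in> LP (- (int k - 1 - int m))" by (metis order_refl)
  from step[OF this] show ?thesis by (simp add: algebra_simps)
qed

section \<open>Wave packets\<close>

lemma D1_pow_rescale:
  assumes f: "smooth f"
  shows "(D1 ^^ l) (\<lambda>X. f (b + X / w)) = (\<lambda>X. complex_of_real (1 / w) ^ l * (D1 ^^ l) f (b + X / w))"
proof (induction l)
  case (Suc l)
  have one: "D1 (\<lambda>X. g (b + X / w)) = (\<lambda>X. complex_of_real (1 / w) * D1 g (b + X / w))" if g: "smooth g" for g
  proof
    fix X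
    have "dir_deriv 1 (\<lambda>X. g (b + X / w)) X = dir_deriv (1 / w) g (b + X / w)"
      by (simp only: dir_deriv_affine[OF g bounded_linear_divide])
    also have "\<dots> = (1 / w) *\<^sub>R dir_deriv 1 g (b + X / w)"
      by (rule dir_deriv_vector_derivative[OF smooth_vd[OF g]])
    finally show "D1 (\<lambda>X. g (b + X / w)) X = complex_of_real (1 / w) * D1 g (b + X / w)"
      by (simp add: D1_def scaleR_conv_of_real mult.left_commute)
  qed
  have s: "smooth (\<lambda>X. (D1 ^^ l) f (b + X / w))"
    by (rule smooth_affine[OF smooth_D1_pow[OF f] bounded_linear_divide])
  have "(D1 ^^ Suc l) (\<lambda>X. f (b + X / w)) = D1 (\<lambda>X. complex_of_real (1 / w) ^ l * (D1 ^^ l) f (b + X / w))"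
    by (simp add: Suc)
  also have "\<dots> = (\<lambda>X. complex_of_real (1 / w) ^ l * (complex_of_real (1 / w) * D1 ((D1 ^^ l) f) (b + X / w)))"
    unfolding D1_cmult[OF s] one[OF smooth_D1_pow[OF f]] ..
  finally show ?case by (simp add: mult.commute mult.left_commute)
qed simp

text \<open>The cutoff of the packets: \<open>\<kappa>\<close> yields the lower bound for the norm
  on arrival, while \<open>B\<close> controls the initial norm and the derivatives entering the
  defect.\<close>

lemma profile_exists:
  obtains pr :: "real \<Rightarrow> complex" and \<kappa> B :: real where "pr \<in> ccs" "\<kappa> > 0" "B > 0"
    "\<And>s. \<bar>s\<bar> \<le> 1 / 2 \<Longrightarrow> cmod (pr s) \<ge> \<kappa>"
    "\<And>l s. l \<le> k \<Longrightarrow> cmod ((D1 ^^ l) pr s) \<le> B" "\<And>l s. \<bar>s\<bar> > 1 \<Longrightarrow> (D1 ^^ l) pr s = 0"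
proof -
  obtain r :: "real \<Rightarrow> real" where r: "smooth (\<lambda>x. complex_of_real (r x))"
    "\<And>x. r x \<ge> 0" "\<And>x. \<bar>x\<bar> < 1 \<Longrightarrow> r x > 0" "\<And>x. \<bar>x\<bar> \<ge> 1 \<Longrightarrow> r x = 0"
    using bump_exists by blast
  define pr where "pr x = complex_of_real (r x)" for x
  have pr: "pr \<in> ccs" by (rule ccsI[of _ 1]) (use r in \<open>auto simp: pr_def[abs_def]\<close>)
  have "continuous_on {-1/2..1/2::real} (\<lambda>s. cmod (pr s))"
    by (intro continuous_intros smooth_continuous ccs_smooth pr)
  then obtain s0 where s0: "s0 \<in> {-1/2..1/2::real}" "\<And>s. s \<in> {-1/2..1/2} \<Longrightarrow> cmod (pr s0) \<le> cmod (pr s)"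
    using continuous_attains_inf[of "{-1/2..1/2::real}" "\<lambda>s. cmod (pr s)"] by auto
  have "r s0 > 0" by (rule r(3)) (use s0(1) in auto)
  then have \<kappa>: "cmod (pr s0) > 0" by (simp add: pr_def)
  have "\<exists>B. \<forall>s. cmod ((D1 ^^ l) pr s) \<le> B" for l
    using ccs_bounded[OF ccs_D1_pow[OF pr, of l]] by (auto simp: bounded_iff)
  then obtain b where b: "\<And>l s. cmod ((D1 ^^ l) pr s) \<le> b l" by metis
  have b0: "b l \<ge> 0" for l using b norm_ge_zero order_trans by blast
  have z: "(D1 ^^ l) pr s = 0" if "\<bar>s\<bar> > 1" for l s
  proof -
    have "\<forall>s. \<bar>s\<bar> > 1 \<longrightarrow> (D1 ^^ l) pr s = 0"
    proof (induction l)
      case 0 show ?case using r(4) by (simp add: pr_def)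
    next
      case (Suc l)
      show ?case
      proof (intro allI impI)
        fix s :: real assume s: "\<bar>s\<bar> > 1"
        have "((D1 ^^ l) pr has_vector_derivative 0) (at s)"
          by (rule has_vector_derivative_transform_within_open[where f = "\<lambda>x. 0" and S = "{x. \<bar>x\<bar> > 1}"])
            (use s Suc in \<open>auto intro!: open_Collect_less continuous_intros\<close>)
        then show "(D1 ^^ Suc l) pr s = 0" using D1_eqI by fastforce
      qed
    qed
    then show ?thesis using that by blast
  qed
  show ?thesis
  proof (rule that[OF pr \<kappa>, of "(\<Sum>l\<le>k. b l) + 1"])
    show "(\<Sum>l\<le>k. b l) + 1 > 0" using b0 by (simp add: add_nonneg_pos sum_nonneg)
    show "cmod (pr s0) \<le> cmod (pr s)" if "\<bar>s\<bar> \<le> 1 / 2" for s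
      by (rule s0(2)) (use that in \<open>auto simp: abs_le_iff\<close>)
    show "cmod ((D1 ^^ l) pr s) \<le> (\<Sum>l\<le>k. b l) + 1" if "l \<le> k" for l s
    proof -
      have "b l \<le> (\<Sum>l\<le>k. b l)" by (rule member_le_sum) (use that b0 in auto)
      then show ?thesis using b[of l s] by linarith
    qed
  qed (use z in auto)
qed

text \<open>\<open>c\<close> and \<open>q\<close> describe the same operator, \<open>q\<close> being
  the part below \<open>D1 ^^ k\<close>; the full phase is
  \<open>\<xi> * x + \<Gamma> \<xi> x\<close>. The locale is used once for P and once for the
  unperturbed operator.\<close>

locale wkb =
  fixes k :: nat and q :: "nat \<Rightarrow> real \<Rightarrow> complex" and c :: "nat \<Rightarrow> real \<Rightarrow> complex" and M :: real
    and \<psi> \<Gamma> :: "real \<Rightarrow> real \<Rightarrow> complex"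
  assumes k: "k \<ge> 3" and q: "\<And>j. j \<le> k - 2 \<Longrightarrow> q j \<in> Cbar_infinity"
    and c: "\<And>f x. diff_op k c f x = (D1 ^^ k) f x + diff_op (k - 2) q f x"
    and energy: "energy_bound k c M"
    and \<psi>: "\<psi> \<in> LP (-1)" and res: "Res k q \<psi> \<in> LP 0"
    and \<Gamma>: "\<And>\<xi> x. \<xi> \<ge> 1 \<Longrightarrow> (\<Gamma> \<xi> has_vector_derivative \<psi> \<xi> x) (at x)"
begin

text \<open>The logarithm of the modulus of the exponential solution at frequency \<xi>.\<close>

definition h where "h \<xi> x = - Im (\<Gamma> \<xi> x)"

text \<open>The coefficient of \<open>D1 ^^ l\<close> in the conjugated operator after removal of
  the constant \<open>\<xi> ^ k\<close> and of the transport term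
  \<open>k \<xi>\<^sup>k\<^sup>-\<^sup>1 D\<close>; the packet is built to solve these two
  exactly.\<close>

definition A where "A l \<xi> x = of_nat (k choose l) * E \<psi> (k - l) \<xi> x
  + (\<Sum>j\<le>k - 2. of_nat (j choose l) * (q j x * E \<psi> (j - l) \<xi> x))
  - (if l = 0 then complex_of_real (\<xi> ^ k) else 0)
  - (if l = 1 then of_nat k * complex_of_real (\<xi> ^ (k - 1)) else 0)"

text \<open>\<open>A 0\<close> is the residual, of order 0. For l = 1 the leading power has been
  removed and the error is two orders down by \<open>E_asymptotics\<close>; for larger l the order
  is at most k-l.\<close>

lemma A_LP: "A l \<in> LP (if l = 0 then 0 else int (k - 2))"
proof (cases "l = 0")
  case True
  have "A 0 = Res k q \<psi>" by (auto simp: fun_eq_iff A_def Res_def)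
  then show ?thesis using res True by simp
next
  case False
  have 1: "(\<lambda>\<xi> x. \<Sum>j\<le>k - 2. of_nat (j choose l) * (q j x * E \<psi> (j - l) \<xi> x)) \<in> LP (int (k - 2))"
  proof (rule LP_sum)
    fix j assume "j \<in> {..k - 2}"
    then have j: "j \<le> k - 2" by simp
    show "(\<lambda>\<xi> x. of_nat (j choose l) * (q j x * E \<psi> (j - l) \<xi> x)) \<in> LP (int (k - 2))"
      by (rule LP_cmult, rule LP_mono[OF LP_mult[OF LP_coeff[OF q[OF j]] E_asymptotics(2)[OF \<psi>]]]) (use j in simp)
  qed
  have 2: "(\<lambda>\<xi> x. of_nat (k choose l) * E \<psi> (k - l) \<xi> x - (if l = 1 then of_nat k * complex_of_real (\<xi> ^ (k - 1)) else 0)) \<in> LP (int (k - 2))"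
  proof (cases "l = 1")
    case True
    have "(\<lambda>\<xi> x. of_nat k * (E \<psi> (k - 1) \<xi> x - complex_of_real (\<xi> ^ (k - 1)))) \<in> LP (int (k - 2))"
      by (rule LP_cmult, rule LP_mono[OF E_asymptotics(1)[OF \<psi>]]) simp
    then show ?thesis by (rule LP_cong) (simp add: True right_diff_distrib)
  next
    case l1: False
    have "(\<lambda>\<xi> x. of_nat (k choose l) * E \<psi> (k - l) \<xi> x) \<in> LP (int (k - 2))"
      by (rule LP_cmult, rule LP_mono[OF E_asymptotics(2)[OF \<psi>]]) (use l1 False in simp)
    then show ?thesis using l1 by simp
  qed
  have "A l \<in> LP (int (k - 2))"
    by (rule LP_cong[OF LP_add[OF 2 1]]) (use False in \<open>simp add: A_def\<close>)
  then show ?thesis using False by simp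
qed

lemma A_bound: "\<exists>C\<ge>0. \<forall>l\<le>k. \<forall>\<xi>\<ge>1. \<forall>x. cmod (A l \<xi> x) \<le> C * (if l = 0 then 1 else \<xi> ^ (k - 2))"
proof -
  have "\<exists>C\<ge>0. \<forall>\<xi>\<ge>1. \<forall>x. cmod (A l \<xi> x) \<le> C * (if l = 0 then 1 else \<xi> ^ (k - 2))" for l
    using LP_bound[OF A_LP[of l]] by (cases "l = 0") (simp_all add: power_int_of_nat)
  then obtain C where C: "\<And>l. l \<le> k \<Longrightarrow> C l \<ge> 0" "\<And>l \<xi> x. l \<le> k \<Longrightarrow> \<xi> \<ge> 1 \<Longrightarrow> cmod (A l \<xi> x) \<le> C l * (if l = 0 then 1 else \<xi> ^ (k - 2))"
    by metis
  have "cmod (A l \<xi> x) \<le> (\<Sum>l\<le>k. C l) * (if l = 0 then 1 else \<xi> ^ (k - 2))" if "l \<le> k" "\<xi> \<ge> 1" for l \<xi> x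
  proof -
    have "C l \<le> (\<Sum>l\<le>k. C l)" by (rule member_le_sum) (use that C in auto)
    then have "C l * (if l = 0 then 1 else \<xi> ^ (k - 2)) \<le> (\<Sum>l\<le>k. C l) * (if l = 0 then 1 else \<xi> ^ (k - 2))"
      by (rule mult_right_mono) (use that in auto)
    then show ?thesis using C(2)[OF that, of x] by linarith
  qed
  then show ?thesis using C(1) by (intro exI[of _ "\<Sum>l\<le>k. C l"]) (auto intro: sum_nonneg)
qed

lemma conjugated_operator:
  assumes \<xi>: "\<xi> \<ge> 1" and f: "smooth f"
  shows "diff_op k c (\<lambda>x. exp (\<i> * (complex_of_real (\<xi> * x) + \<Gamma> \<xi> x)) * f x) x
    = exp (\<i> * (complex_of_real (\<xi> * x) + \<Gamma> \<xi> x)) * ((\<Sum>l\<le>k. A l \<xi> x * (D1 ^^ l) f x)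
        + complex_of_real (\<xi> ^ k) * f x + of_nat k * (complex_of_real (\<xi> ^ (k - 1)) * D1 f x))"
proof -
  define \<Phi> where "\<Phi> x = complex_of_real (\<xi> * x) + \<Gamma> \<xi> x" for x
  let ?\<theta> = "\<lambda>x. complex_of_real \<xi> + \<psi> \<xi> x"
  have \<theta>: "smooth ?\<theta>" by (intro smooth_add smooth_const LP_smooth[OF \<psi> \<xi>])
  have \<Phi>d: "(\<Phi> has_vector_derivative ?\<theta> x) (at x)" for x
    unfolding \<Phi>_def by (intro has_vector_derivative_add \<Gamma>[OF \<xi>]) (auto intro!: derivative_eq_intros)
  have \<Phi>: "smooth \<Phi>" by (rule smooth_antiderivative[OF \<theta> \<Phi>d])
  have d\<Phi>: "D1 \<Phi> x = - \<i> * ?\<theta> x" for x by (rule D1_eqI[OF \<Phi>d])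
  have tw: "(tw ?\<theta> ^^ j) f x = (\<Sum>l\<le>k. of_nat (j choose l) * (E \<psi> (j - l) \<xi> x * (D1 ^^ l) f x))" if "j \<le> k" for j
  proof -
    have "(tw ?\<theta> ^^ j) f x = (\<Sum>l\<le>j. of_nat (j choose l) * (E \<psi> (j - l) \<xi> x * (D1 ^^ l) f x))"
      using tw_Leibniz[OF \<theta> smooth_const[of 1] f, of j] by (simp add: E_def)
    also have "\<dots> = (\<Sum>l\<le>k. of_nat (j choose l) * (E \<psi> (j - l) \<xi> x * (D1 ^^ l) f x))"
      by (rule sum.mono_neutral_left) (use that in auto)
    finally show ?thesis .
  qed
  have D: "(D1 ^^ j) (\<lambda>x. exp (\<i> * \<Phi> x) * f x) x = exp (\<i> * \<Phi> x) * (tw ?\<theta> ^^ j) f x" for j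
    using D1_pow_exp_mult[OF \<Phi> d\<Phi> \<theta> f] by simp
  have "diff_op k c (\<lambda>x. exp (\<i> * \<Phi> x) * f x) x
      = exp (\<i> * \<Phi> x) * ((tw ?\<theta> ^^ k) f x + (\<Sum>j\<le>k - 2. q j x * (tw ?\<theta> ^^ j) f x))"
    unfolding c unfolding diff_op_def D by (simp add: distrib_left sum_distrib_left mult.left_commute)
  also have "(tw ?\<theta> ^^ k) f x + (\<Sum>j\<le>k - 2. q j x * (tw ?\<theta> ^^ j) f x)
      = (\<Sum>l\<le>k. (of_nat (k choose l) * E \<psi> (k - l) \<xi> x + (\<Sum>j\<le>k - 2. of_nat (j choose l) * (q j x * E \<psi> (j - l) \<xi> x))) * (D1 ^^ l) f x)"
  proof -
    have "(\<Sum>j\<le>k - 2. q j x * (tw ?\<theta> ^^ j) f x)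
        = (\<Sum>j\<le>k - 2. \<Sum>l\<le>k. of_nat (j choose l) * (q j x * E \<psi> (j - l) \<xi> x) * (D1 ^^ l) f x)"
      by (intro sum.cong refl) (simp add: tw sum_distrib_left mult_ac)
    also have "\<dots> = (\<Sum>l\<le>k. \<Sum>j\<le>k - 2. of_nat (j choose l) * (q j x * E \<psi> (j - l) \<xi> x) * (D1 ^^ l) f x)"
      by (rule sum.swap)
    finally show ?thesis by (simp add: tw distrib_right sum.distrib sum_distrib_right mult.assoc)
  qed
  also have "\<dots> = (\<Sum>l\<le>k. A l \<xi> x * (D1 ^^ l) f x + (if l = 0 then complex_of_real (\<xi> ^ k) * f x else 0)
      + (if l = 1 then of_nat k * (complex_of_real (\<xi> ^ (k - 1)) * D1 f x) else 0))"
    by (intro sum.cong refl) (auto simp: A_def algebra_simps)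
  also have "\<dots> = (\<Sum>l\<le>k. A l \<xi> x * (D1 ^^ l) f x) + complex_of_real (\<xi> ^ k) * f x
      + of_nat k * (complex_of_real (\<xi> ^ (k - 1)) * D1 f x)"
    using k by (simp add: sum.distrib)
  finally show ?thesis by (simp add: \<Phi>_def)
qed

lemma \<Gamma>_continuous: "\<xi> \<ge> 1 \<Longrightarrow> continuous_on S (\<Gamma> \<xi>)"
  by (rule continuous_at_imp_continuous_on) (simp add: has_vector_derivative_continuous[OF \<Gamma>])

lemma h_continuous: "\<xi> \<ge> 1 \<Longrightarrow> continuous_on S (h \<xi>)"
  unfolding h_def by (intro continuous_intros \<Gamma>_continuous)

lemma norm_phase: "cmod (exp (\<i> * (complex_of_real (\<xi> * x) + \<Gamma> \<xi> x))) = exp (h \<xi> x)"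
  by (simp add: h_def)

text \<open>The packet is the approximate solution times a profile of width \<open>w\<close> centred
  at \<open>x - v t\<close>. Its defect contains only the coefficients \<open>A l\<close>, and the
  energy bound compares its norm on arrival at \<open>z\<close> with its norm at \<open>x\<close>.
  Since \<open>h\<close> is maximal at \<open>z\<close> along the path, the defect is measured by
  the modulus at the end point.\<close>

lemma packet_estimate:
  assumes C: "C \<ge> 0" "\<And>l \<xi> x. l \<le> k \<Longrightarrow> \<xi> \<ge> 1 \<Longrightarrow> cmod (A l \<xi> x) \<le> C * (if l = 0 then 1 else \<xi> ^ (k - 2))"
    and pr: "pr \<in> ccs" "\<And>s. \<bar>s\<bar> \<le> 1 / 2 \<Longrightarrow> cmod (pr s) \<ge> \<kappa>"
    "\<And>l s. l \<le> k \<Longrightarrow> cmod ((D1 ^^ l) pr s) \<le> B" "\<And>l s. \<bar>s\<bar> > 1 \<Longrightarrow> (D1 ^^ l) pr s = 0"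
    and pos: "\<kappa> > 0" "B > 0"
    and \<xi>: "\<xi> \<ge> 1" and w: "w \<ge> 1"
    and G: "\<And>x y. \<bar>x - y\<bar> \<le> w \<Longrightarrow> \<bar>h \<xi> x - h \<xi> y\<bar> \<le> G"
    and xz: "\<bar>x - z\<bar> \<le> real k * \<xi> ^ (k - 1)" and zmax: "\<And>y. y \<in> closed_segment x z \<Longrightarrow> h \<xi> y \<le> h \<xi> z"
  shows "\<kappa> * exp (h \<xi> z - G) * sqrt w \<le> M * (B * exp (h \<xi> x + G) * sqrt (2 * w)
    + \<bar>x - z\<bar> / (real k * \<xi> ^ (k - 1)) * (C * B * (1 + real k * (\<xi> ^ (k - 2) / w)) * exp (h \<xi> z + G) * sqrt (2 * w)))"
proof -
  define v where "v = real k * \<xi> ^ (k - 1)"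
  have v: "v > 0" unfolding v_def using k \<xi> by simp
  \<comment> \<open>The signed travel time from \<open>x\<close> to \<open>z\<close> at speed
    \<open>v\<close>; the assumption on the distance keeps it within the range of
    \<open>energy_bound\<close>.\<close>
  define \<tau> where "\<tau> = (x - z) / v"
  have \<tau>: "\<bar>\<tau>\<bar> \<le> 1" "\<bar>\<tau>\<bar> = \<bar>x - z\<bar> / v"
  proof -
    show "\<bar>\<tau>\<bar> = \<bar>x - z\<bar> / v" unfolding \<tau>_def abs_divide abs_of_pos[OF v] ..
    moreover have "\<bar>x - z\<bar> \<le> v" using xz by (simp only: v_def)
    ultimately show "\<bar>\<tau>\<bar> \<le> 1" using v by simp
  qed
  define xt where "xt t = x - v * t" for t
  have xt0: "xt 0 = x" "xt \<tau> = z" using v by (simp_all add: xt_def \<tau>_def)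
  have xts: "xt t \<in> closed_segment x z" if t: "t \<in> closed_segment 0 \<tau>" for t
  proof -
    obtain s where s: "0 \<le> s" "s \<le> 1" "t = s * \<tau>" using t by (auto simp: closed_segment_def)
    then have "v * t = s * (x - z)" using v by (simp add: \<tau>_def)
    then show ?thesis unfolding xt_def closed_segment_def
      using s by (intro CollectI exI[of _ s]) (simp add: algebra_simps)
  qed
  define ph where "ph X = exp (\<i> * (complex_of_real (\<xi> * X) + \<Gamma> \<xi> X))" for X
  have nph: "cmod (ph X) = exp (h \<xi> X)" for X unfolding ph_def by (rule norm_phase)
  define en where "en t = exp (\<i> * complex_of_real (\<xi> ^ k * t))" for t
  have en1: "cmod (en t) = 1" for t unfolding en_def by (rule norm_exp_i_times)
  define u where "u t X = en t * (ph X * pr (- xt t / w + X / w))" for t X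
  define u' where "u' t X = en t * (ph X * (\<i> * complex_of_real (\<xi> ^ k) * pr (- xt t / w + X / w)
      + \<i> * (complex_of_real (v / w) * D1 pr (- xt t / w + X / w))))" for t X
  have spr: "smooth pr" by (rule ccs_smooth[OF pr(1)])
  have pr0: "pr s = 0" if "\<bar>s\<bar> > 1" for s using pr(4)[OF that, of 0] by simp
  have arg: "- a / w + X / w = (X - a) / w" for a X by (simp add: diff_divide_distrib)
  have out: "\<bar>- a / w + X / w\<bar> > 1" if "\<bar>X - a\<bar> > w" for a X
    unfolding arg using that w by (simp add: abs_divide)
  have phs: "smooth ph"
  proof -
    have g: "smooth (\<Gamma> \<xi>)" by (rule smooth_antiderivative[OF LP_smooth[OF \<psi> \<xi>] \<Gamma>[OF \<xi>]])
    have "smooth (\<lambda>x. complex_of_real (\<xi> * x))"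
      by (rule smooth_bounded_linear) (intro bounded_linear_compose[OF bounded_linear_of_real] bounded_linear_mult_right)
    then show ?thesis unfolding ph_def by (intro smooth_exp smooth_mult smooth_const smooth_add g)
  qed
  have prs: "smooth (\<lambda>X. pr (b + X / w))" for b
    by (rule smooth_affine[OF spr bounded_linear_divide])
  have uc: "u t \<in> ccs" for t
  proof (rule ccsI[of _ "\<bar>xt t\<bar> + w"])
    show "smooth (u t)" unfolding u_def[abs_def] by (intro smooth_mult smooth_const phs prs)
    show "u t X = 0" if "\<bar>X\<bar> > \<bar>xt t\<bar> + w" for X
      unfolding u_def by (subst pr0, rule out) (use that in auto)
  qed
  have ud: "((\<lambda>t. u t X) has_vector_derivative u' t X) (at t)" for t X
  proof -
    have 1: "(en has_vector_derivative \<i> * complex_of_real (\<xi> ^ k) * en t) (at t)"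
    proof -
      have a: "((\<lambda>t. \<i> * complex_of_real (\<xi> ^ k * t)) has_vector_derivative \<i> * complex_of_real (\<xi> ^ k)) (at t)"
        by (auto intro!: derivative_eq_intros)
      show ?thesis
        using field_vector_diff_chain_at[OF a DERIV_exp] unfolding en_def[abs_def] o_def .
    qed
    have 2: "((\<lambda>t. pr (- xt t / w + X / w)) has_vector_derivative (v / w) *\<^sub>R (\<i> * D1 pr (- xt t / w + X / w))) (at t)"
    proof -
      have a: "((\<lambda>t. - xt t / w + X / w) has_vector_derivative (v / w)) (at t)"
        unfolding xt_def using w by (auto intro!: derivative_eq_intros)
      show ?thesis using vector_diff_chain_at[OF a D1_vd[OF spr]] by (simp add: o_def)
    qed
    have "((\<lambda>t. en t * (ph X * pr (- xt t / w + X / w))) has_vector_derivative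
        en t * (ph X * ((v / w) *\<^sub>R (\<i> * D1 pr (- xt t / w + X / w)))) + (\<i> * complex_of_real (\<xi> ^ k) * en t) * (ph X * pr (- xt t / w + X / w))) (at t)"
      by (rule has_vector_derivative_mult[OF 1 bounded_linear.has_vector_derivative[OF bounded_linear_mult_right 2]])
    then show ?thesis unfolding u_def u'_def by (simp add: scaleR_conv_of_real algebra_simps)
  qed
  have u'c: "continuous_on UNIV (\<lambda>p. u' (fst p) (snd p))"
  proof -
    have ec: "continuous_on UNIV en" unfolding en_def[abs_def] by (intro continuous_intros)
    have pc: "continuous_on UNIV ph" by (rule smooth_continuous[OF phs])
    have cc: "continuous_on UNIV (\<lambda>p. g (- xt (fst p) / w + snd p / w))" if "smooth g" for g :: "real \<Rightarrow> complex"
      by (rule continuous_on_compose2[OF smooth_continuous[OF that, of UNIV]])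
        (use w in \<open>auto simp: xt_def intro!: continuous_intros\<close>)
    show ?thesis unfolding u'_def
      by (intro continuous_intros cc spr smooth_D1 continuous_on_compose2[OF ec] continuous_on_compose2[OF pc]) auto
  qed
  have vd: "u' t \<in> L2 \<and> ((\<lambda>t. emb (u t)) has_vector_derivative emb (u' t)) (at t)" for t
  proof -
    define R where "R = \<bar>x\<bar> + v * (\<bar>t\<bar> + 1) + w"
    have R: "R > 0" using v w by (simp add: R_def add_nonneg_pos add_pos_nonneg)
    have z: "u s X = 0" if "\<bar>s - t\<bar> < 1" "\<bar>X\<bar> > R" for s X
    proof -
      have "\<bar>xt s\<bar> \<le> \<bar>x\<bar> + v * \<bar>s\<bar>" unfolding xt_def using v by (simp add: abs_mult order_trans[OF abs_triangle_ineq4])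
      also have "\<dots> \<le> \<bar>x\<bar> + v * (\<bar>t\<bar> + 1)" using v that(1) by (intro add_left_mono mult_left_mono) auto
      finally have "\<bar>X - xt s\<bar> > w" using that(2) by (simp add: R_def)
      then show ?thesis by (simp only: u_def pr0[OF out] mult_zero_right)
    qed
    have a: "continuous_on UNIV (u s)" for s by (rule smooth_continuous[OF ccs_smooth[OF uc]])
    show ?thesis using emb_curve_derivative[OF ud u'c a R z] by blast
  qed
  have near: "exp (h \<xi> X) \<le> exp (h \<xi> a + G)" if "\<bar>X - a\<bar> \<le> w" for X a
    using G[OF that] by (simp add: abs_le_iff)
  define F where "F = C * B * (1 + real k * (\<xi> ^ (k - 2) / w))"
  define S where "S = F * exp (h \<xi> z + G) * sqrt (2 * w)"
  have F0: "F \<ge> 0" unfolding F_def using C pos \<xi> w by (intro mult_nonneg_nonneg add_nonneg_nonneg divide_nonneg_nonneg) auto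
  have res: "L2_norm (\<lambda>X. u' t X - \<i> * diff_op k c (u t) X) \<le> S" if t: "t \<in> closed_segment 0 \<tau>" for t
  proof -
    define f where "f X = pr (- xt t / w + X / w)" for X
    have fs: "smooth f" unfolding f_def[abs_def] by (rule prs)
    have Df: "(D1 ^^ l) f = (\<lambda>X. complex_of_real (1 / w) ^ l * (D1 ^^ l) pr (- xt t / w + X / w))" for l
      unfolding f_def[abs_def] by (rule D1_pow_rescale[OF spr])
    define r where "r X = (\<Sum>l\<le>k. A l \<xi> X * (D1 ^^ l) f X)" for X
    \<comment> \<open>The time derivatives of the factor \<open>en\<close> and of the moving profile
      cancel the constant and the transport term of the conjugated operator; only \<open>r\<close>
      is left.\<close>
    have eq: "u' t X - \<i> * diff_op k c (u t) X = - \<i> * (en t * (ph X * r X))" for X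
    proof -
      have "u t = (\<lambda>X. ph X * (en t * f X))" by (auto simp: u_def f_def)
      then have "diff_op k c (u t) X = ph X * ((\<Sum>l\<le>k. A l \<xi> X * (D1 ^^ l) (\<lambda>X. en t * f X) X)
          + complex_of_real (\<xi> ^ k) * (en t * f X) + of_nat k * (complex_of_real (\<xi> ^ (k - 1)) * D1 (\<lambda>X. en t * f X) X))"
        using conjugated_operator[OF \<xi> smooth_mult[OF smooth_const fs]] by (simp only: ph_def)
      also have "\<dots> = en t * (ph X * (r X + complex_of_real (\<xi> ^ k) * f X + of_nat k * (complex_of_real (\<xi> ^ (k - 1)) * D1 f X)))"
        by (simp add: D1_pow_cmult[OF fs] D1_cmult[OF fs] r_def algebra_simps sum_distrib_left)
      finally have 1: "diff_op k c (u t) X = en t * (ph X * (r X + complex_of_real (\<xi> ^ k) * f X + of_nat k * (complex_of_real (\<xi> ^ (k - 1)) * D1 f X)))" .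
      have "D1 f X = complex_of_real (1 / w) * D1 pr (- xt t / w + X / w)" using Df[of 1] by simp
      then have 2: "of_nat k * (complex_of_real (\<xi> ^ (k - 1)) * D1 f X) = complex_of_real (v / w) * D1 pr (- xt t / w + X / w)"
        by (simp add: v_def)
      show ?thesis unfolding 1 2 u'_def f_def[symmetric] by (simp add: algebra_simps)
    qed
    have rb: "cmod (r X) \<le> F" for X
    proof -
      have "cmod (r X) \<le> (\<Sum>l\<le>k. cmod (A l \<xi> X * (D1 ^^ l) f X))" unfolding r_def by (rule norm_sum)
      also have "\<dots> \<le> (\<Sum>l\<le>k. C * B * (if l = 0 then 1 else \<xi> ^ (k - 2) / w))"
      proof (rule sum_mono)
        fix l assume "l \<in> {..k}"
        then have l: "l \<le> k" by simp
        have "cmod ((D1 ^^ l) f X) = (1 / w) ^ l * cmod ((D1 ^^ l) pr (- xt t / w + X / w))"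
          unfolding Df using w by (simp add: norm_mult norm_power norm_divide)
        also have "\<dots> \<le> (1 / w) ^ l * B" using w by (intro mult_left_mono pr(3)[OF l]) auto
        \<comment> \<open>One factor 1/w is kept for each positive l; as \<open>w\<close> is at
          least 1, the higher powers may be dropped.\<close>
        also have "\<dots> \<le> (if l = 0 then 1 else 1 / w) * B"
        proof (rule mult_right_mono)
          show "(1 / w) ^ l \<le> (if l = 0 then 1 else 1 / w)"
            using w power_decreasing[of 1 l "1 / w"] by auto
        qed (use pos in simp)
        finally have 1: "cmod ((D1 ^^ l) f X) \<le> (if l = 0 then 1 else 1 / w) * B" .
        have "cmod (A l \<xi> X * (D1 ^^ l) f X) \<le> (C * (if l = 0 then 1 else \<xi> ^ (k - 2))) * ((if l = 0 then 1 else 1 / w) * B)"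
          unfolding norm_mult by (rule mult_mono[OF C(2)[OF l \<xi>] 1]) (use C \<xi> in auto)
        then show "cmod (A l \<xi> X * (D1 ^^ l) f X) \<le> C * B * (if l = 0 then 1 else \<xi> ^ (k - 2) / w)"
          by (simp add: mult_ac split: if_splits)
      qed
      also have "\<dots> = F"
      proof -
        have "(\<Sum>l\<le>k. if l = 0 then 1 else \<xi> ^ (k - 2) / w) = 1 + real k * (\<xi> ^ (k - 2) / w)"
          by (cases k) (simp_all only: sum.atMost_Suc_shift, simp_all)
        then show ?thesis unfolding F_def sum_distrib_left[symmetric] by simp
      qed
      finally show ?thesis .
    qed
    have rz: "r X = 0" if "\<bar>X - xt t\<bar> > w" for X
      unfolding r_def Df using pr(4)[OF out[OF that]] by simp
    have L: "(\<lambda>X. u' t X - \<i> * diff_op k c (u t) X) \<in> L2"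
    proof -
      have "(\<lambda>X. - \<i> * (en t * (ph X * r X))) \<in> ccs"
      proof (rule ccsI[of _ "\<bar>xt t\<bar> + w"])
        show "smooth (\<lambda>X. - \<i> * (en t * (ph X * r X)))"
          unfolding r_def by (intro smooth_mult smooth_const phs smooth_sum smooth_D1_pow fs LP_smooth[OF A_LP \<xi>])
        show "- \<i> * (en t * (ph X * r X)) = 0" if "\<bar>X\<bar> > \<bar>xt t\<bar> + w" for X
          by (subst rz) (use that in auto)
      qed
      then show ?thesis unfolding eq by (rule ccs_L2)
    qed
    have "L2_norm (\<lambda>X. u' t X - \<i> * diff_op k c (u t) X) \<le> (F * exp (h \<xi> z + G)) * sqrt (2 * w)"
    proof (rule L2_norm_le[OF L, where a = "xt t"])
      show "u' t X - \<i> * diff_op k c (u t) X = 0" if "\<bar>X - xt t\<bar> > w" for X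
        unfolding eq using rz[OF that] by simp
      show "cmod (u' t X - \<i> * diff_op k c (u t) X) \<le> F * exp (h \<xi> z + G)" for X
      proof (cases "\<bar>X - xt t\<bar> \<le> w")
        case True
        have "cmod (u' t X - \<i> * diff_op k c (u t) X) = cmod (r X) * exp (h \<xi> X)"
          unfolding eq by (simp add: norm_mult en1 nph)
        also have "\<dots> \<le> F * exp (h \<xi> (xt t) + G)" by (rule mult_mono[OF rb near[OF True] F0]) simp
        \<comment> \<open>The centre stays on the segment on which \<open>z\<close> maximizes
          \<open>h\<close>.\<close>
        also have "\<dots> \<le> F * exp (h \<xi> z + G)" using zmax[OF xts[OF t]] F0 by (intro mult_left_mono) auto
        finally show ?thesis .
      next
        case False
        then show ?thesis unfolding eq using rz[of X] F0 by simp
      qed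
    qed (use w in simp)
    then show ?thesis by (simp only: S_def)
  qed
  have "L2_norm (u \<tau>) \<le> M * (L2_norm (u 0) + \<bar>\<tau>\<bar> * S)"
    using energy \<tau>(1) uc vd res unfolding energy_bound_def by blast
  moreover have "\<kappa> * exp (h \<xi> z - G) * sqrt w \<le> L2_norm (u \<tau>)"
  proof -
    have "(\<kappa> * exp (h \<xi> z - G)) * sqrt (2 * (w / 2)) \<le> L2_norm (u \<tau>)"
    proof (rule L2_norm_ge[OF ccs_L2[OF uc], where a = z])
      fix X assume X: "\<bar>X - z\<bar> \<le> w / 2"
      then have "\<bar>- xt \<tau> / w + X / w\<bar> \<le> 1 / 2" unfolding arg xt0 using w by (simp add: abs_divide field_simps)
      then have 1: "\<kappa> \<le> cmod (pr (- xt \<tau> / w + X / w))" by (rule pr(2))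
      have "\<bar>X - z\<bar> \<le> w" using X w by linarith
      from G[OF this] have 2: "exp (h \<xi> z - G) \<le> exp (h \<xi> X)" by (simp add: abs_le_iff)
      have "\<kappa> * exp (h \<xi> z - G) \<le> cmod (pr (- xt \<tau> / w + X / w)) * exp (h \<xi> X)"
        by (rule mult_mono[OF 1 2]) auto
      also have "\<dots> = cmod (u \<tau> X)" unfolding u_def by (simp add: norm_mult en1 nph)
      finally show "\<kappa> * exp (h \<xi> z - G) \<le> cmod (u \<tau> X)" .
    qed (use pos w in auto)
    then show ?thesis by simp
  qed
  moreover have u0: "L2_norm (u 0) \<le> B * exp (h \<xi> x + G) * sqrt (2 * w)"
  proof (rule L2_norm_le[OF ccs_L2[OF uc], where a = x])
    show "u 0 X = 0" if "\<bar>X - x\<bar> > w" for X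
      unfolding u_def by (subst pr0) (use out[OF that] xt0 in auto)
    show "cmod (u 0 X) \<le> B * exp (h \<xi> x + G)" for X
    proof (cases "\<bar>X - x\<bar> \<le> w")
      case True
      have "cmod (u 0 X) = cmod (pr (- xt 0 / w + X / w)) * exp (h \<xi> X)"
        unfolding u_def by (simp add: norm_mult en1 nph)
      also have "\<dots> \<le> B * exp (h \<xi> x + G)"
        by (rule mult_mono[OF _ near[OF True]]) (use pr(3)[of 0] pos in auto)
      finally show ?thesis .
    next
      case False
      then have "u 0 X = 0" unfolding u_def by (subst pr0) (use out[of X x] xt0 in auto)
      then show ?thesis using pos by simp
    qed
  qed (use w in simp)
  ultimately have "\<kappa> * exp (h \<xi> z - G) * sqrt w \<le> M * (L2_norm (u 0) + \<bar>\<tau>\<bar> * S)" by linarith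
  \<comment> \<open>\<open>energy_bound\<close> does not prescribe the sign of \<open>M\<close>; a
    negative value would contradict the positive lower bound for the norm on arrival.\<close>
  moreover have "0 \<le> M"
  proof (rule ccontr)
    assume "\<not> 0 \<le> M"
    have S0: "S \<ge> 0" unfolding S_def using F0 w by simp
    have "M * (L2_norm (u 0) + \<bar>\<tau>\<bar> * S) \<le> 0" using \<open>\<not> 0 \<le> M\<close> S0
      by (intro mult_nonpos_nonneg add_nonneg_nonneg mult_nonneg_nonneg) auto
    moreover have "0 < \<kappa> * exp (h \<xi> z - G) * sqrt w" using pos w by simp
    ultimately show False using \<open>\<kappa> * exp (h \<xi> z - G) * sqrt w \<le> M * (L2_norm (u 0) + \<bar>\<tau>\<bar> * S)\<close> by linarith
  qed
  then have "M * (L2_norm (u 0) + \<bar>\<tau>\<bar> * S) \<le> M * (B * exp (h \<xi> x + G) * sqrt (2 * w) + \<bar>\<tau>\<bar> * S)"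
    using u0 by (intro mult_left_mono add_right_mono) auto
  ultimately show ?thesis unfolding \<tau>(2) v_def S_def F_def by linarith
qed

end

section \<open>Growth of the modulus from scale to scale\<close>

lemma variation_subdivide:
  fixes f :: "real \<Rightarrow> real"
  assumes "\<And>x y. \<bar>x - y\<bar> \<le> r \<Longrightarrow> \<bar>f x - f y\<bar> \<le> D"
  shows "\<bar>x - y\<bar> \<le> real N * r \<Longrightarrow> \<bar>f x - f y\<bar> \<le> real N * D"
proof (induction N arbitrary: y)
  case (Suc N)
  define p where "p = x + (y - x) * (real N / real (Suc N))"
  have 1: "\<bar>x - p\<bar> = \<bar>x - y\<bar> * (real N / real (Suc N))"
    by (simp add: p_def abs_mult abs_minus_commute)
  have 2: "p - y = (x - y) * (1 / real (Suc N))"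
    unfolding p_def by (simp add: field_simps)
  have "\<bar>x - p\<bar> \<le> (real (Suc N) * r) * (real N / real (Suc N))"
    unfolding 1 by (rule mult_right_mono[OF Suc.prems]) simp
  then have "\<bar>x - p\<bar> \<le> real N * r" by (simp add: mult.commute)
  then have a: "\<bar>f x - f p\<bar> \<le> real N * D" by (rule Suc.IH)
  have "\<bar>p - y\<bar> = \<bar>x - y\<bar> * (1 / real (Suc N))" unfolding 2 abs_mult by simp
  also have "\<dots> \<le> (real (Suc N) * r) * (1 / real (Suc N))"
    by (rule mult_right_mono[OF Suc.prems]) simp
  finally have "\<bar>p - y\<bar> \<le> r" by simp
  from assms[OF this] a show ?case by (simp add: distrib_right)
qed simp

context wkb
begin

text \<open>A packet of width w at frequency \<open>\<xi>\<close> moves with speed \<open>k \<xi>\<^bsup>k-1\<^esup>\<close>, and its relative error per unit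
  of time is \<open>O(1 + \<xi>\<^bsup>k-2\<^esup> / w)\<close>. Over a distance \<open>d \<xi> w\<close> with \<open>w \<le> \<xi>\<^bsup>k-2\<^esup>\<close> the accumulated error is
  \<open>O(d)\<close>, and d is chosen to absorb it. The end point z is taken where the modulus is largest.\<close>

lemma variation_step:
  "\<exists>G'. \<forall>\<xi>\<ge>1. \<forall>w. 1 \<le> w \<longrightarrow> w \<le> \<xi> ^ (k - 2) \<longrightarrow> (\<forall>x y. \<bar>x - y\<bar> \<le> w \<longrightarrow> \<bar>h \<xi> x - h \<xi> y\<bar> \<le> G) \<longrightarrow>
    (\<forall>x y. \<bar>x - y\<bar> \<le> \<xi> * w \<longrightarrow> \<bar>h \<xi> x - h \<xi> y\<bar> \<le> G')"
proof -
  obtain C where C: "C \<ge> 0" "\<And>l \<xi> x. l \<le> k \<Longrightarrow> \<xi> \<ge> 1 \<Longrightarrow> cmod (A l \<xi> x) \<le> C * (if l = 0 then 1 else \<xi> ^ (k - 2))"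
    using A_bound by blast
  obtain pr :: "real \<Rightarrow> complex" and \<kappa> B where pr: "pr \<in> ccs" "\<kappa> > 0" "B > 0"
    "\<And>s. \<bar>s\<bar> \<le> 1 / 2 \<Longrightarrow> cmod (pr s) \<ge> \<kappa>"
    "\<And>l s. l \<le> k \<Longrightarrow> cmod ((D1 ^^ l) pr s) \<le> B" "\<And>l s. \<bar>s\<bar> > 1 \<Longrightarrow> (D1 ^^ l) pr s = 0"
    using profile_exists[of k] by blast
  define M1 where "M1 = max M 1"
  \<comment> \<open>Collects the constants: two factors \<open>exp G\<close> for the variation of
    the modulus within the windows at departure and arrival, and \<open>sqrt 2\<close> from the
    different widths in the upper and lower norm bounds.\<close>
  define L where "L = M1 * sqrt 2 * exp (2 * G)"
  have L: "L > 0" by (simp add: L_def M1_def)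
  \<comment> \<open>Makes \<open>4 * (L * C * B) * d\<close> at most \<open>\<kappa>\<close>, so
    that the defect, which enters with a factor at most \<open>2 * d\<close>, is absorbed by half of
    the left-hand side. The bound by 1 keeps the travel time at most 1.\<close>
  define d where "d = min 1 (\<kappa> / (4 * (L * C * B) + 1))"
  have LCB: "L * C * B \<ge> 0" using L C pr by simp
  have d: "0 < d" "d \<le> 1" "4 * (L * C * B) * d \<le> \<kappa>"
  proof -
    show "0 < d" "d \<le> 1" using pr LCB by (auto simp: d_def intro!: divide_pos_pos add_nonneg_pos)
    have "4 * (L * C * B) * d \<le> (4 * (L * C * B) + 1) * d" using \<open>0 < d\<close> by (intro mult_right_mono) auto
    also have "\<dots> \<le> (4 * (L * C * B) + 1) * (\<kappa> / (4 * (L * C * B) + 1))"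
      using LCB by (intro mult_left_mono) (auto simp: d_def)
    also have "\<dots> = \<kappa>" using LCB by simp
    finally show "4 * (L * C * B) * d \<le> \<kappa>" .
  qed
  define D where "D = \<bar>ln (2 * (L * B) / \<kappa>)\<bar>"
  define N where "N = nat \<lceil>1 / d\<rceil>"
  have N: "1 \<le> real N * d"
  proof -
    have "1 / d \<le> real N" unfolding N_def by (rule real_nat_ceiling_ge)
    then show ?thesis using d(1) by (simp add: field_simps)
  qed
  have main: "h \<xi> y - h \<xi> x \<le> D" if \<xi>: "\<xi> \<ge> 1" and w: "1 \<le> w" "w \<le> \<xi> ^ (k - 2)"
    and G: "\<And>x y. \<bar>x - y\<bar> \<le> w \<Longrightarrow> \<bar>h \<xi> x - h \<xi> y\<bar> \<le> G" and xy: "\<bar>x - y\<bar> \<le> d * (\<xi> * w)" for \<xi> w x y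
  proof -
    have "compact (closed_segment x y)" "closed_segment x y \<noteq> {}" by auto
    then obtain z where z: "z \<in> closed_segment x y" "\<And>s. s \<in> closed_segment x y \<Longrightarrow> h \<xi> s \<le> h \<xi> z"
      using continuous_attains_sup[OF _ _ h_continuous[OF \<xi>]] by metis
    have xz: "\<bar>x - z\<bar> \<le> d * (\<xi> * w)"
      using segment_bound1[OF z(1)] xy by (simp add: abs_minus_commute)
    have kk: "\<xi> * \<xi> ^ (k - 2) = \<xi> ^ (k - 1)" using k by (simp flip: power_Suc add: Suc_diff_Suc numeral_2_eq_2)
    have w0: "\<xi> * w \<le> \<xi> ^ (k - 1)" unfolding kk[symmetric] using w \<xi> by (intro mult_left_mono) auto
    have k1: "1 \<le> real k" using k by simp
    have v: "0 < real k * \<xi> ^ (k - 1)" using k \<xi> by simp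
    have v1: "\<xi> ^ (k - 1) \<le> real k * \<xi> ^ (k - 1)" using k1 \<xi> by simp
    have "d * (\<xi> * w) \<le> 1 * (\<xi> * w)" using d w \<xi> by (intro mult_right_mono) auto
    then have xz': "\<bar>x - z\<bar> \<le> real k * \<xi> ^ (k - 1)" using xz w0 v1 by linarith
    \<comment> \<open>Travel time multiplied by the relative error rate; each of the two summands of
      the rate contributes at most \<open>d\<close>.\<close>
    define Q where "Q = \<bar>x - z\<bar> / (real k * \<xi> ^ (k - 1)) * (1 + real k * (\<xi> ^ (k - 2) / w))"
    have sub: "closed_segment x z \<subseteq> closed_segment x y" using z(1) by (simp add: subset_closed_segment)
    have est: "\<kappa> * exp (h \<xi> z - G) * sqrt w \<le> M * (B * exp (h \<xi> x + G) * sqrt (2 * w)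
        + \<bar>x - z\<bar> / (real k * \<xi> ^ (k - 1)) * (C * B * (1 + real k * (\<xi> ^ (k - 2) / w)) * exp (h \<xi> z + G) * sqrt (2 * w)))"
      by (rule packet_estimate[OF C pr(1,4,5,6,2,3) \<xi> w(1) G xz']) (use z(2) sub in auto)
    have Q: "0 \<le> Q" "Q \<le> 2 * d"
    proof -
      show "0 \<le> Q" unfolding Q_def using \<xi> w by (intro mult_nonneg_nonneg add_nonneg_nonneg divide_nonneg_nonneg) auto
      have "Q \<le> d * (\<xi> * w) / (real k * \<xi> ^ (k - 1)) * (1 + real k * (\<xi> ^ (k - 2) / w))"
        unfolding Q_def by (intro mult_right_mono divide_right_mono xz) (use \<xi> w in auto)
      also have "\<dots> = d * (\<xi> * w / (real k * \<xi> ^ (k - 1))) + d * ((\<xi> * \<xi> ^ (k - 2)) / \<xi> ^ (k - 1))"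
        using w \<xi> k by (simp add: field_simps)
      also have "(\<xi> * \<xi> ^ (k - 2)) / \<xi> ^ (k - 1) = 1" unfolding kk using \<xi> by simp
      also have "d * (\<xi> * w / (real k * \<xi> ^ (k - 1))) + d * 1 \<le> d * 1 + d * 1"
        using w0 v1 v d(1) by (intro add_mono mult_left_mono) (auto simp: divide_le_eq)
      finally show "Q \<le> 2 * d" by simp
    qed
    have "\<kappa> * exp (h \<xi> z - G) * sqrt w \<le> M * (B * exp (h \<xi> x + G) * sqrt (2 * w) + C * B * Q * exp (h \<xi> z + G) * sqrt (2 * w))"
      using est by (simp add: Q_def mult_ac)
    also have "\<dots> \<le> M1 * (B * exp (h \<xi> x + G) * sqrt (2 * w) + C * B * Q * exp (h \<xi> z + G) * sqrt (2 * w))"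
      by (rule mult_right_mono) (use C pr Q w in \<open>auto simp: M1_def\<close>)
    finally have "\<kappa> * exp (h \<xi> z - G) * sqrt w \<le> \<dots>" .
    then have "(\<kappa> * exp (h \<xi> z - G) * sqrt w) * (exp G / sqrt w)
        \<le> (M1 * (B * exp (h \<xi> x + G) * sqrt (2 * w) + C * B * Q * exp (h \<xi> z + G) * sqrt (2 * w))) * (exp G / sqrt w)"
      using w by (intro mult_right_mono) auto
    moreover have "(\<kappa> * exp (h \<xi> z - G) * sqrt w) * (exp G / sqrt w) = \<kappa> * exp (h \<xi> z)"
      using w by (simp add: exp_diff)
    moreover have "(M1 * (B * exp (h \<xi> x + G) * sqrt (2 * w) + C * B * Q * exp (h \<xi> z + G) * sqrt (2 * w))) * (exp G / sqrt w)
        = L * B * exp (h \<xi> x) + L * C * B * Q * exp (h \<xi> z)"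
    proof -
      have e2: "exp (2 * G) = exp G * exp G" by (simp flip: exp_add)
      have s: "sqrt (2 * w) = sqrt 2 * sqrt w" by (rule real_sqrt_mult)
      have "sqrt w \<noteq> 0" using w by simp
      then show ?thesis unfolding L_def e2 s exp_add by (simp add: field_simps)
    qed
    ultimately have e1: "\<kappa> * exp (h \<xi> z) \<le> L * B * exp (h \<xi> x) + L * C * B * Q * exp (h \<xi> z)" by simp
    have "L * C * B * Q \<le> L * C * B * (2 * d)" by (rule mult_left_mono[OF Q(2) LCB])
    also have "\<dots> \<le> \<kappa> / 2" using d(3) by simp
    finally have "L * C * B * Q * exp (h \<xi> z) \<le> \<kappa> / 2 * exp (h \<xi> z)" by (rule mult_right_mono) simp
    then have "\<kappa> / 2 * exp (h \<xi> z) \<le> L * B * exp (h \<xi> x)" using e1 by linarith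
    then have "exp (h \<xi> z) \<le> 2 * (L * B) / \<kappa> * exp (h \<xi> x)" using pr(2) by (simp add: field_simps)
    also have "2 * (L * B) / \<kappa> = exp (ln (2 * (L * B) / \<kappa>))" using L pr by simp
    finally have "exp (h \<xi> z) \<le> exp (ln (2 * (L * B) / \<kappa>) + h \<xi> x)" by (simp only: exp_add)
    then have "h \<xi> z \<le> ln (2 * (L * B) / \<kappa>) + h \<xi> x" by (simp only: exp_le_cancel_iff)
    moreover have "ln (2 * (L * B) / \<kappa>) \<le> D" unfolding D_def by (rule abs_ge_self)
    moreover have "h \<xi> y \<le> h \<xi> z" by (rule z(2)) simp
    ultimately show ?thesis by linarith
  qed
  show ?thesis
  proof (intro exI[of _ "real N * D"] allI impI)
    fix \<xi> w x y :: real
    assume \<xi>: "1 \<le> \<xi>" and w: "1 \<le> w" "w \<le> \<xi> ^ (k - 2)" and G: "\<forall>x y. \<bar>x - y\<bar> \<le> w \<longrightarrow> \<bar>h \<xi> x - h \<xi> y\<bar> \<le> G"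
      and xy: "\<bar>x - y\<bar> \<le> \<xi> * w"
    have "\<bar>h \<xi> x - h \<xi> y\<bar> \<le> D" if "\<bar>x - y\<bar> \<le> d * (\<xi> * w)" for x y
      using main[OF \<xi> w _ that] main[OF \<xi> w, of y x] G that by (simp add: abs_le_iff abs_minus_commute)
    then show "\<bar>h \<xi> x - h \<xi> y\<bar> \<le> real N * D"
    proof (rule variation_subdivide)
      have "1 * (\<xi> * w) \<le> real N * d * (\<xi> * w)" by (rule mult_right_mono[OF N]) (use \<xi> w in simp)
      then show "\<bar>x - y\<bar> \<le> real N * (d * (\<xi> * w))" using xy by (simp add: mult.assoc)
    qed
  qed
qed

text \<open>\<open>variation_step\<close> with \<open>w = \<xi> ^ j\<close> leads from scale j to
  j+1 as long as j is at most k-2. The start is the boundedness of \<open>\<psi>\<close>. The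
  constant may grow with j but never depends on \<xi>.\<close>

lemma variation_bound_pow:
  "j \<le> k - 1 \<Longrightarrow> \<exists>G. \<forall>\<xi>\<ge>1. \<forall>x y. \<bar>x - y\<bar> \<le> \<xi> ^ j \<longrightarrow> \<bar>h \<xi> x - h \<xi> y\<bar> \<le> G"
proof (induction j)
  case 0
  obtain C where C: "C \<ge> 0" "\<And>\<xi> x. \<xi> \<ge> 1 \<Longrightarrow> cmod (\<psi> \<xi> x) \<le> C * \<xi> powi (-1)" using LP_bound[OF \<psi>] by blast
  have "\<bar>h \<xi> x - h \<xi> y\<bar> \<le> C" if \<xi>: "\<xi> \<ge> 1" and xy: "\<bar>x - y\<bar> \<le> 1" for \<xi> x y
  proof -
    have b: "cmod (\<psi> \<xi> s) \<le> C" for s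
    proof -
      have "\<xi> powi (-1) \<le> 1" using \<xi> by (simp add: power_int_minus inverse_le_1_iff)
      then have "C * \<xi> powi (-1) \<le> C * 1" by (rule mult_left_mono[OF _ C(1)])
      then show ?thesis using C(2)[OF \<xi>, of s] by simp
    qed
    have "norm (\<Gamma> \<xi> x - \<Gamma> \<xi> y) \<le> C * norm (x - y)"
    proof (rule differentiable_bound[where S = UNIV and f' = "\<lambda>s t. t *\<^sub>R \<psi> \<xi> s"])
      fix s
      show "(\<Gamma> \<xi> has_derivative (\<lambda>t. t *\<^sub>R \<psi> \<xi> s)) (at s within UNIV)"
        using \<Gamma>[OF \<xi>, of s] by (simp add: has_vector_derivative_def)
      show "onorm (\<lambda>t. t *\<^sub>R \<psi> \<xi> s) \<le> C"
      proof (rule onorm_le)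
        show "norm (t *\<^sub>R \<psi> \<xi> s) \<le> C * norm t" for t
          unfolding norm_scaleR real_norm_def mult.commute[of C] by (rule mult_left_mono[OF b]) simp
      qed
    qed auto
    also have "\<dots> \<le> C * 1" using xy by (intro mult_left_mono C(1)) auto
    finally show ?thesis
      using abs_Im_le_cmod[of "\<Gamma> \<xi> x - \<Gamma> \<xi> y"] by (simp add: h_def abs_minus_commute)
  qed
  then show ?case by auto
next
  case (Suc j)
  then obtain G where G: "\<And>\<xi> x y. \<xi> \<ge> 1 \<Longrightarrow> \<bar>x - y\<bar> \<le> \<xi> ^ j \<Longrightarrow> \<bar>h \<xi> x - h \<xi> y\<bar> \<le> G" by auto
  obtain G' where G': "\<And>\<xi> w x y. \<xi> \<ge> 1 \<Longrightarrow> 1 \<le> w \<Longrightarrow> w \<le> \<xi> ^ (k - 2) \<Longrightarrow>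
      (\<forall>x y. \<bar>x - y\<bar> \<le> w \<longrightarrow> \<bar>h \<xi> x - h \<xi> y\<bar> \<le> G) \<Longrightarrow> \<bar>x - y\<bar> \<le> \<xi> * w \<Longrightarrow> \<bar>h \<xi> x - h \<xi> y\<bar> \<le> G'"
    using variation_step[of G] by blast
  have "\<bar>h \<xi> x - h \<xi> y\<bar> \<le> G'" if \<xi>: "\<xi> \<ge> 1" and xy: "\<bar>x - y\<bar> \<le> \<xi> ^ Suc j" for \<xi> x y
  proof (rule G'[OF \<xi>, of "\<xi> ^ j"])
    show "1 \<le> \<xi> ^ j" using \<xi> by simp
    show "\<xi> ^ j \<le> \<xi> ^ (k - 2)" by (rule power_increasing) (use Suc.prems \<xi> in auto)
  qed (use G \<xi> xy in auto)
  then show ?case by blast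
qed

lemma variation_bound:
  "\<exists>G. \<forall>\<xi>\<ge>1. \<forall>x y. \<bar>x - y\<bar> \<le> \<xi> ^ (k - 1) \<longrightarrow> \<bar>Im (\<Gamma> \<xi> x) - Im (\<Gamma> \<xi> y)\<bar> \<le> G"
  using variation_bound_pow[of "k - 1"] by (simp add: h_def abs_minus_commute)

end

text \<open>\<open>2\<^bsup>n+1\<^esup> f(2\<xi>) - f(\<xi>)\<close> has no term \<open>\<xi>\<^bsup>-(n+1)\<^esup>\<close>.\<close>

lemma leading_coefficient_bound:
  "\<exists>C\<ge>0. \<forall>(c::nat \<Rightarrow> real) H R. H \<ge> 0 \<longrightarrow> R \<ge> 1 \<longrightarrow>
    (\<forall>\<xi>\<ge>R. \<bar>\<Sum>i\<le>n. c i / \<xi> ^ i\<bar> \<le> H * \<xi> ^ e) \<longrightarrow> \<bar>c 0\<bar> \<le> C * H * R ^ e"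
proof (induction n)
  case 0 show ?case by (rule exI[of _ 1]) auto
next
  case (Suc n)
  then obtain C where C: "C \<ge> 0" "\<And>(c::nat \<Rightarrow> real) H R. H \<ge> 0 \<Longrightarrow> R \<ge> 1 \<Longrightarrow>
    (\<forall>\<xi>\<ge>R. \<bar>\<Sum>i\<le>n. c i / \<xi> ^ i\<bar> \<le> H * \<xi> ^ e) \<Longrightarrow> \<bar>c 0\<bar> \<le> C * H * R ^ e" by blast
  \<comment> \<open>The first summand pays for the value at \<open>2 * \<xi>\<close>, the 1 for the
    value at \<open>\<xi>\<close>.\<close>
  define K :: real where "K = 2 ^ Suc n * 2 ^ e + 1"
  have K: "K \<ge> 0" by (simp add: K_def)
  have "\<bar>c 0\<bar> \<le> (C * K) * H * R ^ e" if H: "H \<ge> 0" "R \<ge> 1" and b: "\<forall>\<xi>\<ge>R. \<bar>\<Sum>i\<le>Suc n. c i / \<xi> ^ i\<bar> \<le> H * \<xi> ^ e"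
    for c :: "nat \<Rightarrow> real" and H R
  proof -
    \<comment> \<open>The coefficients of the combination: the factor is 0 at i = n+1, while at i =
      0 it is at least 1, so nothing is lost for the leading coefficient.\<close>
    define c' where "c' i = c i * (2 ^ (Suc n - i) - 1)" for i
    define f where "f \<xi> = (\<Sum>i\<le>Suc n. c i / \<xi> ^ i)" for \<xi>
    have "\<bar>\<Sum>i\<le>n. c' i / \<xi> ^ i\<bar> \<le> (K * H) * \<xi> ^ e" if \<xi>: "\<xi> \<ge> R" for \<xi>
    proof -
      have pos: "\<xi> > 0" using \<xi> H by simp
      have "(\<Sum>i\<le>n. c' i / \<xi> ^ i) = (\<Sum>i\<le>Suc n. c' i / \<xi> ^ i)" by (simp add: c'_def)
      also have "\<dots> = (\<Sum>i\<le>Suc n. 2 ^ Suc n * (c i / (2 * \<xi>) ^ i) - c i / \<xi> ^ i)"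
      proof (rule sum.cong[OF refl])
        fix i assume "i \<in> {..Suc n}"
        then have "(2::real) ^ Suc n = 2 ^ (Suc n - i) * 2 ^ i" by (simp flip: power_add)
        then have "2 ^ Suc n * (c i / (2 * \<xi>) ^ i) = c i * 2 ^ (Suc n - i) / \<xi> ^ i"
          by (simp only: power_mult_distrib) (simp add: field_simps)
        then show "c' i / \<xi> ^ i = 2 ^ Suc n * (c i / (2 * \<xi>) ^ i) - c i / \<xi> ^ i"
          by (simp only: c'_def right_diff_distrib diff_divide_distrib mult_1_right)
      qed
      also have "\<dots> = 2 ^ Suc n * f (2 * \<xi>) - f \<xi>" unfolding f_def by (simp only: sum_subtractf sum_distrib_left)
      finally have "\<bar>\<Sum>i\<le>n. c' i / \<xi> ^ i\<bar> \<le> 2 ^ Suc n * \<bar>f (2 * \<xi>)\<bar> + \<bar>f \<xi>\<bar>"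
        using abs_triangle_ineq4[of "2 ^ Suc n * f (2 * \<xi>)" "f \<xi>"] by (simp add: abs_mult)
      also have "\<dots> \<le> 2 ^ Suc n * (H * (2 * \<xi>) ^ e) + H * \<xi> ^ e"
      proof (intro add_mono mult_left_mono)
        show "\<bar>f (2 * \<xi>)\<bar> \<le> H * (2 * \<xi>) ^ e"
          unfolding f_def by (rule b[rule_format]) (use \<xi> pos in linarith)
        show "\<bar>f \<xi>\<bar> \<le> H * \<xi> ^ e" unfolding f_def by (rule b[rule_format, OF \<xi>])
      qed simp
      also have "\<dots> = (K * H) * \<xi> ^ e" by (simp add: K_def power_mult_distrib algebra_simps)
      finally show ?thesis .
    qed
    then have "\<bar>c' 0\<bar> \<le> C * (K * H) * R ^ e" using K H by (intro C(2)) auto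
    moreover have "\<bar>c 0\<bar> * 1 \<le> \<bar>c' 0\<bar>"
    proof -
      have "(1::real) \<le> 2 ^ Suc n - 1" using one_le_power[of "2::real" n] by simp
      then have "1 \<le> \<bar>(2::real) ^ Suc n - 1\<bar>" by linarith
      then have "\<bar>c 0\<bar> * 1 \<le> \<bar>c 0\<bar> * \<bar>2 ^ Suc n - 1\<bar>" by (rule mult_left_mono) simp
      then show ?thesis by (simp only: c'_def abs_mult diff_zero)
    qed
    ultimately show ?thesis by (simp add: mult.assoc)
  qed
  then show ?case using C(1) K by (intro exI[of _ "C * K"]) auto
qed

theorem theorem1:
  fixes k m :: nat and a b :: "nat \<Rightarrow> real \<Rightarrow> complex"
  assumes "k \<ge> 3" and "1 \<le> m" and "m \<le> k - 2"
    and "\<And>j. j \<le> k - 2 \<Longrightarrow> a j \<in> Cbar_infinity"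
    and "self_adjoint_mod_S0 (diff_op (k - 2) a)"
    and "\<And>j. j \<le> m \<Longrightarrow> b j \<in> Cbar_infinity"
    and "L2_wellposed (distr_L k m a b)"
  shows "\<exists>C>0. \<forall>x y :: real.
    \<bar>LBINT s=ereal x..ereal y. Im (b m s)\<bar>
      \<le> C * \<bar>x - y\<bar> powr ((real k - 1 - real m) / (real k - 1))"
proof -
  note k = assms(1) and m = assms(2,3) and a = assms(4) and b = assms(6)
  have k2: "k \<ge> 2" using k by simp
  have sa: "smooth (a j)" if "j \<le> k - 2" for j using a[OF that] by (rule Cbar_smooth)
  have sb: "smooth (b j)" if "j \<le> m" for j using b[OF that] by (rule Cbar_smooth)
  define q where "q j x = a j x + (if j \<le> m then b j x else 0)" for j x
  have q: "q j \<in> Cbar_infinity" if "j \<le> k - 2" for j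
    unfolding q_def by (intro Cbar_add Cbar_if a that b)
  \<comment> \<open>The time 2 leaves all times up to 1, as required in \<open>energy_bound\<close>,
    strictly inside the interval.\<close>
  obtain M U where "solution_group k (opcoeff k m a b) 2 M U"
    using wellposed_solution_group[of k a m b 2] sa sb m(2) assms(7) by auto
  then interpret SG: solution_group k "opcoeff k m a b" 2 M U .
  have e1: "energy_bound k (opcoeff k m a b) M" by (rule SG.energy_bound) simp
  obtain M0 where e0: "energy_bound k (opcoeff k m a (\<lambda>j x. 0)) M0"
    using self_adjoint_energy_bound[of k a m] a assms(5) m(2) k2 by blast
  obtain \<psi> where \<psi>: "\<psi> \<in> LP (-1)" "Res k q \<psi> \<in> LP 0" using WKB_exists[of k q] k2 q by blast
  obtain \<psi>0 where \<psi>0: "\<psi>0 \<in> LP (-1)" "Res k a \<psi>0 \<in> LP 0" using WKB_exists[of k a] k2 a by blast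
  have ad: "\<exists>F. \<forall>x. (F has_vector_derivative f x) (at x)" if "f \<in> Cbar_infinity" for f :: "real \<Rightarrow> complex"
    using antiderivative_exists[OF smooth_continuous[OF Cbar_smooth[OF that]]] by metis
  have "\<exists>F. \<forall>x. \<xi> \<ge> 1 \<longrightarrow> (F has_vector_derivative \<psi> \<xi> x) (at x)" for \<xi> using ad LP_Cbar[OF \<psi>(1)] by blast
  then obtain \<Gamma> where \<Gamma>: "\<And>\<xi> x. \<xi> \<ge> 1 \<Longrightarrow> (\<Gamma> \<xi> has_vector_derivative \<psi> \<xi> x) (at x)" by metis
  have "\<exists>F. \<forall>x. \<xi> \<ge> 1 \<longrightarrow> (F has_vector_derivative \<psi>0 \<xi> x) (at x)" for \<xi> using ad LP_Cbar[OF \<psi>0(1)] by blast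
  then obtain \<Gamma>0 where \<Gamma>0: "\<And>\<xi> x. \<xi> \<ge> 1 \<Longrightarrow> (\<Gamma>0 \<xi> has_vector_derivative \<psi>0 \<xi> x) (at x)" by metis
  interpret W: wkb k q "opcoeff k m a b" M \<psi> \<Gamma>
    by unfold_locales (use k q e1 \<psi> \<Gamma> in \<open>auto simp: diff_op_opcoeff[OF m(2) k2] q_def[abs_def]\<close>)
  interpret W0: wkb k a "opcoeff k m a (\<lambda>j x. 0)" M0 \<psi>0 \<Gamma>0
    by unfold_locales (use k a e0 \<psi>0 \<Gamma>0 in \<open>auto simp: diff_op_opcoeff[OF m(2) k2]\<close>)
  obtain G1 where G1: "\<And>\<xi> x y. \<xi> \<ge> 1 \<Longrightarrow> \<bar>x - y\<bar> \<le> \<xi> ^ (k - 1) \<Longrightarrow> \<bar>Im (\<Gamma> \<xi> x) - Im (\<Gamma> \<xi> y)\<bar> \<le> G1"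
    using W.variation_bound by blast
  obtain G0 where G0: "\<And>\<xi> x y. \<xi> \<ge> 1 \<Longrightarrow> \<bar>x - y\<bar> \<le> \<xi> ^ (k - 1) \<Longrightarrow> \<bar>Im (\<Gamma>0 \<xi> x) - Im (\<Gamma>0 \<xi> y)\<bar> \<le> G0"
    using W0.variation_bound by blast
  define G where "G = G1 + G0"
  have G_nn: "G \<ge> 0" using G1[of 1 0 0] G0[of 1 0 0] by (simp add: G_def)
  \<comment> \<open>\<open>b m\<close> enters the phase difference with the power -e of
    \<xi>.\<close>
  define e where "e = k - 1 - m"
  have ek: "int e = int k - 1 - int m" "e + m = k - 1" using m k by (auto simp: e_def of_nat_diff)
  have "(\<lambda>\<xi> x. \<psi> \<xi> x - \<psi>0 \<xi> x + b m x / of_nat k * complex_of_real (\<xi> powi (int m - int k + 1))) \<in> LP (int m - int k)"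
    by (rule WKB_compare[OF k m a b \<psi>(1) \<psi>(2)[unfolded q_def[abs_def]] \<psi>0])
  then obtain N g where g: "\<And>i. g i \<in> Cbar_infinity"
    "\<And>\<xi> x. \<xi> \<ge> 1 \<Longrightarrow> \<psi> \<xi> x - \<psi>0 \<xi> x + b m x / of_nat k * complex_of_real (\<xi> powi (int m - int k + 1))
      = (\<Sum>i\<le>(N::nat). g i x * complex_of_real (\<xi> powi (int m - int k - int i)))"
    unfolding LP_def mem_Collect_eq by blast
  obtain \<beta> where \<beta>: "\<And>x. (\<beta> has_vector_derivative b m x) (at x)" using ad[OF b[OF order_refl]] by blast
  have "\<exists>F. \<forall>x. (F has_vector_derivative g i x) (at x)" for i by (rule ad[OF g(1)])
  then obtain \<gamma> where \<gamma>: "\<And>i x. (\<gamma> i has_vector_derivative g i x) (at x)" by metis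
  \<comment> \<open>Index 0 carries the primitive that is wanted; the remainder coefficients are
    shifted by one, being one order lower.\<close>
  define J where "J i x = (case i of 0 \<Rightarrow> - (1 / of_nat k) * \<beta> x | Suc i \<Rightarrow> \<gamma> i x)" for i x
  have imr: "Im (z * complex_of_real r) = Im z * r" "Im (complex_of_real r * z) = r * Im z" for z r by simp_all
  have expand: "\<bar>\<Sum>i\<le>Suc N. (Im (J i x) - Im (J i y)) / \<xi> ^ i\<bar> \<le> G * \<xi> ^ e"
    if \<xi>: "\<xi> \<ge> 1" and xy: "\<bar>x - y\<bar> \<le> \<xi> ^ (k - 1)" for \<xi> x y
  proof -
    \<comment> \<open>The phase difference minus its integrated expansion. Its derivative is zero,
      so it takes equal values at \<open>x\<close> and \<open>y\<close>, and the variation bounds of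
      both phases pass to the expansion.\<close>
    define F where "F x = \<Gamma> \<xi> x - \<Gamma>0 \<xi> x - (\<Sum>i\<le>Suc N. J i x * complex_of_real (1 / (\<xi> ^ e * \<xi> ^ i)))" for x
    have pw: "\<xi> powi (int m - int k + 1 - int i) = 1 / (\<xi> ^ e * \<xi> ^ i)" for i
    proof -
      have "int m - int k + 1 - int i = - int (e + i)" using ek by simp
      then show ?thesis by (simp only: power_int_minus power_int_of_nat power_add inverse_eq_divide)
    qed
    have "(F has_vector_derivative 0) (at x)" for x
    proof -
      have Jd: "(J i has_vector_derivative (case i of 0 \<Rightarrow> - (1 / of_nat k) * b m x | Suc i \<Rightarrow> g i x)) (at x)" for i
      proof (cases i)
        case 0
        have "((\<lambda>x. - (1 / of_nat k) * \<beta> x) has_vector_derivative - (1 / of_nat k) * b m x) (at x)"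
          by (rule bounded_linear.has_vector_derivative[OF bounded_linear_mult_right \<beta>])
        then show ?thesis by (simp add: 0 J_def[abs_def])
      next
        case (Suc j) then show ?thesis using \<gamma>[of j x] by (simp add: J_def[abs_def])
      qed
      have "(F has_vector_derivative \<psi> \<xi> x - \<psi>0 \<xi> x
          - (\<Sum>i\<le>Suc N. (case i of 0 \<Rightarrow> - (1 / of_nat k) * b m x | Suc i \<Rightarrow> g i x) * complex_of_real (1 / (\<xi> ^ e * \<xi> ^ i)))) (at x)"
        unfolding F_def[abs_def]
        by (intro has_vector_derivative_diff has_vector_derivative_sum \<Gamma>[OF \<xi>] \<Gamma>0[OF \<xi>]
            bounded_linear.has_vector_derivative[OF bounded_linear_mult_left Jd])
      moreover have "(\<Sum>i\<le>Suc N. (case i of 0 \<Rightarrow> - (1 / of_nat k) * b m x | Suc i \<Rightarrow> g i x) * complex_of_real (1 / (\<xi> ^ e * \<xi> ^ i)))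
          = \<psi> \<xi> x - \<psi>0 \<xi> x"
      proof -
        have "(\<Sum>i\<le>N. g i x * complex_of_real (1 / (\<xi> ^ e * \<xi> ^ Suc i))) = (\<Sum>i\<le>N. g i x * complex_of_real (\<xi> powi (int m - int k - int i)))"
        proof (rule sum.cong[OF refl])
          fix i
          have "int m - int k - int i = int m - int k + 1 - int (Suc i)" by simp
          then show "g i x * complex_of_real (1 / (\<xi> ^ e * \<xi> ^ Suc i)) = g i x * complex_of_real (\<xi> powi (int m - int k - int i))"
            using pw[of "Suc i"] by (simp only:)
        qed
        also have "\<dots> = \<psi> \<xi> x - \<psi>0 \<xi> x + b m x / of_nat k * complex_of_real (1 / (\<xi> ^ e * \<xi> ^ 0))"
        proof -
          have "1 / (\<xi> ^ e * \<xi> ^ 0) = \<xi> powi (int m - int k + 1)" using pw[of 0] by simp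
          then show ?thesis by (simp only: g(2)[OF \<xi>])
        qed
        finally show ?thesis by (subst sum.atMost_Suc_shift) simp
      qed
      ultimately show ?thesis by simp
    qed
    then have "(F has_vector_derivative 0) (at x within UNIV)" for x by simp
    then obtain c where "\<And>x. F x = c" using has_vector_derivative_zero_constant[of UNIV F] by auto
    then have "Im (F x) = Im (F y)" by simp
    then have "(Im (\<Gamma> \<xi> x) - Im (\<Gamma> \<xi> y)) - (Im (\<Gamma>0 \<xi> x) - Im (\<Gamma>0 \<xi> y))
        = (\<Sum>i\<le>Suc N. Im (J i x) * (1 / (\<xi> ^ e * \<xi> ^ i))) - (\<Sum>i\<le>Suc N. Im (J i y) * (1 / (\<xi> ^ e * \<xi> ^ i)))"
      unfolding F_def minus_complex.sel Im_sum imr by linarith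
    also have "\<dots> = (\<Sum>i\<le>Suc N. (Im (J i x) - Im (J i y)) / \<xi> ^ i) / \<xi> ^ e"
      unfolding sum_subtractf[symmetric] sum_divide_distrib
      by (intro sum.cong refl) (simp add: diff_divide_distrib mult.commute)
    finally have "\<bar>(\<Sum>i\<le>Suc N. (Im (J i x) - Im (J i y)) / \<xi> ^ i) / \<xi> ^ e\<bar> \<le> G"
      using G1[OF \<xi> xy] G0[OF \<xi> xy] unfolding G_def by linarith
    then show ?thesis using \<xi> by (simp add: abs_divide divide_le_eq)
  qed
  obtain C where C: "C \<ge> 0" "\<And>(c::nat \<Rightarrow> real) H R. H \<ge> 0 \<Longrightarrow> R \<ge> 1 \<Longrightarrow>
    (\<forall>\<xi>\<ge>R. \<bar>\<Sum>i\<le>Suc N. c i / \<xi> ^ i\<bar> \<le> H * \<xi> ^ e) \<Longrightarrow> \<bar>c 0\<bar> \<le> C * H * R ^ e"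
    using leading_coefficient_bound[of "Suc N" e] by blast
  obtain K where K: "K \<ge> 0" "\<And>x. cmod (b m x) \<le> K" using Cbar_bound[OF b[OF order_refl]] by blast
  define p where "p = (real k - 1 - real m) / (real k - 1)"
  have p: "p = real e / real (k - 1)" "0 \<le> p" "p \<le> 1"
    using ek m k by (auto simp: p_def of_nat_diff divide_le_eq)
  have int: "(LBINT s=ereal x..ereal y. Im (b m s)) = Im (\<beta> y) - Im (\<beta> x)" for x y
  proof (rule interval_integral_FTC_finite)
    show "continuous_on {min x y..max x y} (\<lambda>s. Im (b m s))"
      by (intro continuous_intros smooth_continuous sb order_refl)
    show "((\<lambda>s. Im (\<beta> s)) has_vector_derivative Im (b m s)) (at s within {min x y..max x y})" for s
      by (rule has_vector_derivative_at_within, rule bounded_linear.has_vector_derivative[OF bounded_linear_Im \<beta>])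
  qed
  \<comment> \<open>One constant for both ranges of the distance: the first summand serves distances
    of at least 1, \<open>K\<close> the short ones, and the 1 makes it positive.\<close>
  have "\<bar>Im (\<beta> y) - Im (\<beta> x)\<bar> \<le> (real k * (C * G) + K + 1) * \<bar>x - y\<bar> powr p" for x y
  proof (cases "\<bar>x - y\<bar> \<ge> 1")
    case True
    \<comment> \<open>The frequency at which \<open>\<xi>\<^sup>k\<^sup>-\<^sup>1\<close> equals the
      distance. All larger frequencies are admissible in \<open>expand\<close>, and
      \<open>R ^ e\<close> is the asserted power.\<close>
    define R where "R = \<bar>x - y\<bar> powr (1 / real (k - 1))"
    have k1: "real (k - 1) > 0" using k by simp
    have R: "R \<ge> 1" unfolding R_def using True by (simp add: ge_one_powr_ge_zero)
    have Rpow: "R ^ j = \<bar>x - y\<bar> powr (real j / real (k - 1))" for j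
    proof -
      have "R ^ j = R powr real j" using R by (simp add: powr_realpow)
      then show ?thesis unfolding R_def powr_powr by simp
    qed
    have Rk: "R ^ (k - 1) = \<bar>x - y\<bar>" unfolding Rpow using k1 True by simp
    have "\<bar>Im (J 0 x) - Im (J 0 y)\<bar> \<le> C * G * R ^ e"
    proof (rule C(2)[OF G_nn R, of "\<lambda>i. Im (J i x) - Im (J i y)"], intro allI impI)
      fix \<xi> assume \<xi>: "\<xi> \<ge> R"
      have "\<bar>x - y\<bar> \<le> \<xi> ^ (k - 1)" unfolding Rk[symmetric] by (rule power_mono[OF \<xi>]) (use R in simp)
      then show "\<bar>\<Sum>i\<le>Suc N. (Im (J i x) - Im (J i y)) / \<xi> ^ i\<bar> \<le> G * \<xi> ^ e"
        using \<xi> R by (intro expand) auto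
    qed
    moreover have "Im (J 0 x) - Im (J 0 y) = (Im (\<beta> y) - Im (\<beta> x)) / real k"
    proof -
      have "J 0 z = complex_of_real (- 1 / real k) * \<beta> z" for z by (simp add: J_def)
      then have "Im (J 0 z) = (- 1 / real k) * Im (\<beta> z)" for z by (simp only: imr)
      then show ?thesis by (simp add: diff_divide_distrib)
    qed
    ultimately have "\<bar>(Im (\<beta> y) - Im (\<beta> x)) / real k\<bar> \<le> C * G * \<bar>x - y\<bar> powr p"
      using Rpow[of e] by (simp only: p(1))
    then have "\<bar>Im (\<beta> y) - Im (\<beta> x)\<bar> \<le> real k * (C * G * \<bar>x - y\<bar> powr p)"
      using k by (simp add: abs_divide divide_le_eq mult.commute)
    also have "\<dots> \<le> (real k * (C * G) + K + 1) * \<bar>x - y\<bar> powr p"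
    proof -
      have "(real k * (C * G)) * \<bar>x - y\<bar> powr p \<le> (real k * (C * G) + K + 1) * \<bar>x - y\<bar> powr p"
        by (rule mult_right_mono) (use K in auto)
      then show ?thesis by (simp only: mult.assoc)
    qed
    finally show ?thesis .
  next
    case False
    \<comment> \<open>At distances below 1 the Lipschitz bound is stronger than the claim, because
      the exponent \<open>p\<close> is at most 1.\<close>
    have "norm (\<beta> y - \<beta> x) \<le> K * norm (y - x)"
    proof (rule differentiable_bound[where S = UNIV and f' = "\<lambda>s t. t *\<^sub>R b m s"])
      fix s
      show "(\<beta> has_derivative (\<lambda>t. t *\<^sub>R b m s)) (at s within UNIV)"
        using \<beta>[of s] by (simp add: has_vector_derivative_def)
      show "onorm (\<lambda>t. t *\<^sub>R b m s) \<le> K"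
      proof (rule onorm_le)
        show "norm (t *\<^sub>R b m s) \<le> K * norm t" for t
          unfolding norm_scaleR real_norm_def mult.commute[of K] by (rule mult_left_mono[OF K(2)]) simp
      qed
    qed auto
    then have "\<bar>Im (\<beta> y) - Im (\<beta> x)\<bar> \<le> K * \<bar>x - y\<bar>"
      using abs_Im_le_cmod[of "\<beta> y - \<beta> x"] by (simp add: abs_minus_commute)
    also have "\<dots> \<le> K * \<bar>x - y\<bar> powr p"
    proof (rule mult_left_mono[OF _ K(1)])
      show "\<bar>x - y\<bar> \<le> \<bar>x - y\<bar> powr p"
      proof (cases "x = y")
        case xy: False
        then show ?thesis using powr_mono'[of p 1 "\<bar>x - y\<bar>"] p False by simp
      qed simp
    qed
    also have "\<dots> \<le> (real k * (C * G) + K + 1) * \<bar>x - y\<bar> powr p"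
      by (rule mult_right_mono) (use C(1) G_nn in auto)
    finally show ?thesis .
  qed
  moreover have "real k * (C * G) + K + 1 > 0"
    using C(1) G_nn K(1) by (intro add_nonneg_pos add_nonneg_nonneg mult_nonneg_nonneg) auto
  ultimately show ?thesis unfolding int p_def by blast
qed

end
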